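(* Let $p\neq q$ be odd prime numbers. Let $B$ be a free $\mathbb{Z}_{p^k}$-module of rank $n>0$, for some $k>0$, and let $\beta\colon B\times B\to\mathbb{Z}_{p^k}$ be a non-degenerate symmetric bilinear form. Let $s$ be the maximal integer such that $q^s\mid (p^{2[q|p]}-1)$. Fix an integer $r>0$ and set $\widetilde{r}=\max(r-s,0)$. (a) There exists an isometry of $(B,\beta)$ of order $q^r$ if and only if $n\ge 2[q|p]q^{\widetilde{r}}+1$, or $n=2[q|p]q^{\widetilde{r}}$ and $\epsilon(B,\beta)=\eta(q)$. (b) There exists an isometry of $(B,\beta)$ of order $q^r$ with no non-zero fixed points if and only if $n=2[q|p]d$ for some integer $d\ge q^{\widetilde{r}}$ and $\epsilon(B,\beta)=\eta(q)^d$.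
   Context: $\mathbb{Z}_{m}$ denotes $\mathbb{Z}/m\mathbb{Z}$. Non-degenerate means: if $\beta(x,y)=0$ for all $y\in B$ then $x=0$. An isometry is a $\mathbb{Z}_{p^k}$-module automorphism preserving $\beta$. For a prime $p$ and an odd number $m$ coprime with $p$, $[m|p]$ denotes the minimal positive exponent $t$ such that either $m\mid (p^t-1)$ or $m\mid (p^t+1)$. One sets $\eta(m)=1$ if $m\mid (p^{[m|p]}-1)$ and $\eta(m)=-1$ if $m\mid (p^{[m|p]}+1)$. Index: for $p$ odd, every non-degenerate symmetric bilinear form $(B,\beta)$ on a free $\mathbb{Z}_{p^k}$-module of rank $n$ is isometric to exactly one of: the standard form $\beta(x,y)=\sum_i x_iy_i$, or the non-standard form $\beta(x,y)=\tau x_1y_1+\sum_{i>1}x_iy_i$, where $\tau$ is a unit that is not a square modulo $p^k$. The index is $\epsilon(B,\beta)=\epsilon_1\epsilon_2$, where $\epsilon_1=1$ if the form is standard and $\epsilon_1=-1$ otherwise, and $\epsilon_2=-1$ if $p\equiv 3\bmod 4$ and $n\equiv 2\bmod 4$, and $\epsilon_2=1$ otherwise. *)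

theory Defs
  imports
    "HOL-Number_Theory.Residues"
    "HOL-Algebra.Bij"
    "HOL-Algebra.Multiplicative_Group"
    "Jordan_Normal_Form.Missing_VectorSpace"
begin

section \<open>The numerical invariants\<close>

definition min_exp :: "nat \<Rightarrow> nat \<Rightarrow> nat" where
  "min_exp m p = (LEAST t. 0 < t \<and> (m dvd p ^ t - 1 \<or> m dvd p ^ t + 1))"

text \<open>For \<open>m > 2\<close> the integer \<open>m\<close> divides exactly one of \<open>p ^ min_exp m p - 1\<close> and
  \<open>p ^ min_exp m p + 1\<close> (if \<open>m\<close> is coprime to \<open>p\<close>); for \<open>m = 1\<close> the first alternative takes precedence.\<close>

definition eta :: "nat \<Rightarrow> nat \<Rightarrow> int" where
  "eta m p = (if m dvd p ^ min_exp m p - 1 then 1 else - 1)"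

section \<open>Free modules and bilinear forms\<close>

definition free_of_rank ::
    "('a, 'r) ring_scheme \<Rightarrow> ('a, 'b, 'm) module_scheme \<Rightarrow> nat \<Rightarrow> bool" where
  "free_of_rank R M n \<longleftrightarrow> module R M \<and>
     (\<exists>A. A \<subseteq> carrier M \<and> finite A \<and> card A = n \<and>
          \<not> module.lin_dep R M A \<and> module.span R M A = carrier M)"

definition bilinear_form ::
    "('a, 'r) ring_scheme \<Rightarrow> ('a, 'b, 'm) module_scheme \<Rightarrow> ('b \<Rightarrow> 'b \<Rightarrow> 'a) \<Rightarrow> bool" where
  "bilinear_form R M \<beta> \<longleftrightarrow>
     (\<forall>x\<in>carrier M. \<forall>y\<in>carrier M. \<beta> x y \<in> carrier R) \<and>
     (\<forall>x\<in>carrier M. \<forall>y\<in>carrier M. \<forall>z\<in>carrier M.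
        \<beta> (x \<oplus>\<^bsub>M\<^esub> y) z = \<beta> x z \<oplus>\<^bsub>R\<^esub> \<beta> y z \<and>
        \<beta> z (x \<oplus>\<^bsub>M\<^esub> y) = \<beta> z x \<oplus>\<^bsub>R\<^esub> \<beta> z y) \<and>
     (\<forall>a\<in>carrier R. \<forall>x\<in>carrier M. \<forall>y\<in>carrier M.
        \<beta> (a \<odot>\<^bsub>M\<^esub> x) y = a \<otimes>\<^bsub>R\<^esub> \<beta> x y \<and>
        \<beta> x (a \<odot>\<^bsub>M\<^esub> y) = a \<otimes>\<^bsub>R\<^esub> \<beta> x y)"

definition symmetric_form ::
    "('a, 'b, 'm) module_scheme \<Rightarrow> ('b \<Rightarrow> 'b \<Rightarrow> 'a) \<Rightarrow> bool" where
  "symmetric_form M \<beta> \<longleftrightarrow> (\<forall>x\<in>carrier M. \<forall>y\<in>carrier M. \<beta> x y = \<beta> y x)"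

definition nondegenerate_form ::
    "('a, 'r) ring_scheme \<Rightarrow> ('a, 'b, 'm) module_scheme \<Rightarrow> ('b \<Rightarrow> 'b \<Rightarrow> 'a) \<Rightarrow> bool" where
  "nondegenerate_form R M \<beta> \<longleftrightarrow>
     (\<forall>x\<in>carrier M. (\<forall>y\<in>carrier M. \<beta> x y = \<zero>\<^bsub>R\<^esub>) \<longrightarrow> x = \<zero>\<^bsub>M\<^esub>)"

section \<open>Isometries\<close>

definition is_isometry ::
    "('a, 'r) ring_scheme \<Rightarrow> ('a, 'b, 'm) module_scheme \<Rightarrow> ('b \<Rightarrow> 'b \<Rightarrow> 'a) \<Rightarrow>
     ('a, 'c, 'l) module_scheme \<Rightarrow> ('c \<Rightarrow> 'c \<Rightarrow> 'a) \<Rightarrow> ('b \<Rightarrow> 'c) \<Rightarrow> bool" where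
  "is_isometry R M \<beta> N \<gamma> f \<longleftrightarrow>
     f \<in> LinearCombinations.module_hom R M N \<and> bij_betw f (carrier M) (carrier N) \<and>
     (\<forall>x\<in>carrier M. \<forall>y\<in>carrier M. \<gamma> (f x) (f y) = \<beta> x y)"

text \<open>As in \<^const>\<open>BijGroup\<close>, elements are functions that are \<^const>\<open>undefined\<close>
  outside the carrier, so that each isometry is represented by exactly one function.\<close>

definition isometry_group ::
    "('a, 'r) ring_scheme \<Rightarrow> ('a, 'b, 'm) module_scheme \<Rightarrow> ('b \<Rightarrow> 'b \<Rightarrow> 'a) \<Rightarrow> ('b \<Rightarrow> 'b) monoid"
  where
  "isometry_group R M \<beta> =
     BijGroup (carrier M) \<lparr>carrier := {f \<in> Bij (carrier M). is_isometry R M \<beta> M \<beta> f}\<rparr>"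

lemma group_isometry_group:
  assumes "module R M"
  shows "group (isometry_group R M \<beta>)"
proof -
  interpret module R M by (rule assms)
  interpret B: group "BijGroup (carrier M)" by (rule group_BijGroup)
  let ?S = "{f \<in> Bij (carrier M). is_isometry R M \<beta> M \<beta> f}"
  have "subgroup ?S (BijGroup (carrier M))"
  proof (rule B.subgroupI)
    show "?S \<subseteq> carrier (BijGroup (carrier M))"
      by (auto simp: BijGroup_def)
    have "(\<lambda>x\<in>carrier M. x) \<in> ?S"
      using id_Bij[of "carrier M"]
      by (auto simp: is_isometry_def LinearCombinations.module_hom_def Bij_def)
    then show "?S \<noteq> {}" by blast
  next
    fix f g assume f: "f \<in> ?S" and g: "g \<in> ?S"
    have fB: "f \<in> Bij (carrier M)" and gB: "g \<in> Bij (carrier M)"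
      using f g by simp_all
    have fc: "f x \<in> carrier M" and gc: "g x \<in> carrier M" if "x \<in> carrier M" for x
      using Bij_imp_funcset[OF fB] Bij_imp_funcset[OF gB] that by (simp_all add: Pi_iff)
    have cB: "compose (carrier M) f g \<in> Bij (carrier M)"
      by (rule compose_Bij[OF fB gB])
    then have "bij_betw (compose (carrier M) f g) (carrier M) (carrier M)"
      by (simp add: Bij_def)
    then have "compose (carrier M) f g \<in> ?S"
      using f g cB fc gc
      by (simp add: is_isometry_def LinearCombinations.module_hom_def Pi_iff compose_def)
    then show "f \<otimes>\<^bsub>BijGroup (carrier M)\<^esub> g \<in> ?S"
      using fB gB by (simp add: BijGroup_def)
  next
    fix f assume f: "f \<in> ?S"
    define g where "g = (\<lambda>x\<in>carrier M. inv_into (carrier M) f x)"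
    have fB: "f \<in> Bij (carrier M)"
      and add: "\<And>x y. x \<in> carrier M \<Longrightarrow> y \<in> carrier M \<Longrightarrow> f (x \<oplus>\<^bsub>M\<^esub> y) = f x \<oplus>\<^bsub>M\<^esub> f y"
      and sm: "\<And>a x. a \<in> carrier R \<Longrightarrow> x \<in> carrier M \<Longrightarrow> f (a \<odot>\<^bsub>M\<^esub> x) = a \<odot>\<^bsub>M\<^esub> f x"
      and iso: "\<And>x y. x \<in> carrier M \<Longrightarrow> y \<in> carrier M \<Longrightarrow> \<beta> (f x) (f y) = \<beta> x y"
      using f by (auto simp: is_isometry_def LinearCombinations.module_hom_def)
    have bij: "bij_betw f (carrier M) (carrier M)" using fB by (simp add: Bij_def)
    have gB: "g \<in> Bij (carrier M)" unfolding g_def by (rule restrict_inv_into_Bij[OF fB])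
    have gc: "g x \<in> carrier M" if "x \<in> carrier M" for x
      using that Bij_inv_into_mem[OF fB that] by (simp add: g_def)
    have fg: "f (g x) = x" if "x \<in> carrier M" for x
      using that bij by (simp add: g_def bij_betw_inv_into_right)
    have gf: "g (f x) = x" if "x \<in> carrier M" for x
      using that bij bij_betwE[OF bij] by (simp add: g_def bij_betw_inv_into_left)
    have "g (x \<oplus>\<^bsub>M\<^esub> y) = g x \<oplus>\<^bsub>M\<^esub> g y" if "x \<in> carrier M" "y \<in> carrier M" for x y
      by (metis gf add gc fg M.a_closed that)
    moreover have "g (a \<odot>\<^bsub>M\<^esub> x) = a \<odot>\<^bsub>M\<^esub> g x" if "a \<in> carrier R" "x \<in> carrier M" for a x
      by (metis gf sm gc fg smult_closed that)
    moreover have "\<beta> (g x) (g y) = \<beta> x y" if "x \<in> carrier M" "y \<in> carrier M" for x y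
      using iso[of "g x" "g y"] that by (simp only: gc fg)
    moreover have "g \<in> carrier M \<rightarrow> carrier M"
      using gc by (rule Pi_I)
    moreover have "bij_betw g (carrier M) (carrier M)"
      using gB unfolding Bij_def by (rule IntD2[THEN CollectD])
    ultimately have "is_isometry R M \<beta> M \<beta> g"
      unfolding is_isometry_def LinearCombinations.module_hom_def mem_Collect_eq
      by (intro conjI allI impI ballI) (elim conjE, assumption | metis)+
    moreover have "inv\<^bsub>BijGroup (carrier M)\<^esub> f = g"
    proof (rule B.inv_equality)
      show "g \<otimes>\<^bsub>BijGroup (carrier M)\<^esub> f = \<one>\<^bsub>BijGroup (carrier M)\<^esub>"
        using fB gB Bij_compose_restrict_eq[OF fB] by (simp add: BijGroup_def g_def)
    qed (use fB gB in \<open>simp_all add: BijGroup_def\<close>)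
    ultimately show "inv\<^bsub>BijGroup (carrier M)\<^esub> f \<in> ?S" using gB by simp
  qed
  then show ?thesis
    unfolding isometry_group_def by (rule B.subgroup_imp_group)
qed

section \<open>The index of a form over the integers modulo a prime power\<close>

definition std_form :: "('a, 'r) ring_scheme \<Rightarrow> nat \<Rightarrow> (nat \<Rightarrow> 'a) \<Rightarrow> (nat \<Rightarrow> 'a) \<Rightarrow> 'a" where
  "std_form R n x y = (\<Oplus>\<^bsub>R\<^esub>i\<in>{..<n}. x i \<otimes>\<^bsub>R\<^esub> y i)"

text \<open>The coordinate module of rank \<open>n\<close> is \<^const>\<open>ring.func_space\<close> on \<open>{..<n}\<close>.\<close>

definition is_standard_form ::
    "('a, 'r) ring_scheme \<Rightarrow> nat \<Rightarrow> ('a, 'b, 'm) module_scheme \<Rightarrow> ('b \<Rightarrow> 'b \<Rightarrow> 'a) \<Rightarrow> bool" where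
  "is_standard_form R n M \<beta> \<longleftrightarrow>
     (\<exists>f. is_isometry R M \<beta> (ring.func_space R {..<n}) (std_form R n) f)"

text \<open>Here \<open>n\<close> is the rank of \<open>M\<close> over the ring of integers modulo \<open>p ^ k\<close>.\<close>

definition form_index ::
    "nat \<Rightarrow> nat \<Rightarrow> nat \<Rightarrow> (int, 'b, 'm) module_scheme \<Rightarrow> ('b \<Rightarrow> 'b \<Rightarrow> int) \<Rightarrow> int" where
  "form_index p k n M \<beta> =
     (if is_standard_form (residue_ring (int (p ^ k))) n M \<beta> then 1 else - 1) *
     (if p mod 4 = 3 \<and> n mod 4 = 2 then - 1 else 1)"

end

(* Orbits, on the vectors of a given norm c, of a fixed-point-free isometry of q-power order have
   length divisible by q^r when its minimal blocks do.  For rank 2N and c a unit, the number of such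
   vectors is p^(N-1) (p^N - e) up to a power of p, where e is the discriminant sign; so
   q^r divides p^N - e, which determines rank and index.  Conversely, the blocks arise as
   summands of the permutation module, where the self-adjoint polynomials in the isometry form,
   modulo p, a field fixed by c |-> c^(p^M); this bounds the rank from above.  Forms are classified
   by rank and discriminant class. *)
theory Submission
  imports Defs "HOL-Library.Function_Algebras" "HOL-Library.Product_Plus"
    "HOL-Number_Theory.Number_Theory" "HOL-Computational_Algebra.Polynomial"
begin


section \<open>Rational numbers modulo one and integer multiples\<close>

\<comment> \<open>Two estimates meet at the threshold. From below, counting vectors whose norm is a
  square unit and a nonsquare unit excludes odd rank, and averaging over a group of order q, which
  is invertible modulo p^k, splits off the fixed vectors and reduces an isometry of order q^r to the
  free case. From above, no block is written down: a minimal invariant summand of the permutation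
  module is generated by one vector, and g^2 = tau g - 1 with the self-adjoint element tau = g +
  g^(-1), so modulo p it has at most (p^M)^2 elements. The exponent M = m q^(r-s) is chosen so that
  p^M is eta modulo q^r; then the Frobenius power turns g into g or its inverse and fixes every
  self-adjoint element. The orbit count applied to the block itself forces its rank and sign to be
  the extreme ones. Summands appear as kernels and images of operators, without a basis. A form
  space is therefore axiomatized by nondegeneracy and its analogue modulo p, and orthogonal bases
  are recovered by diagonalization.\<close>
text \<open>Every finite free module over the integers modulo \<open>K\<close> embeds into the abelian group of functions
  \<open>nat \<Rightarrow> qz\<close>, for all \<open>K\<close> at once. This makes type class algebra available although \<open>K\<close> is a variable.\<close>

quotient_type qz = rat / "\<lambda>x y. x - y \<in> \<int>"
  by (auto intro!: equivpI reflpI sympI transpI) (metis Ints_minus minus_diff_eq, metis Ints_add diff_add_cancel add_diff_eq)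

instantiation qz :: ab_group_add
begin
lift_definition zero_qz :: qz is 0 .
lift_definition plus_qz :: "qz \<Rightarrow> qz \<Rightarrow> qz" is "(+)"
  by (metis Ints_add add_diff_add)
lift_definition uminus_qz :: "qz \<Rightarrow> qz" is uminus
  by (metis Ints_minus minus_diff_minus)
definition minus_qz :: "qz \<Rightarrow> qz \<Rightarrow> qz" where "minus_qz x y = x + - y"
instance
  by standard (transfer; simp add: minus_qz_def algebra_simps)+
end

text \<open>\<open>nat\<close> truncates at 0, so at most one of the two iterations is nontrivial,
  and the definition makes sense in every abelian group.\<close>

definition zscale :: "int \<Rightarrow> 'a::ab_group_add \<Rightarrow> 'a" (infixr "*z" 75) where
  "a *z x = ((+) x ^^ nat a) 0 - ((+) x ^^ nat (- a)) 0"

lemma zscale_zero_left [simp]: "0 *z x = 0"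
  by (simp add: zscale_def)

lemma zscale_one [simp]: "1 *z x = x"
  by (simp add: zscale_def)

lemma zscale_succ: "(a + 1) *z x = a *z x + x"
proof (cases "a \<ge> 0")
  case True
  then have "nat (a + 1) = Suc (nat a)" by simp
  then show ?thesis using True by (simp add: zscale_def)
next
  case False
  then have "nat (- a) = Suc (nat (- (a + 1)))" by simp
  then show ?thesis using False by (simp add: zscale_def)
qed

lemma zscale_pred: "(a - 1) *z x = a *z x - x"
  using zscale_succ[of "a - 1" x] by (simp add: algebra_simps)

lemma zscale_add_left: "(a + c) *z x = a *z x + c *z x"
proof (induct c rule: int_induct[where k = 0])
  case (step1 i)
  have "(a + (i + 1)) *z x = (a + i + 1) *z x" by (simp add: algebra_simps)
  then show ?case using step1 by (simp only: zscale_succ) (simp add: algebra_simps)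
next
  case (step2 i)
  have "(a + (i - 1)) *z x = (a + i - 1) *z x" by (simp add: algebra_simps)
  then show ?case using step2 by (simp only: zscale_pred) (simp add: algebra_simps)
qed simp

lemma zscale_add_right: "a *z (x + y) = a *z x + a *z y"
proof (induct a rule: int_induct[where k = 0])
  case (step1 i)
  then show ?case by (simp only: zscale_succ) (simp add: algebra_simps)
next
  case (step2 i)
  then show ?case by (simp only: zscale_pred) (simp add: algebra_simps)
qed simp

lemma zscale_minus_left: "(- a) *z x = - (a *z x)"
  using zscale_add_left[of a "- a" x] by (simp add: eq_neg_iff_add_eq_0 add.commute)

lemma zscale_mult: "a *z c *z x = (a * c) *z x"
proof (induct a rule: int_induct[where k = 0])
  case (step1 i)
  then show ?case by (simp only: zscale_succ distrib_right zscale_add_left mult_1 zscale_one)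
next
  case (step2 i)
  then show ?case by (simp only: zscale_pred left_diff_distrib mult_1)
      (simp add: zscale_add_left zscale_minus_left diff_conv_add_uminus del: add_uminus_conv_diff)
qed simp

interpretation zscale: Modules.module zscale
  by standard (simp_all add: zscale_add_left zscale_add_right zscale_mult)

lemmas zscale_simps = zscale.scale_left_distrib zscale.scale_right_distrib zscale.scale_left_diff_distrib
  zscale.scale_right_diff_distrib

text \<open>Induction in both directions from 0. Because of this fact, the maps and forms below are
  only required to be additive: scalars modulo \<open>p ^ k\<close> act through integer
  multiples.\<close>

lemma additive_zscale:
  assumes "\<And>x y. x \<in> V \<Longrightarrow> y \<in> V \<Longrightarrow> f (x + y) = f x + f y"
    and "\<And>x a. x \<in> V \<Longrightarrow> a *z x \<in> V" and "x \<in> V"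
  shows "f (a *z x) = a *z f x"
proof (induct a rule: int_induct[where k = 0])
  case base
  have "0 \<in> V" using assms(2)[OF assms(3), of 0] by simp
  then show ?case using assms(1)[of 0 0] by simp
next
  case (step1 i)
  then show ?case using assms by (simp add: zscale_succ)
next
  case (step2 i)
  have "f (i *z x) = f ((i - 1) *z x + x)" by (simp add: zscale_pred)
  also have "\<dots> = f ((i - 1) *z x) + f x" using assms by blast
  finally show ?case using step2 by (simp add: zscale_pred algebra_simps)
qed

lemma zscale_fun_apply: "(a *z f) i = a *z f i"
  by (rule additive_zscale[where V = UNIV and f = "\<lambda>f. f i"]) auto

lemma zscale_Pair: "a *z (x, y) = (a *z x, a *z y)"
proof -
  have "fst (a *z (x, y)) = a *z x" "snd (a *z (x, y)) = a *z y"
    using additive_zscale[where V = UNIV and f = fst and x = "(x, y)" and a = a]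
      additive_zscale[where V = UNIV and f = snd and x = "(x, y)" and a = a] by auto
  then show ?thesis by (metis prod.collapse)
qed

text \<open>The class of \<open>a / K\<close>. It identifies the integers modulo \<open>K\<close>
  with the \<open>K\<close>-torsion of Q/Z, so that form values for all moduli share one
  type.\<close>

definition qfrac :: "int \<Rightarrow> int \<Rightarrow> qz" where
  "qfrac K a = abs_qz (of_int a / of_int K)"

lemma qfrac_eq_iff:
  assumes "K > 0"
  shows "qfrac K a = qfrac K c \<longleftrightarrow> [a = c] (mod K)"
proof -
  have "qfrac K a = qfrac K c \<longleftrightarrow> (of_int a / of_int K - of_int c / of_int K :: rat) \<in> \<int>"
    by (simp add: qfrac_def qz.abs_eq_iff)
  also have "(of_int a / of_int K - of_int c / of_int K :: rat) = of_int (a - c) / of_int K"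
    by (simp add: diff_divide_distrib)
  also have "\<dots> \<in> \<int> \<longleftrightarrow> K dvd a - c"
  proof
    assume "(of_int (a - c) / of_int K :: rat) \<in> \<int>"
    then obtain m where "(of_int (a - c) / of_int K :: rat) = of_int m" by (auto elim: Ints_cases)
    then have "(of_int (a - c) :: rat) = of_int (K * m)" using assms by (simp add: field_simps)
    then show "K dvd a - c" by (simp only: of_int_eq_iff) simp
  next
    assume "K dvd a - c"
    then obtain m where "a - c = K * m" by (elim dvdE)
    then show "(of_int (a - c) / of_int K :: rat) \<in> \<int>" using assms by simp
  qed
  finally show ?thesis by (simp add: cong_iff_dvd_diff)
qed

lemma qfrac_0 [simp]: "qfrac K 0 = 0"
  by (simp add: qfrac_def zero_qz.abs_eq)

lemma qfrac_eq_0_iff: "K > 0 \<Longrightarrow> qfrac K a = 0 \<longleftrightarrow> K dvd a"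
  using qfrac_eq_iff[of K a 0] by (simp add: cong_0_iff)

lemma qfrac_add: "qfrac K (a + c) = qfrac K a + qfrac K c"
  by (simp add: qfrac_def plus_qz.abs_eq add_divide_distrib)

lemma zscale_int: "a *z (c::int) = a * c"
  by (induct a rule: int_induct[where k = 0]) (simp_all add: zscale_succ zscale_pred algebra_simps)

lemma zscale_qfrac: "a *z qfrac K c = qfrac K (a * c)"
  using additive_zscale[where V = UNIV and f = "qfrac K" and x = c and a = a]
  by (simp add: qfrac_add zscale_int)

text \<open>If \<open>K * r\<close> is an integer then \<open>r\<close> is a fraction over
  \<open>K\<close>: the \<open>K\<close>-torsion of Q/Z is cyclic.\<close>

lemma qfrac_exists:
  assumes "K > 0" "K *z x = 0"
  obtains a where "x = qfrac K a"
proof -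
  obtain r where r: "x = abs_qz r" by (metis Quotient3_abs_rep[OF Quotient3_qz])
  have "a *z abs_qz r = abs_qz (of_int a * r)" for a
  proof (induct a rule: int_induct[where k = 0])
    case base then show ?case by (simp add: zero_qz.abs_eq)
  next
    case (step1 i) then show ?case by (simp add: zscale_succ plus_qz.abs_eq algebra_simps)
  next
    case (step2 i) then show ?case
      by (simp add: zscale_pred minus_qz_def uminus_qz.abs_eq plus_qz.abs_eq algebra_simps)
  qed
  with assms r have "abs_qz (of_int K * r) = abs_qz 0" by (simp add: zero_qz.abs_eq)
  then obtain m where "of_int K * r = of_int m" by (auto simp: qz.abs_eq_iff elim: Ints_cases)
  then have "r = of_int m / of_int K" using assms by (simp add: field_simps)
  then show ?thesis using r that by (auto simp: qfrac_def)
qed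

text \<open>With \<open>d = p ^ (k - 1)\<close> and \<open>K = p\<close>, multiplication by
  \<open>p ^ (k - 1)\<close> on fractions over \<open>p ^ k\<close> becomes reduction of the
  numerator modulo \<open>p\<close>.\<close>

lemma qfrac_cancel: "d \<noteq> 0 \<Longrightarrow> qfrac (d * K) (d * a) = qfrac K a"
  by (simp add: qfrac_def)


section \<open>Symmetric bilinear forms and orthogonal diagonalization\<close>

locale odd_prime_power =
  fixes p :: int and k :: nat
  assumes prime_p: "prime p" and odd_p: "odd p" and k_pos: "k > 0"
begin

lemma p_gt_2: "p > 2"
  using prime_p odd_p prime_gt_1_int[of p] by (cases "p = 2") auto

lemma p_pos [simp]: "p > 0" and p_nonneg [simp]: "p \<ge> 0" and p_pow_pos [simp]: "p ^ n > 0" and p_nz [simp]: "p \<noteq> 0"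
  using p_gt_2 by auto

lemma k_split: "p ^ k = p * p ^ (k - 1)"
  using k_pos by (cases k) auto

end

text \<open>A \<open>p ^ k\<close>-torsion group is a module over the integers modulo
  \<open>p ^ k\<close>, and the form values are then \<open>p ^ k\<close>-torsion as well
  (\<open>b_torsion\<close>). The locale is weak enough to pass to every subgroup.\<close>

locale bform = odd_prime_power p k for p :: int and k :: nat +
  fixes V :: "'v::ab_group_add set" and b :: "'v \<Rightarrow> 'v \<Rightarrow> qz"
  assumes finite_V: "finite V" and zero_V [simp]: "0 \<in> V"
    and add_V: "x \<in> V \<Longrightarrow> y \<in> V \<Longrightarrow> x + y \<in> V"
    and torsion: "x \<in> V \<Longrightarrow> (p ^ k) *z x = 0"
    and b_add_left: "x \<in> V \<Longrightarrow> y \<in> V \<Longrightarrow> z \<in> V \<Longrightarrow> b (x + y) z = b x z + b y z"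
    and b_sym: "x \<in> V \<Longrightarrow> y \<in> V \<Longrightarrow> b x y = b y x"
begin

abbreviation "fr \<equiv> qfrac (p ^ k)"

text \<open>Torsion replaces \<open>a\<close> by its nonnegative residue modulo
  \<open>p ^ k\<close>, which is a repeated sum; so closure under negatives comes from closure under
  addition.\<close>

lemma scale_V: assumes "x \<in> V" shows "a *z x \<in> V"
proof -
  have nat: "int n *z x \<in> V" for n
  proof (induct n)
    case (Suc n)
    have "int (Suc n) *z x = int n *z x + x" using zscale_succ[of "int n" x] by (simp add: add.commute)
    then show ?case using Suc assms add_V by simp
  qed simp
  have "a *z x = (a mod p ^ k) *z x"
  proof -
    have "a *z x = (a div p ^ k * p ^ k + a mod p ^ k) *z x" by (simp only: div_mult_mod_eq)
    also have "\<dots> = (a div p ^ k) *z (p ^ k) *z x + (a mod p ^ k) *z x"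
      by (simp only: zscale.scale_left_distrib zscale.scale_scale)
    finally show ?thesis using assms torsion by simp
  qed
  then show ?thesis using nat[of "nat (a mod p ^ k)"] by simp
qed

lemma uminus_V: "x \<in> V \<Longrightarrow> - x \<in> V"
  using scale_V[of x "- 1"] by simp

lemma diff_V: "x \<in> V \<Longrightarrow> y \<in> V \<Longrightarrow> x - y \<in> V"
  using add_V[of x "- y"] uminus_V by simp

lemma sum_V: "(\<And>i. i \<in> I \<Longrightarrow> f i \<in> V) \<Longrightarrow> sum f I \<in> V"
  by (induct I rule: infinite_finite_induct) (auto simp: add_V)

lemmas closed = add_V scale_V diff_V uminus_V

lemma b_add_right: "x \<in> V \<Longrightarrow> y \<in> V \<Longrightarrow> z \<in> V \<Longrightarrow> b z (x + y) = b z x + b z y"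
  by (metis add_V b_add_left b_sym)

lemma b_scale_left: "x \<in> V \<Longrightarrow> y \<in> V \<Longrightarrow> b (a *z x) y = a *z b x y"
  by (rule additive_zscale[where V = V and f = "\<lambda>x. b x y"]) (simp_all add: b_add_left scale_V)

lemma b_scale_right: "x \<in> V \<Longrightarrow> y \<in> V \<Longrightarrow> b y (a *z x) = a *z b y x"
  by (metis scale_V b_scale_left b_sym)

lemma b_zero_left [simp]: "y \<in> V \<Longrightarrow> b 0 y = 0"
  using b_scale_left[of 0 y 0] by simp

lemma b_zero_right [simp]: "y \<in> V \<Longrightarrow> b y 0 = 0"
  by (simp add: b_sym[of y 0])

lemma b_diff_left: "x \<in> V \<Longrightarrow> y \<in> V \<Longrightarrow> z \<in> V \<Longrightarrow> b (x - y) z = b x z - b y z"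
  using b_add_left[of "x - y" y z] by (simp add: closed algebra_simps)

lemma b_diff_right: "x \<in> V \<Longrightarrow> y \<in> V \<Longrightarrow> z \<in> V \<Longrightarrow> b z (x - y) = b z x - b z y"
  using b_add_right[of "x - y" y z] by (simp add: closed algebra_simps)

lemma b_sum_left: "(\<And>i. i \<in> I \<Longrightarrow> f i \<in> V) \<Longrightarrow> y \<in> V \<Longrightarrow> b (sum f I) y = (\<Sum>i\<in>I. b (f i) y)"
  by (induct I rule: infinite_finite_induct) (auto simp: b_add_left sum_V)

lemma b_sum_right: "(\<And>i. i \<in> I \<Longrightarrow> f i \<in> V) \<Longrightarrow> y \<in> V \<Longrightarrow> b y (sum f I) = (\<Sum>i\<in>I. b y (f i))"
  by (induct I rule: infinite_finite_induct) (auto simp: b_add_right sum_V)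

lemmas b_simps = b_add_left b_add_right b_diff_left b_diff_right b_scale_left b_scale_right

lemma b_torsion: "x \<in> V \<Longrightarrow> y \<in> V \<Longrightarrow> (p ^ k) *z b x y = 0"
  by (metis b_scale_left torsion b_zero_left)

lemma b_frac: assumes "x \<in> V" "y \<in> V" obtains a where "b x y = fr a"
  using qfrac_exists[OF p_pow_pos[of k] b_torsion[OF assms]] by blast

lemma scale_cong: assumes "x \<in> V" "[a = c] (mod p ^ k)" shows "a *z x = c *z x"
proof -
  obtain m where "a = c + m * p ^ k"
    using assms(2) by (metis cong_iff_lin cong_sym mult.commute)
  then have "a *z x = c *z x + m *z (p ^ k) *z x" by (simp only: zscale.scale_left_distrib zscale.scale_scale)
  then show ?thesis using torsion assms by simp
qed

lemma subspace:
  assumes "U \<subseteq> V" "0 \<in> U" "\<And>x y. x \<in> U \<Longrightarrow> y \<in> U \<Longrightarrow> x + y \<in> U"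
  shows "bform p k U b"
proof
  show "finite U" using assms(1) finite_V finite_subset by blast
  show "b (x + y) z = b x z + b y z" if "x \<in> U" "y \<in> U" "z \<in> U" for x y z
    using that assms(1) b_add_left by blast
  show "b x y = b y x" if "x \<in> U" "y \<in> U" for x y
    using that assms(1) b_sym by blast
qed (use assms prime_p odd_p k_pos torsion in auto)

end

definition perp :: "('v::ab_group_add \<Rightarrow> 'v \<Rightarrow> qz) \<Rightarrow> 'v set \<Rightarrow> 'v \<Rightarrow> 'v set" where
  "perp b V v = {x \<in> V. b x v = 0}"

text \<open>An orthogonal basis with unit norms \<open>us\<close>, recorded as a chain of
  complements: each \<open>v\<close> splits off a free line and the rest continues inside its
  complement. The length is the rank and \<open>prod_list us\<close> the discriminant.\<close>

inductive diag :: "int \<Rightarrow> nat \<Rightarrow> ('v::ab_group_add \<Rightarrow> 'v \<Rightarrow> qz) \<Rightarrow> 'v set \<Rightarrow> int list \<Rightarrow> bool" for p k b where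
  diag_Nil: "diag p k b {0} []"
| diag_Cons: "v \<in> V \<Longrightarrow> b v v = qfrac (p ^ k) u \<Longrightarrow> coprime u p \<Longrightarrow> diag p k b (perp b V v) us \<Longrightarrow>
    diag p k b V (u # us)"

inductive_cases diag_NilE: "diag p k b V []"
inductive_cases diag_ConsE: "diag p k b V (u # us)"

context bform
begin

lemma perp_bform: "v \<in> V \<Longrightarrow> bform p k (perp b V v) b"
  by (rule subspace) (auto simp: perp_def b_add_left add_V)

lemma unit_inverse:
  assumes "coprime u p" obtains u' where "[u * u' = 1] (mod p ^ k)" "coprime u' p"
proof -
  have "coprime u (p ^ k)" using assms by simp
  then obtain u' where u': "[u * u' = 1] (mod p ^ k)" using cong_solve_coprime_int by blast
  have "[u * u' = 1] (mod p)" using u' cong_dvd_modulus k_split dvd_triv_left by metis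
  then have "coprime u' p" by (metis coprime_iff_invertible_int mult.commute)
  then show ?thesis using u' that by blast
qed

text \<open>Gram-Schmidt: the coefficient is \<open>b x v\<close> divided by the unit norm of
  \<open>v\<close>; reducing it below \<open>p ^ k\<close> makes it unique.\<close>

lemma line_decomp:
  assumes v: "v \<in> V" "b v v = fr u" "coprime u p" and x: "x \<in> V"
  obtains a y where "a \<in> {0..<p ^ k}" "y \<in> perp b V v" "x = a *z v + y"
proof -
  obtain c where c: "b x v = fr c" using b_frac x v by blast
  obtain u' where u': "[u * u' = 1] (mod p ^ k)" using unit_inverse v(3) by blast
  define a where "a = (c * u') mod p ^ k"
  have "[a * u = (c * u') * u] (mod p ^ k)" by (simp add: a_def cong_def mod_mult_left_eq)
  also have "(c * u') * u = c * (u * u')" by simp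
  also have "[c * (u * u') = c * 1] (mod p ^ k)" using u' cong_scalar_left by blast
  finally have "fr (a * u) = fr c" using qfrac_eq_iff p_pow_pos by simp
  then have "b (a *z v) v = b x v" using v c by (simp add: b_simps zscale_qfrac)
  then have "x - a *z v \<in> perp b V v" using v x by (simp add: perp_def closed b_simps)
  moreover have "a \<in> {0..<p ^ k}" using p_pow_pos[of k] by (simp add: a_def)
  ultimately show ?thesis using that[of a "x - a *z v"] by simp
qed

lemma line_decomp_unique:
  assumes v: "v \<in> V" "b v v = fr u" "coprime u p"
    and y: "y \<in> perp b V v" "z \<in> perp b V v" and eq: "a *z v + y = c *z v + z"
  shows "[a = c] (mod p ^ k)" "y = z"
proof -
  have yV: "y \<in> V" "z \<in> V" "b y v = 0" "b z v = 0" using y by (auto simp: perp_def)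
  have "b (a *z v + y) v = fr (a * u)" "b (c *z v + z) v = fr (c * u)"
    using yV v by (simp_all add: b_simps closed zscale_qfrac)
  then have "[a * u = c * u] (mod p ^ k)" using eq qfrac_eq_iff p_pow_pos by metis
  then show ac: "[a = c] (mod p ^ k)" using v(3) by (simp add: cong_mult_rcancel)
  show "y = z" using scale_cong[OF v(1) ac] eq by simp
qed

lemma line_decomp_bij:
  assumes v: "v \<in> V" "b v v = fr u" "coprime u p"
  shows "bij_betw (\<lambda>(a, y). a *z v + y) ({0..<p ^ k} \<times> perp b V v) V"
  unfolding bij_betw_def
proof
  show "inj_on (\<lambda>(a, y). a *z v + y) ({0..<p ^ k} \<times> perp b V v)"
  proof (rule inj_onI, clarify)
    fix a y c z assume *: "a \<in> {0..<p ^ k}" "c \<in> {0..<p ^ k}" "y \<in> perp b V v" "z \<in> perp b V v"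
      and eq: "a *z v + y = c *z v + z"
    have "[a = c] (mod p ^ k)" "y = z" using line_decomp_unique[OF v *(3,4) eq] by auto
    then show "a = c \<and> y = z" using * by (simp add: cong_def)
  qed
  show "(\<lambda>(a, y). a *z v + y) ` ({0..<p ^ k} \<times> perp b V v) = V"
  proof
    show "V \<subseteq> (\<lambda>(a, y). a *z v + y) ` ({0..<p ^ k} \<times> perp b V v)"
    proof
      fix x assume "x \<in> V"
      then obtain a y where "a \<in> {0..<p ^ k}" "y \<in> perp b V v" "x = a *z v + y"
        using line_decomp[OF v] by blast
      then show "x \<in> (\<lambda>(a, y). a *z v + y) ` ({0..<p ^ k} \<times> perp b V v)"
        by (intro image_eqI[where x = "(a, y)"]) auto
    qed
  qed (auto simp: perp_def closed v)
qed

end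

text \<open>A free line contributes \<open>p ^ (k - j)\<close> elements to the multiples of
  \<open>p ^ j\<close>. The case \<open>j = 0\<close> recovers the rank from the cardinality, and
  \<open>j = k - 1\<close> counts a copy of V/pV.\<close>

lemma diag_card_image:
  assumes "diag p k b V us" "bform p k V b" "j \<le> k"
  shows "int (card ((*z) (p ^ j) ` V)) = p ^ ((k - j) * length us)"
  using assms
proof (induction rule: diag.induct)
  case diag_Nil
  then show ?case by simp
next
  case (diag_Cons v V u us)
  interpret bform p k V b by fact
  have v: "v \<in> V" "b v v = fr u" "coprime u p" by fact+
  let ?W = "perp b V v"
  interpret W: bform p k ?W b by (rule perp_bform) fact
  have kj: "p ^ k = p ^ j * p ^ (k - j)" using \<open>j \<le> k\<close> by (simp flip: power_add)
  let ?h = "\<lambda>(a, y). a *z (p ^ j) *z v + y"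
  have "bij_betw ?h ({0..<p ^ (k - j)} \<times> (*z) (p ^ j) ` ?W) ((*z) (p ^ j) ` V)"
    unfolding bij_betw_def
  proof
    show "inj_on ?h ({0..<p ^ (k - j)} \<times> (*z) (p ^ j) ` ?W)"
    proof (rule inj_onI, clarify)
      fix a c y z assume *: "a \<in> {0..<p ^ (k - j)}" "c \<in> {0..<p ^ (k - j)}" "y \<in> ?W" "z \<in> ?W"
        and eq: "a *z (p ^ j) *z v + (p ^ j) *z y = c *z (p ^ j) *z v + (p ^ j) *z z"
      have "[a * p ^ j = c * p ^ j] (mod p ^ k)" "(p ^ j) *z y = (p ^ j) *z z"
        using line_decomp_unique[OF v, of "(p ^ j) *z y" "(p ^ j) *z z" "a * p ^ j" "c * p ^ j"] * eq
        by (auto simp: W.scale_V)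
      moreover from this have "[a = c] (mod p ^ (k - j))"
        unfolding kj cong_iff_dvd_diff by (simp add: left_diff_distrib[symmetric] mult.commute)
      then have "a = c" using * by (simp add: cong_def)
      ultimately show "a = c \<and> (p ^ j) *z y = (p ^ j) *z z" by simp
    qed
    show "?h ` ({0..<p ^ (k - j)} \<times> (*z) (p ^ j) ` ?W) = (*z) (p ^ j) ` V"
    proof safe
      fix a y assume "y \<in> ?W"
      then have "a *z v + y \<in> V" using v by (auto simp: perp_def closed)
      moreover have "a *z (p ^ j) *z v + (p ^ j) *z y = (p ^ j) *z (a *z v + y)"
        by (simp add: zscale_simps mult.commute)
      ultimately show "a *z (p ^ j) *z v + (p ^ j) *z y \<in> (*z) (p ^ j) ` V" by blast
    next
      fix x assume "x \<in> V"
      then obtain a y where ay: "y \<in> ?W" "x = a *z v + y" using line_decomp[OF v] by blast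
      have "(p ^ j) *z x = (p ^ j * a) *z v + (p ^ j) *z y" using ay by (simp add: zscale_simps)
      \<comment> \<open>Changing \<open>a\<close> by a multiple of \<open>p ^ (k - j)\<close>
        changes \<open>p ^ j * a\<close> by a multiple of \<open>p ^ k\<close>, which kills
        \<open>v\<close>.\<close>
      also have "(p ^ j * a) *z v = (p ^ j * (a mod p ^ (k - j))) *z v"
        by (rule scale_cong[OF v(1)]) (simp add: kj cong_iff_dvd_diff right_diff_distrib[symmetric] minus_mod_eq_mult_div)
      finally have "(p ^ j) *z x = (a mod p ^ (k - j)) *z (p ^ j) *z v + (p ^ j) *z y"
        by (simp add: mult.commute)
      then show "(p ^ j) *z x \<in> ?h ` ({0..<p ^ (k - j)} \<times> (*z) (p ^ j) ` ?W)"
        using ay p_pow_pos[of "k - j"] by (intro image_eqI[where x = "(a mod p ^ (k - j), (p ^ j) *z y)"]) auto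
    qed
  qed
  from bij_betw_same_card[OF this] have "card ((*z) (p ^ j) ` V) = nat (p ^ (k - j)) * card ((*z) (p ^ j) ` ?W)"
    by (simp add: card_cartesian_product)
  then show ?case using diag_Cons.IH[OF W.bform_axioms \<open>j \<le> k\<close>] by (simp add: power_add less_imp_le)
qed

lemma diag_card:
  assumes "diag p k b V us" "bform p k V b"
  shows "int (card V) = p ^ (k * length us)"
  using diag_card_image[OF assms, of 0] by simp


section \<open>Counting vectors of given norm\<close>

text \<open>Multiplying by \<open>p ^ (k - 1)\<close> carries \<open>d / p ^ k\<close> to
  \<open>d / p\<close>, so norms are compared modulo \<open>p\<close> only, while the vectors range
  over all of \<open>V\<close>. This keeps the count explicit for every \<open>k\<close>.\<close>

definition normset :: "int \<Rightarrow> nat \<Rightarrow> ('v::ab_group_add \<Rightarrow> 'v \<Rightarrow> qz) \<Rightarrow> 'v set \<Rightarrow> int \<Rightarrow> 'v set" where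
  "normset p k b V c = {x \<in> V. (p ^ (k - 1)) *z b x x = qfrac p c}"

text \<open>Coordinates run modulo \<open>p ^ k\<close> but the equation is read modulo
  \<open>p\<close>; in rank 0 the only vector has norm 0.\<close>

fun cnt :: "int \<Rightarrow> nat \<Rightarrow> int list \<Rightarrow> int \<Rightarrow> int" where
  "cnt p k [] c = (if p dvd c then 1 else 0)"
| "cnt p k (u # us) c = (\<Sum>a\<in>{0..<p ^ k}. cnt p k us (c - u * a\<^sup>2))"

context bform
begin

lemma normset_iff:
  assumes "x \<in> V" "b x x = fr d"
  shows "x \<in> normset p k b V c \<longleftrightarrow> [d = c] (mod p)"
proof -
  have "(p ^ (k - 1)) *z b x x = qfrac (p ^ (k - 1) * p) (p ^ (k - 1) * d)"
    using assms(2) k_split by (simp add: zscale_qfrac mult.commute)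
  also have "\<dots> = qfrac p d" by (rule qfrac_cancel) simp
  finally show ?thesis using assms(1) by (simp add: normset_def qfrac_eq_iff)
qed

end

lemma card_normset:
  assumes "diag p k b V us" "bform p k V b"
  shows "int (card (normset p k b V c)) = cnt p k us c"
  using assms
proof (induction arbitrary: c rule: diag.induct)
  case diag_Nil
  then interpret bform p k "{0}" b by simp
  have "normset p k b {0} c = (if p dvd c then {0} else {})"
    using normset_iff[of 0 0 c] by (auto simp: cong_0_iff cong_sym_eq[of 0] normset_def)
  then show ?case by simp
next
  case (diag_Cons v V u us)
  interpret bform p k V b by fact
  have v: "v \<in> V" "b v v = fr u" "coprime u p" by fact+
  let ?W = "perp b V v"
  interpret W: bform p k ?W b by (rule perp_bform) fact
  let ?h = "\<lambda>(a, y). a *z v + y"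
  \<comment> \<open>Orthogonality removes the cross term, so the coordinate along \<open>v\<close>
    just shifts the norm by \<open>u * a\<^sup>2\<close>.\<close>
  have norm: "a *z v + y \<in> normset p k b V c \<longleftrightarrow> y \<in> normset p k b ?W (c - u * a\<^sup>2)" if "y \<in> ?W" for a y
  proof -
    have y: "y \<in> V" "b y v = 0" "b v y = 0" using that v b_sym by (auto simp: perp_def)
    obtain d where d: "b y y = fr d" using b_frac y by blast
    have "b (a *z v + y) (a *z v + y) = fr (u * a\<^sup>2 + d)"
      using y d v by (simp add: b_simps closed zscale_qfrac qfrac_add power2_eq_square ac_simps)
    then have "a *z v + y \<in> normset p k b V c \<longleftrightarrow> [u * a\<^sup>2 + d = c] (mod p)"
      using y v by (intro normset_iff) (auto simp: closed)
    also have "\<dots> \<longleftrightarrow> [d = c - u * a\<^sup>2] (mod p)"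
      by (simp add: cong_iff_dvd_diff algebra_simps)
    finally show ?thesis using W.normset_iff[OF that d] by simp
  qed
  have "bij_betw ?h (SIGMA a:{0..<p ^ k}. normset p k b ?W (c - u * a\<^sup>2)) (normset p k b V c)"
  proof (rule bij_betw_subset[OF line_decomp_bij[OF v], THEN bij_betw_cong[THEN iffD1, rotated]])
    show "(SIGMA a:{0..<p ^ k}. normset p k b ?W (c - u * a\<^sup>2)) \<subseteq> {0..<p ^ k} \<times> ?W"
      by (auto simp: normset_def)
    show "?h ` (SIGMA a:{0..<p ^ k}. normset p k b ?W (c - u * a\<^sup>2)) = normset p k b V c"
    proof
      show "?h ` (SIGMA a:{0..<p ^ k}. normset p k b ?W (c - u * a\<^sup>2)) \<subseteq> normset p k b V c"
        using norm by (auto simp: normset_def[of p k b "?W"])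
      show "normset p k b V c \<subseteq> ?h ` (SIGMA a:{0..<p ^ k}. normset p k b ?W (c - u * a\<^sup>2))"
      proof
        fix x assume x: "x \<in> normset p k b V c"
        then have "x \<in> V" by (simp add: normset_def)
        then obtain a y where ay: "a \<in> {0..<p ^ k}" "y \<in> ?W" "x = a *z v + y"
          using line_decomp[OF v] by blast
        with x norm show "x \<in> ?h ` (SIGMA a:{0..<p ^ k}. normset p k b ?W (c - u * a\<^sup>2))"
          by (intro image_eqI[where x = "(a, y)"]) auto
      qed
    qed
  qed simp
  moreover have "finite (normset p k b ?W d)" for d
    using W.finite_V by (simp add: normset_def)
  ultimately have "int (card (normset p k b V c)) = (\<Sum>a\<in>{0..<p ^ k}. int (card (normset p k b ?W (c - u * a\<^sup>2))))"
    by (simp add: bij_betw_same_card[symmetric])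
  then show ?case using diag_Cons.IH[OF W.bform_axioms] by simp
qed

section \<open>Legendre symbol and binary forms modulo p\<close>

context odd_prime_power
begin

abbreviation "chi a \<equiv> Legendre a p"

lemma coprime_iff: "coprime a p \<longleftrightarrow> \<not> p dvd a"
  using prime_p by (metis coprime_commute dvd_refl not_prime_unit coprime_common_divisor prime_imp_coprime)

lemma inverse_mod_p: assumes "coprime u p" obtains u' where "[u * u' = 1] (mod p)" "coprime u' p"
proof -
  obtain u' where u': "[u * u' = 1] (mod p)" using cong_solve_coprime_int assms by blast
  then have "coprime u' p" by (metis coprime_iff_invertible_int mult.commute)
  then show ?thesis using u' that by blast
qed

lemma p_nat: "p = int (nat p)" "prime (nat p)" "nat p > 2"
  using prime_p p_gt_2 by auto

lemma chi_euler: "[chi a = a ^ ((nat p - 1) div 2)] (mod p)"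
  using euler_criterion[of "nat p" a] p_nat(2,3) p_pos by simp

lemma chi_values: "chi a \<in> {- 1, 0, 1}"
  by (auto simp: Legendre_def)

lemma chi_unit: "coprime a p \<Longrightarrow> chi a = 1 \<or> chi a = - 1"
  by (auto simp: Legendre_def coprime_iff cong_0_iff)

lemma cong_cong_right: "[r = s] (mod m) \<Longrightarrow> [x = r] (mod m) \<longleftrightarrow> [x = s] (mod m)" for r s x m :: int
  by (simp add: cong_def)

text \<open>Turns congruences between Legendre symbols, or between small residues, into
  equalities.\<close>

lemma small_cong: assumes "[x = y] (mod p)" "\<bar>x - y\<bar> < p" shows "x = y"
proof -
  have "p dvd x - y" using assms(1) by (simp add: cong_iff_dvd_diff)
  then show ?thesis using assms(2) zdvd_not_zless[of "\<bar>x - y\<bar>" p] by (cases "x = y") auto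
qed

lemma chi_mult: "chi (a * c) = chi a * chi c"
proof -
  have "[chi a * chi c = a ^ ((nat p - 1) div 2) * c ^ ((nat p - 1) div 2)] (mod p)"
    by (intro cong_mult chi_euler)
  then have "[chi (a * c) = chi a * chi c] (mod p)"
    using chi_euler[of "a * c"] by (simp add: cong_def power_mult_distrib)
  moreover have "\<bar>chi a * chi c\<bar> \<le> 1" "\<bar>chi (a * c)\<bar> \<le> 1"
    using chi_values[of a] chi_values[of c] chi_values[of "a * c"] by (auto simp: abs_mult)
  ultimately show ?thesis using p_gt_2 by (intro small_cong) linarith+
qed

lemma chi_cong: "[a = c] (mod p) \<Longrightarrow> chi a = chi c"
proof -
  assume ac: "[a = c] (mod p)"
  then have "[a = 0] (mod p) \<longleftrightarrow> [c = 0] (mod p)" and "QuadRes p a \<longleftrightarrow> QuadRes p c"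
    unfolding QuadRes_def by (meson cong_sym cong_trans)+
  then show ?thesis by (simp add: Legendre_def)
qed

lemma chi_power: "chi (a ^ n) = chi a ^ n" if "n > 0"
  using that by (induct n rule: nat_induct_non_zero) (auto simp: chi_mult)

lemma chi_one [simp]: "chi 1 = 1"
  using prime_p by (auto simp: Legendre_def QuadRes_def cong_0_iff intro!: exI[of _ 1])

lemma chi_eq_1D: "chi a = 1 \<Longrightarrow> \<exists>z. [z\<^sup>2 = a] (mod p)"
  by (auto simp: Legendre_def QuadRes_def split: if_splits)

lemma chi_eq_m1D: "chi a = - 1 \<Longrightarrow> \<not> [z\<^sup>2 = a] (mod p)"
  by (auto simp: Legendre_def QuadRes_def split: if_splits)

text \<open>Each coordinate modulo \<open>p ^ k\<close> thus contributes a factor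
  \<open>p ^ (k - 1)\<close> to counts of conditions modulo \<open>p\<close>.\<close>

lemma residue_card: "card {a \<in> {0..<p ^ k}. [a = r] (mod p)} = nat (p ^ (k - 1))"
proof -
  have "bij_betw (\<lambda>j. r mod p + p * j) {0..<p ^ (k - 1)} {a \<in> {0..<p ^ k}. [a = r] (mod p)}"
  proof (rule bij_betw_byWitness[where f' = "\<lambda>a. a div p"])
    show "(\<lambda>j. r mod p + p * j) ` {0..<p ^ (k - 1)} \<subseteq> {a \<in> {0..<p ^ k}. [a = r] (mod p)}"
    proof safe
      fix j assume j: "j \<in> {0..<p ^ (k - 1)}"
      have "r mod p < p" by simp
      moreover have "p * j \<le> p * (p ^ (k - 1) - 1)" using j by (intro mult_left_mono) auto
      ultimately have "r mod p + p * j < p * p ^ (k - 1)" by (simp only: right_diff_distrib)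
      then show "r mod p + p * j \<in> {0..<p ^ k}" using j k_split by simp
    qed (simp add: cong_def)
    show "(\<lambda>a. a div p) ` {a \<in> {0..<p ^ k}. [a = r] (mod p)} \<subseteq> {0..<p ^ (k - 1)}"
    proof safe
      fix a assume a: "a \<in> {0..<p ^ k}"
      have "a div p * p \<le> a" using div_mult_mod_eq[of a p] pos_mod_sign[of p a] p_pos by linarith
      moreover have "p ^ (k - 1) * p \<le> a div p * p" if "p ^ (k - 1) \<le> a div p"
        using that by (rule mult_right_mono) simp
      moreover have "a < p ^ (k - 1) * p" using a k_split by (simp add: mult.commute)
      ultimately have "a div p < p ^ (k - 1)" by linarith
      then show "a div p \<in> {0..<p ^ (k - 1)}" using a by (simp add: pos_imp_zdiv_nonneg_iff)
    qed
    show "\<forall>a\<in>{a \<in> {0..<p ^ k}. [a = r] (mod p)}. r mod p + p * (a div p) = a"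
      by (metis (no_types, lifting) cong_def mem_Collect_eq mod_mult_div_eq)
  qed (auto simp: cong_def)
  from bij_betw_same_card[OF this] show ?thesis by simp
qed

lemma two_residues_card:
  assumes "\<not> [r = s] (mod p)"
  shows "card {a \<in> {0..<p ^ k}. [a = r] (mod p) \<or> [a = s] (mod p)} = 2 * nat (p ^ (k - 1))"
proof -
  let ?A = "\<lambda>r. {a \<in> {0..<p ^ k}. [a = r] (mod p)}"
  have un: "{a \<in> {0..<p ^ k}. [a = r] (mod p) \<or> [a = s] (mod p)} = ?A r \<union> ?A s" by blast
  have "card (?A r \<union> ?A s) = card (?A r) + card (?A s)"
  proof (rule card_Un_disjoint)
    show "?A r \<inter> ?A s = {}"
    proof (rule equals0I)
      fix a assume "a \<in> ?A r \<inter> ?A s"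
      then have "[a = r] (mod p)" "[a = s] (mod p)" by blast+
      then show False using assms cong_trans[OF cong_sym, of a r p s] by blast
    qed
    show "finite (?A r)" by (rule finite_subset[of _ "{0..<p ^ k}"]) auto
    show "finite (?A s)" by (rule finite_subset[of _ "{0..<p ^ k}"]) auto
  qed
  then show ?thesis unfolding un residue_card mult_2 .
qed

lemma sq_cong_iff: "[x\<^sup>2 = y\<^sup>2] (mod p) \<longleftrightarrow> [x = y] (mod p) \<or> [x = - y] (mod p)"
proof -
  have "x\<^sup>2 - y\<^sup>2 = (x - y) * (x - - y)" by (simp add: power2_eq_square algebra_simps)
  then show ?thesis using prime_p by (simp only: cong_iff_dvd_diff prime_dvd_mult_iff)
qed

lemma cong_mult_unit: "coprime u p \<Longrightarrow> [u * x = u * y] (mod p) \<longleftrightarrow> [x = y] (mod p)"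
  by (simp add: cong_mult_lcancel)

text \<open>Pigeonhole: \<open>u * x\<^sup>2\<close> and \<open>e - w * y\<^sup>2\<close> each take
  (p + 1) / 2 residues, more than half of all, so they share one.\<close>

lemma binary_represents:
  assumes "coprime u p" "coprime w p"
  shows "\<exists>x y. [u * x\<^sup>2 + w * y\<^sup>2 = e] (mod p)"
proof -
  \<comment> \<open>The range from 0 to \<open>h\<close> contains one element of each pair of
    opposite residues, which makes squaring injective on it.\<close>
  define h where "h = (p - 1) div 2"
  have h: "2 * h + 1 = p" using odd_p unfolding h_def by presburger
  have inj: "inj_on (\<lambda>x. (c + v * x\<^sup>2) mod p) {0..h}" if "coprime v p" for v c
  proof (rule inj_onI)
    fix x y assume x: "x \<in> {0..h}" and y: "y \<in> {0..h}" and "(c + v * x\<^sup>2) mod p = (c + v * y\<^sup>2) mod p"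
    then have "[c + v * x\<^sup>2 = c + v * y\<^sup>2] (mod p)" by (simp only: cong_def)
    then have "[x\<^sup>2 = y\<^sup>2] (mod p)" using that by (simp only: cong_add_lcancel cong_mult_unit)
    then have "x = y \<or> x = - y" unfolding sq_cong_iff using small_cong[of x y] small_cong[of x "- y"] x y h by auto
    then show "x = y" using x y by auto
  qed
  define A where "A = (\<lambda>x. (0 + u * x\<^sup>2) mod p) ` {0..h}"
  define B where "B = (\<lambda>x. (e + (- w) * x\<^sup>2) mod p) ` {0..h}"
  have "card A = nat (h + 1)" "card B = nat (h + 1)"
    unfolding A_def B_def using card_image[OF inj[of u 0]] card_image[OF inj[of "- w" e]] assms by simp_all
  moreover have "A \<union> B \<subseteq> {0..<p}" by (auto simp: A_def B_def)
  then have "card (A \<union> B) \<le> nat p" using card_mono[of "{0..<p}" "A \<union> B"] by simp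
  moreover have "nat (h + 1) + nat (h + 1) > nat p" using h p_gt_2 by simp
  moreover have "finite A" "finite B" by (simp_all add: A_def B_def)
  ultimately have "A \<inter> B \<noteq> {}" using card_Un_disjoint[of A B] by linarith
  then obtain x y where "(0 + u * x\<^sup>2) mod p = (e + (- w) * y\<^sup>2) mod p" by (auto simp: A_def B_def)
  then have "[0 + u * x\<^sup>2 = e + (- w) * y\<^sup>2] (mod p)" by (simp only: cong_def)
  then have "[u * x\<^sup>2 + w * y\<^sup>2 = e] (mod p)" by (simp add: cong_iff_dvd_diff algebra_simps)
  then show ?thesis by blast
qed

definition binsol :: "int \<Rightarrow> int \<Rightarrow> int \<Rightarrow> (int \<times> int) set" where
  "binsol u w c = {(a, d) \<in> {0..<p ^ k} \<times> {0..<p ^ k}. [u * a\<^sup>2 + w * d\<^sup>2 = c] (mod p)}"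

lemma finite_binsol: "finite (binsol u w c)"
  by (rule finite_subset[of _ "{0..<p ^ k} \<times> {0..<p ^ k}"]) (auto simp: binsol_def)

text \<open>Brahmagupta's identity
  \<open>(x\<^sup>2 + u w y\<^sup>2) (u a\<^sup>2 + w d\<^sup>2) = u (x a - w y d)\<^sup>2 + w (x d + u y a)\<^sup>2\<close>.\<close>

lemma card_binsol_le:
  assumes "coprime u p" "coprime w p" "coprime e p"
  shows "card (binsol u w c) \<le> card (binsol u w (e * c))"
proof -
  obtain x y where xy: "[1 * x\<^sup>2 + (u * w) * y\<^sup>2 = e] (mod p)"
    using binary_represents[of 1 "u * w" e] assms by auto
  define D where "D = x\<^sup>2 + u * w * y\<^sup>2"
  have D: "[D = e] (mod p)" using xy by (simp add: D_def)
  then have cop: "coprime D (p ^ k)" using assms(3) by (metis cong_imp_coprime cong_sym coprime_power_right_iff)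
  define h where "h = (\<lambda>(a, d). ((x * a - w * y * d) mod p ^ k, (x * d + u * y * a) mod p ^ k))"
  have "inj_on h (binsol u w c)"
  proof (rule inj_onI)
    fix s t assume st: "s \<in> binsol u w c" "t \<in> binsol u w c" "h s = h t"
    obtain a d a' d' where adt: "s = (a, d)" "t = (a', d')" by (metis surj_pair)
    have mem: "(a, d) \<in> binsol u w c" "(a', d') \<in> binsol u w c" and "h (a, d) = h (a', d')"
      using st adt by auto
    then have 1: "[x * a - w * y * d = x * a' - w * y * d'] (mod p ^ k)"
      and 2: "[x * d + u * y * a = x * d' + u * y * a'] (mod p ^ k)" by (auto simp: h_def cong_def)
    \<comment> \<open>The substitution has determinant \<open>D\<close>, a unit modulo
      \<open>p ^ k\<close>. These two combinations apply its adjugate and recover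
      \<open>D * a\<close> and \<open>D * d\<close>.\<close>
    have "[x * (x * a - w * y * d) + w * y * (x * d + u * y * a) =
        x * (x * a' - w * y * d') + w * y * (x * d' + u * y * a')] (mod p ^ k)"
      by (intro cong_add cong_mult cong_refl 1 2)
    then have "[D * a = D * a'] (mod p ^ k)" by (simp add: D_def power2_eq_square algebra_simps)
    moreover have "[x * (x * d + u * y * a) - u * y * (x * a - w * y * d) =
        x * (x * d' + u * y * a') - u * y * (x * a' - w * y * d')] (mod p ^ k)"
      by (intro cong_diff cong_mult cong_refl 1 2)
    then have "[D * d = D * d'] (mod p ^ k)" by (simp add: D_def power2_eq_square algebra_simps)
    ultimately have "[a = a'] (mod p ^ k)" "[d = d'] (mod p ^ k)" using cop by (simp_all add: cong_mult_lcancel)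
    then show "s = t" using mem adt by (auto simp: binsol_def cong_def)
  qed
  moreover have "h ` binsol u w c \<subseteq> binsol u w (e * c)"
  proof (rule image_subsetI)
    fix s assume s: "s \<in> binsol u w c"
    obtain a d where sad: "s = (a, d)" by (metis surj_pair)
    have ad: "(a, d) \<in> binsol u w c" using s sad by simp
    let ?a = "x * a - w * y * d" and ?d = "x * d + u * y * a"
    have pk: "[z mod p ^ k = z] (mod p)" for z
      using k_split by (metis cong_def cong_dvd_modulus dvd_triv_left mod_mod_trivial)
    have "[u * (?a mod p ^ k)\<^sup>2 + w * (?d mod p ^ k)\<^sup>2 = u * ?a\<^sup>2 + w * ?d\<^sup>2] (mod p)"
      by (intro cong_add cong_mult cong_refl cong_pow pk)
    also have "u * ?a\<^sup>2 + w * ?d\<^sup>2 = D * (u * a\<^sup>2 + w * d\<^sup>2)"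
      by (simp add: D_def power2_eq_square algebra_simps)
    also have "[D * (u * a\<^sup>2 + w * d\<^sup>2) = e * c] (mod p)"
      using ad D by (intro cong_mult) (auto simp: binsol_def)
    finally show "h s \<in> binsol u w (e * c)" by (simp add: sad h_def binsol_def)
  qed
  ultimately show ?thesis using finite_binsol card_inj_on_le by blast
qed

lemma binsol_cong: "[c = c'] (mod p) \<Longrightarrow> binsol u w c = binsol u w c'"
  by (simp add: binsol_def cong_cong_right)

text \<open>If \<open>p\<close> divides \<open>d\<close> then it divides \<open>a\<close>. Otherwise
  multiplying by \<open>u\<close> gives \<open>(u * a)\<^sup>2 = - (u * w) * d\<^sup>2\<close>, with
  two roots or none according to the class of \<open>- (u * w)\<close>.\<close>

lemma card_binsol_0:
  assumes "coprime u p" "coprime w p"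
  shows "int (card (binsol u w 0)) = (p ^ (k - 1))\<^sup>2 * (1 + (p - 1) * (1 + chi (- (u * w))))"
proof -
  let ?P = "p ^ (k - 1)"
  have fib: "card {a \<in> {0..<p ^ k}. [u * a\<^sup>2 + w * d\<^sup>2 = 0] (mod p)} =
      (if p dvd d then nat ?P else if chi (- (u * w)) = 1 then 2 * nat ?P else 0)" for d
  proof (cases "p dvd d")
    case True
    have "[u * a\<^sup>2 + w * d\<^sup>2 = 0] (mod p) \<longleftrightarrow> [a = 0] (mod p)" for a
      using True assms prime_p by (simp add: cong_0_iff coprime_iff dvd_add_left_iff prime_dvd_mult_iff prime_dvd_power_iff)
    then show ?thesis using True residue_card[of 0] by simp
  next
    case False
    have eq: "[u * a\<^sup>2 + w * d\<^sup>2 = 0] (mod p) \<longleftrightarrow> [(u * a)\<^sup>2 = - (u * w) * d\<^sup>2] (mod p)" for a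
    proof -
      have "[u * a\<^sup>2 + w * d\<^sup>2 = 0] (mod p) \<longleftrightarrow> [u * (u * a\<^sup>2 + w * d\<^sup>2) = u * 0] (mod p)"
        using cong_mult_unit assms(1) by blast
      also have "\<dots> \<longleftrightarrow> [(u * a)\<^sup>2 = - (u * w) * d\<^sup>2] (mod p)"
        by (simp add: cong_iff_dvd_diff power2_eq_square algebra_simps)
      finally show ?thesis .
    qed
    obtain u' where u': "[u * u' = 1] (mod p)" "coprime u' p" using inverse_mod_p assms(1) by blast
    have cd: "coprime d p" using False by (simp add: coprime_iff)
    obtain d' where d': "[d * d' = 1] (mod p)" "coprime d' p" using inverse_mod_p cd by blast
    consider "chi (- (u * w)) = 1" | "chi (- (u * w)) = - 1" using chi_unit[of "- (u * w)"] assms by auto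
    then show ?thesis
    proof cases
      case 1
      then obtain z where z: "[z\<^sup>2 = - (u * w)] (mod p)" using chi_eq_1D by blast
      have "coprime (- (u * w)) p" using assms by simp
      then have "coprime (z\<^sup>2) p" using z by (metis cong_imp_coprime cong_sym)
      then have cz: "coprime z p" by simp
      \<comment> \<open>The root \<open>z * d / u\<close>, with \<open>u'\<close> standing for the
        inverse of \<open>u\<close>.\<close>
      define r where "r = u' * (z * d)"
      have ur: "[u * r = z * d] (mod p)"
        using cong_scalar_right[OF u'(1), of "z * d"] by (simp add: r_def mult.assoc)
      have "[u * a\<^sup>2 + w * d\<^sup>2 = 0] (mod p) \<longleftrightarrow> [a = r] (mod p) \<or> [a = - r] (mod p)" for a
      proof -
        have "[(u * r)\<^sup>2 = z\<^sup>2 * d\<^sup>2] (mod p)" using cong_pow[OF ur, of 2] by (simp add: power_mult_distrib)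
        also have "[z\<^sup>2 * d\<^sup>2 = - (u * w) * d\<^sup>2] (mod p)" using z cong_scalar_right by blast
        finally have r2: "[(u * r)\<^sup>2 = - (u * w) * d\<^sup>2] (mod p)" .
        have "[u * a\<^sup>2 + w * d\<^sup>2 = 0] (mod p) \<longleftrightarrow> [(u * a)\<^sup>2 = (u * r)\<^sup>2] (mod p)"
          unfolding eq cong_cong_right[OF r2] by (rule refl)
        also have "\<dots> \<longleftrightarrow> [u * a = u * r] (mod p) \<or> [u * a = u * (- r)] (mod p)" by (simp add: sq_cong_iff)
        finally show ?thesis unfolding cong_mult_unit[OF assms(1)] .
      qed
      moreover have "\<not> [r = - r] (mod p)"
      proof
        assume "[r = - r] (mod p)"
        then have "p dvd 2 * r" by (simp add: cong_iff_dvd_diff)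
        then have "p dvd r" using prime_p p_gt_2 by (auto simp: prime_dvd_mult_iff dest: zdvd_imp_le)
        then show False using u'(2) cz cd prime_p by (auto simp: r_def coprime_iff prime_dvd_mult_iff)
      qed
      ultimately show ?thesis using 1 False two_residues_card by simp
    next
      case 2
      have "\<not> [u * a\<^sup>2 + w * d\<^sup>2 = 0] (mod p)" for a
      proof
        assume "[u * a\<^sup>2 + w * d\<^sup>2 = 0] (mod p)"
        then have "[(u * a)\<^sup>2 = - (u * w) * d\<^sup>2] (mod p)" unfolding eq .
        then have "[(u * a)\<^sup>2 * d'\<^sup>2 = - (u * w) * d\<^sup>2 * d'\<^sup>2] (mod p)" using cong_scalar_right by blast
        also have "- (u * w) * d\<^sup>2 * d'\<^sup>2 = - (u * w) * (d * d')\<^sup>2" by (simp add: power_mult_distrib)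
        also have "[- (u * w) * (d * d')\<^sup>2 = - (u * w) * 1\<^sup>2] (mod p)"
          by (intro cong_mult cong_refl cong_pow d')
        finally have "[(u * a * d')\<^sup>2 = - (u * w)] (mod p)" by (simp add: power_mult_distrib)
        then show False using chi_eq_m1D[OF 2] by blast
      qed
      then show ?thesis using 2 False by simp
    qed
  qed
  have "binsol u w 0 = (\<lambda>(d, a). (a, d)) ` (SIGMA d:{0..<p ^ k}. {a \<in> {0..<p ^ k}. [u * a\<^sup>2 + w * d\<^sup>2 = 0] (mod p)})"
    by (auto simp: binsol_def)
  then have "card (binsol u w 0) = card (SIGMA d:{0..<p ^ k}. {a \<in> {0..<p ^ k}. [u * a\<^sup>2 + w * d\<^sup>2 = 0] (mod p)})"
    by (simp add: card_image inj_on_def)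
  also have "\<dots> = (\<Sum>d\<in>{0..<p ^ k}. if p dvd d then nat ?P else if chi (- (u * w)) = 1 then 2 * nat ?P else 0)"
  proof -
    have "card (SIGMA d:{0..<p ^ k}. {a \<in> {0..<p ^ k}. [u * a\<^sup>2 + w * d\<^sup>2 = 0] (mod p)}) =
        (\<Sum>d\<in>{0..<p ^ k}. card {a \<in> {0..<p ^ k}. [u * a\<^sup>2 + w * d\<^sup>2 = 0] (mod p)})"
      by (rule card_SigmaI) (auto intro: finite_subset[of _ "{0..<p ^ k}"])
    then show ?thesis unfolding fib .
  qed
  finally have "int (card (binsol u w 0)) =
      (\<Sum>d\<in>{0..<p ^ k}. if p dvd d then ?P else ?P * (1 + chi (- (u * w))))"
    using chi_unit[of "- (u * w)"] assms by (auto simp: less_imp_le intro!: sum.cong)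
  \<comment> \<open>The generic value is used for every \<open>d\<close>, and its surplus at the
    multiples of \<open>p\<close> is subtracted.\<close>
  also have "\<dots> = (\<Sum>d\<in>{0..<p ^ k}. ?P * (1 + chi (- (u * w))) - (if p dvd d then ?P * chi (- (u * w)) else 0))"
    by (intro sum.cong) (auto simp: algebra_simps)
  also have "\<dots> = p ^ k * (?P * (1 + chi (- (u * w)))) - ?P * (?P * chi (- (u * w)))"
  proof -
    have "{d \<in> {0..<p ^ k}. p dvd d} = {d \<in> {0..<p ^ k}. [d = 0] (mod p)}" by (simp add: cong_0_iff)
    then have "(\<Sum>d\<in>{0..<p ^ k}. if p dvd d then ?P * chi (- (u * w)) else 0) = ?P * (?P * chi (- (u * w)))"
      using residue_card[of 0] by (simp flip: sum.inter_filter add: less_imp_le)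
    then show ?thesis by (simp add: sum_subtractf less_imp_le)
  qed
  also have "\<dots> = ?P\<^sup>2 * (1 + (p - 1) * (1 + chi (- (u * w))))"
    using k_split by (simp add: power2_eq_square algebra_simps)
  finally show ?thesis .
qed


end

section \<open>Counting norms two coordinates at a time\<close>

context odd_prime_power
begin

lemma sum_fibres_mod_p:
  assumes "finite S"
  shows "(\<Sum>e\<in>{0..<p}. \<Sum>x | x \<in> S \<and> f x mod p = e. h x) = (\<Sum>x\<in>S. h x)"
proof -
  have "(\<lambda>x. f x mod p) ` S \<subseteq> {0..<p}" by auto
  then show ?thesis using sum.group[of S "{0..<p}" "\<lambda>x. f x mod p" h] assms by simp
qed

lemma binsol_eq_fibre:
  assumes "e \<in> {0..<p}"
  shows "binsol u w e = {x. x \<in> {0..<p ^ k} \<times> {0..<p ^ k} \<and> (case x of (a, d) \<Rightarrow> u * a\<^sup>2 + w * d\<^sup>2) mod p = e}"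
  using assms by (auto simp: binsol_def cong_def)

text \<open>The pairs are grouped by the residue of the binary form, on which alone \<open>F\<close>
  depends.\<close>

lemma sum_binary:
  assumes "\<And>c c'. [c = c'] (mod p) \<Longrightarrow> F c = (F c' :: int)"
  shows "(\<Sum>a\<in>{0..<p ^ k}. \<Sum>d\<in>{0..<p ^ k}. F (u * a\<^sup>2 + w * d\<^sup>2)) =
    (\<Sum>e\<in>{0..<p}. int (card (binsol u w e)) * F e)"
proof -
  let ?g = "\<lambda>x. case x of (a, d) \<Rightarrow> u * a\<^sup>2 + w * d\<^sup>2" and ?S = "{0..<p ^ k} \<times> {0..<p ^ k}"
  have "(\<Sum>a\<in>{0..<p ^ k}. \<Sum>d\<in>{0..<p ^ k}. F (u * a\<^sup>2 + w * d\<^sup>2)) = (\<Sum>x\<in>?S. F (?g x))"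
    by (simp add: sum.cartesian_product case_prod_unfold)
  also have "\<dots> = (\<Sum>e\<in>{0..<p}. \<Sum>x | x \<in> ?S \<and> ?g x mod p = e. F (?g x))"
    by (rule sum_fibres_mod_p[symmetric]) simp
  also have "\<dots> = (\<Sum>e\<in>{0..<p}. \<Sum>x\<in>binsol u w e. F e)"
  proof (rule sum.cong[OF refl])
    fix e assume e: "e \<in> {0..<p}"
    show "(\<Sum>x | x \<in> ?S \<and> ?g x mod p = e. F (?g x)) = (\<Sum>x\<in>binsol u w e. F e)"
      unfolding binsol_eq_fibre[OF e] by (rule sum.cong[OF refl], rule assms) (auto simp: cong_def)
  qed
  finally show ?thesis by simp
qed

text \<open>Multiplying by a unit and by its inverse gives inequalities in both directions, so all
  unit values are attained equally often. The count at 0 is known, and the total number of pairs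
  fixes the rest.\<close>

lemma card_binsol_unit:
  assumes "coprime u p" "coprime w p" "coprime c p"
  shows "int (card (binsol u w c)) = (p ^ (k - 1))\<^sup>2 * (p - chi (- (u * w)))"
proof -
  have eq: "card (binsol u w c) = card (binsol u w 1)" if c: "coprime c p" for c
  proof -
    obtain c' where c': "[c * c' = 1] (mod p)" "coprime c' p" using inverse_mod_p c by blast
    have "card (binsol u w c) \<le> card (binsol u w (c' * c))" using card_binsol_le assms c' by blast
    also have "binsol u w (c' * c) = binsol u w 1" using c' by (intro binsol_cong) (simp add: mult.commute)
    finally have "card (binsol u w c) \<le> card (binsol u w 1)" .
    moreover have "card (binsol u w 1) \<le> card (binsol u w (c * 1))" using card_binsol_le assms c by blast
    ultimately show ?thesis by simp
  qed
  let ?P2 = "(p ^ (k - 1))\<^sup>2"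
  have eq1: "(\<Sum>e\<in>{1..<p}. int (card (binsol u w e))) = (\<Sum>e\<in>{1..<p}. int (card (binsol u w 1)))"
    by (rule sum.cong[OF refl], rule arg_cong[where f = int], rule eq) (simp add: coprime_iff zdvd_not_zless)
  have ins: "{0..<p} = insert 0 {1..<p}" by auto
  have "int (card (binsol u w 0)) + (\<Sum>e\<in>{1..<p}. int (card (binsol u w 1))) =
      (\<Sum>e\<in>{0..<p}. int (card (binsol u w e)) * 1)"
    unfolding ins by (simp add: eq1)
  also have "\<dots> = (\<Sum>a\<in>{0..<p ^ k}. \<Sum>d\<in>{0..<p ^ k}. 1)"
    by (rule sum_binary[symmetric]) simp
  also have "\<dots> = p * p * ?P2" using k_split by (simp add: less_imp_le power2_eq_square)
  finally have "?P2 * (1 + (p - 1) * (1 + chi (- (u * w)))) + (p - 1) * int (card (binsol u w 1)) = p * p * ?P2"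
    using card_binsol_0[OF assms(1,2)] p_gt_2 by simp
  then have "(p - 1) * int (card (binsol u w 1)) = (p - 1) * (?P2 * (p - chi (- (u * w))))"
    by (simp add: algebra_simps)
  then show ?thesis using p_gt_2 eq[OF assms(3)] by simp
qed

lemma cnt_cong: "[c = c'] (mod p) \<Longrightarrow> cnt p k us c = cnt p k us c'"
proof (induction us arbitrary: c c')
  case Nil
  then show ?case using cong_dvd_iff by auto
next
  case (Cons u us)
  then show ?case by (auto intro!: sum.cong Cons.IH cong_diff)
qed

lemma cnt_total: "(\<Sum>e\<in>{0..<p}. cnt p k us (c - e)) = p ^ (k * length us)"
proof (induction us arbitrary: c)
  case Nil
  have "(\<Sum>e\<in>{0..<p}. cnt p k [] (c - e)) = (\<Sum>e\<in>{0..<p}. if e = c mod p then 1 else 0)"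
  proof (rule sum.cong[OF refl])
    fix e assume "e \<in> {0..<p}"
    then have "e mod p = e" by simp
    then have "p dvd c - e \<longleftrightarrow> e = c mod p" using mod_eq_dvd_iff[of c p e] by metis
    then show "cnt p k [] (c - e) = (if e = c mod p then 1 else 0)" by simp
  qed
  then show ?case by simp
next
  case (Cons u us)
  have "c - e - u * a\<^sup>2 = (c - u * a\<^sup>2) - e" for e a by simp
  then have "(\<Sum>e\<in>{0..<p}. cnt p k (u # us) (c - e)) =
      (\<Sum>e\<in>{0..<p}. \<Sum>a\<in>{0..<p ^ k}. cnt p k us ((c - u * a\<^sup>2) - e))"
    by (simp only: cnt.simps)
  also have "\<dots> = (\<Sum>a\<in>{0..<p ^ k}. \<Sum>e\<in>{0..<p}. cnt p k us ((c - u * a\<^sup>2) - e))"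
    by (rule sum.swap)
  finally show ?case by (simp only: Cons.IH) (simp add: power_add less_imp_le)
qed

text \<open>\<open>p\<close> times the deviation from equidistribution of the norms modulo
  \<open>p\<close>. It takes the place of a Gauss sum: adjoining a binary form multiplies it by a
  constant.\<close>

definition excess :: "int list \<Rightarrow> int \<Rightarrow> int" where
  "excess us c = p * cnt p k us c - p ^ (k * length us)"

lemma excess_pair:
  assumes "coprime u p" "coprime w p"
  shows "excess (u # w # us) c = chi (- (u * w)) * (p * (p ^ (k - 1))\<^sup>2) * excess us c"
proof -
  let ?P2 = "(p ^ (k - 1))\<^sup>2" and ?chi = "chi (- (u * w))"
  have "cnt p k (u # w # us) c = (\<Sum>a\<in>{0..<p ^ k}. \<Sum>d\<in>{0..<p ^ k}. cnt p k us (c - (u * a\<^sup>2 + w * d\<^sup>2)))"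
    by (simp add: algebra_simps)
  also have "\<dots> = (\<Sum>e\<in>{0..<p}. int (card (binsol u w e)) * cnt p k us (c - e))"
    by (rule sum_binary) (intro cnt_cong cong_diff cong_refl)
  \<comment> \<open>The binary counts agree on all nonzero residues. Their common value sees only
    the total \<open>cnt_total\<close>; the difference at \<open>e = 0\<close> carries the
    excess.\<close>
  also have "\<dots> = (\<Sum>e\<in>{0..<p}. ?P2 * (p - ?chi) * cnt p k us (c - e) +
      (if e = 0 then ?P2 * p * ?chi * cnt p k us c else 0))"
  proof (rule sum.cong[OF refl])
    fix e assume e: "e \<in> {0..<p}"
    show "int (card (binsol u w e)) * cnt p k us (c - e) = ?P2 * (p - ?chi) * cnt p k us (c - e) +
      (if e = 0 then ?P2 * p * ?chi * cnt p k us c else 0)"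
    proof (cases "e = 0")
      case True
      show ?thesis by (simp only: True card_binsol_0[OF assms] if_True diff_zero) (simp add: algebra_simps)
    next
      case False
      then have "coprime e p" using e zdvd_not_zless[of e p] by (simp add: coprime_iff)
      then show ?thesis using card_binsol_unit[OF assms] False by simp
    qed
  qed
  also have "\<dots> = ?P2 * (p - ?chi) * p ^ (k * length us) + ?P2 * p * ?chi * cnt p k us c"
    using cnt_total[of us c] by (simp add: sum.distrib sum_distrib_left[symmetric])
  finally have cnt: "cnt p k (u # w # us) c = ?P2 * (p - ?chi) * p ^ (k * length us) + ?P2 * p * ?chi * cnt p k us c" .
  have "p ^ (k * length (u # w # us)) = (p ^ k)\<^sup>2 * p ^ (k * length us)"
    by (simp add: power_add power2_eq_square)
  also have "\<dots> = p\<^sup>2 * ?P2 * p ^ (k * length us)" by (simp only: k_split power_mult_distrib)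
  finally show ?thesis unfolding excess_def cnt by (simp add: algebra_simps power2_eq_square)
qed

lemma excess_single:
  assumes "coprime u p" "coprime c p"
  shows "excess [u] c = chi (u * c) * p ^ k"
proof -
  have card: "cnt p k [u] c = int (card {a \<in> {0..<p ^ k}. [u * a\<^sup>2 = c] (mod p)})"
  proof -
    have "cnt p k [u] c = (\<Sum>a\<in>{0..<p ^ k}. if [u * a\<^sup>2 = c] (mod p) then 1 else 0)"
      by (auto intro!: sum.cong simp: cong_iff_dvd_diff dvd_diff_commute)
    then show ?thesis by (simp add: sum.If_cases Int_def)
  qed
  have eq: "[u * a\<^sup>2 = c] (mod p) \<longleftrightarrow> [(u * a)\<^sup>2 = u * c] (mod p)" for a
    using cong_mult_unit[OF assms(1), of "u * a\<^sup>2" c] by (simp add: power2_eq_square ac_simps)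
  consider "chi (u * c) = 1" | "chi (u * c) = - 1" using chi_unit[of "u * c"] assms by auto
  then show ?thesis
  proof cases
    case 1
    then obtain z where z: "[z\<^sup>2 = u * c] (mod p)" using chi_eq_1D by blast
    obtain u' where u': "[u * u' = 1] (mod p)" "coprime u' p" using inverse_mod_p assms(1) by blast
    have "coprime (u * c) p" using assms by simp
    then have "coprime (z\<^sup>2) p" using z by (metis cong_imp_coprime cong_sym)
    then have cz: "coprime z p" by simp
    define r where "r = u' * z"
    have ur: "[u * r = z] (mod p)"
      using cong_scalar_right[OF u'(1), of z] by (simp add: r_def mult.assoc)
    have "[u * a\<^sup>2 = c] (mod p) \<longleftrightarrow> [a = r] (mod p) \<or> [a = - r] (mod p)" for a
    proof -
      have r2: "[(u * r)\<^sup>2 = u * c] (mod p)" using cong_pow[OF ur, of 2] z cong_trans by blast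
      have "[u * a\<^sup>2 = c] (mod p) \<longleftrightarrow> [(u * a)\<^sup>2 = (u * r)\<^sup>2] (mod p)"
        unfolding eq cong_cong_right[OF r2] by (rule refl)
      also have "\<dots> \<longleftrightarrow> [u * a = u * r] (mod p) \<or> [u * a = u * (- r)] (mod p)" by (simp add: sq_cong_iff)
      finally show ?thesis unfolding cong_mult_unit[OF assms(1)] .
    qed
    moreover have "\<not> [r = - r] (mod p)"
    proof
      assume "[r = - r] (mod p)"
      then have "p dvd 2 * r" by (simp add: cong_iff_dvd_diff)
      then have "p dvd r" using prime_p p_gt_2 by (auto simp: prime_dvd_mult_iff dest: zdvd_imp_le)
      then show False using u'(2) cz prime_p by (auto simp: r_def coprime_iff prime_dvd_mult_iff)
    qed
    ultimately have "cnt p k [u] c = 2 * p ^ (k - 1)"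
      unfolding card using two_residues_card by (simp add: less_imp_le)
    then show ?thesis using 1 k_split by (simp add: excess_def)
  next
    case 2
    then have "cnt p k [u] c = 0" unfolding card eq using chi_eq_m1D by simp
    then show ?thesis using 2 by (simp add: excess_def)
  qed
qed

text \<open>Two coordinates are removed at a time. The -1 for even length is the excess of the empty
  list at a unit \<open>c\<close>; for odd length one coordinate is left over and contributes
  \<open>chi c\<close>.\<close>

lemma excess_eq:
  assumes "\<forall>u\<in>set us. coprime u p" "coprime c p"
  shows "excess us c = (if even (length us) then - 1 else p ^ k * chi c) *
    chi (- 1) ^ (length us div 2) * chi (prod_list us) * (p * (p ^ (k - 1))\<^sup>2) ^ (length us div 2)"
  using assms(1)
proof (induction us rule: induct_list012)
  case 1
  then show ?case using assms(2) by (simp add: excess_def coprime_iff)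
next
  case (2 u)
  then show ?case using excess_single assms(2) by (simp add: chi_mult)
next
  case (3 u w us)
  then have "excess us c = (if even (length us) then - 1 else p ^ k * chi c) *
    chi (- 1) ^ (length us div 2) * chi (prod_list us) * (p * (p ^ (k - 1))\<^sup>2) ^ (length us div 2)" by simp
  moreover have "- (u * w) = - 1 * u * w" by simp
  then have "chi (- (u * w)) = chi (- 1) * chi u * chi w" by (simp only: chi_mult)
  moreover have "length (u # w # us) div 2 = Suc (length us div 2)" "even (length (u # w # us)) = even (length us)"
    by simp_all
  moreover have "coprime u p" "coprime w p" using 3 by auto
  ultimately show ?case
    by (simp only: excess_pair prod_list.Cons chi_mult power_Suc mult.assoc mult.commute mult.left_commute)
qed

end


section \<open>Classification of non-degenerate forms\<close>

text \<open>\<open>p_divisible\<close> is nondegeneracy on V/pV: if \<open>x\<close> pairs with all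
  of \<open>V\<close> into multiples of \<open>p\<close>, then \<open>x\<close> lies in pV. With
  \<open>nondeg\<close> it replaces a basis, so that kernels and images of operators can be treated
  directly.\<close>

locale form_space = bform +
  assumes nondeg: "x \<in> V \<Longrightarrow> (\<And>y. y \<in> V \<Longrightarrow> b x y = 0) \<Longrightarrow> x = 0"
    and p_divisible: "x \<in> V \<Longrightarrow> (\<And>y. y \<in> V \<Longrightarrow> (p ^ (k - 1)) *z b x y = 0) \<Longrightarrow> \<exists>y\<in>V. x = p *z y"

text \<open>Additivity suffices by \<open>additive_zscale\<close>. Source and target may have
  different types, which lets abstract spaces be compared with coordinate spaces.\<close>

definition isom :: "'v::ab_group_add set \<Rightarrow> ('v \<Rightarrow> 'v \<Rightarrow> qz) \<Rightarrow> 'w::ab_group_add set \<Rightarrow> ('w \<Rightarrow> 'w \<Rightarrow> qz) \<Rightarrow> ('v \<Rightarrow> 'w) \<Rightarrow> bool"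
  where "isom V b W c f \<longleftrightarrow> bij_betw f V W \<and> (\<forall>x\<in>V. \<forall>y\<in>V. f (x + y) = f x + f y) \<and>
    (\<forall>x\<in>V. \<forall>y\<in>V. c (f x) (f y) = b x y)"

lemma isomD:
  assumes "isom V b W c f"
  shows "bij_betw f V W" "x \<in> V \<Longrightarrow> f x \<in> W" "x \<in> V \<Longrightarrow> y \<in> V \<Longrightarrow> f (x + y) = f x + f y"
    "x \<in> V \<Longrightarrow> y \<in> V \<Longrightarrow> c (f x) (f y) = b x y"
  using assms by (auto simp: isom_def bij_betw_def)

lemma isom_comp: "isom V b W c f \<Longrightarrow> isom W c X d g \<Longrightarrow> isom V b X d (g \<circ> f)"
  unfolding isom_def using bij_betw_trans[of f V W g X] bij_betwE[of f V W] by simp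

lemma isom_inv:
  assumes "isom V b W c f" "\<And>x y. x \<in> V \<Longrightarrow> y \<in> V \<Longrightarrow> x + y \<in> V"
  shows "isom W c V b (inv_into V f)"
proof -
  note f = isomD[OF assms(1)]
  have inv: "inv_into V f y \<in> V" "f (inv_into V f y) = y" if "y \<in> W" for y
    using that f(1) by (auto simp: bij_betw_def inv_into_into f_inv_into_f)
  have inv2: "inv_into V f (f x) = x" if "x \<in> V" for x
    using that f(1) by (auto simp: bij_betw_def)
  have "inv_into V f (x + y) = inv_into V f x + inv_into V f y" if "x \<in> W" "y \<in> W" for x y
    using that inv inv2 f(3) assms(2) by metis
  moreover have "b (inv_into V f x) (inv_into V f y) = c x y" if "x \<in> W" "y \<in> W" for x y
    using that inv f(4) by metis
  ultimately show ?thesis unfolding isom_def using bij_betw_inv_into[OF f(1)] by auto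
qed

lemma diag_units: "diag p k b V us \<Longrightarrow> \<forall>u\<in>set us. coprime u p"
  by (induction rule: diag.induct) auto

section \<open>Lifting congruences from p to p^k\<close>

text \<open>A first-order Taylor expansion with visible derivative term: for exponent
  \<open>p\<close> and \<open>x\<close>, \<open>y\<close> congruent modulo \<open>p\<close>, the
  second factor is divisible by \<open>p\<close>. It is stated for rings because it serves integers
  and polynomials alike.\<close>

lemma power_diff_expand:
  fixes x y :: "'a::comm_ring_1"
  shows "\<exists>s. x ^ n - y ^ n = (x - y) * ((x - y) * s + of_nat n * y ^ (n - 1))"
proof (induct n)
  case 0
  show ?case by (rule exI[of _ 0]) simp
next
  case (Suc n)
  then obtain s where s: "x ^ n - y ^ n = (x - y) * ((x - y) * s + of_nat n * y ^ (n - 1))" by blast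
  have "x ^ Suc n - y ^ Suc n = x * (x ^ n - y ^ n) + (x - y) * y ^ n" by (simp add: algebra_simps)
  also have "\<dots> = (x - y) * ((x - y) * (x * s + of_nat n * y ^ (n - 1)) + (of_nat n * (y * y ^ (n - 1)) + y ^ n))"
    unfolding s by (simp add: algebra_simps)
  also have "of_nat n * (y * y ^ (n - 1)) + y ^ n = of_nat (Suc n) * y ^ (Suc n - 1)"
    by (cases n) (simp_all add: algebra_simps)
  finally show ?case by blast
qed

context odd_prime_power
begin

lemma power_p_cong:
  assumes "[x = y] (mod p ^ Suc j)"
  shows "[x ^ nat p = y ^ nat p] (mod p ^ Suc (Suc j))"
proof -
  obtain s where s: "x ^ nat p - y ^ nat p = (x - y) * ((x - y) * s + of_nat (nat p) * y ^ (nat p - 1))"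
    using power_diff_expand by blast
  have xy: "p ^ Suc j dvd x - y" using assms by (simp add: cong_iff_dvd_diff)
  then have "p dvd x - y" by (metis dvd_mult_left power_Suc)
  then have "p dvd (x - y) * s + of_nat (nat p) * y ^ (nat p - 1)" by simp
  then have "p ^ Suc j * p dvd (x - y) * ((x - y) * s + of_nat (nat p) * y ^ (nat p - 1))"
    using xy by (rule mult_dvd_mono[rotated])
  then show ?thesis unfolding cong_iff_dvd_diff s by (simp add: mult.commute)
qed

text \<open>The quotient \<open>t = e / d\<close> is 1 modulo \<open>p\<close>, so
  \<open>t ^ M\<close> with \<open>M = p ^ (k - 1)\<close> is 1 modulo \<open>p ^ k\<close>. As
  \<open>M\<close> is odd, \<open>t\<close> is congruent to the square of \<open>t ^ h\<close> with
  \<open>h = (M + 1) / 2\<close>.\<close>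

lemma square_lift:
  assumes "coprime d p" "[d = e] (mod p)"
  shows "\<exists>z. [d * z\<^sup>2 = e] (mod p ^ k)"
proof -
  have "coprime d (p ^ k)" using assms by simp
  then obtain d' where d': "[d * d' = 1] (mod p ^ k)" using cong_solve_coprime_int by blast
  define t where "t = e * d'"
  have dt: "[d * t = e] (mod p ^ k)" using cong_scalar_left[OF d', of e] by (simp add: t_def ac_simps)
  have "[d * t = e] (mod p)" using dt k_split by (metis cong_dvd_modulus dvd_triv_left)
  then have "[d * t = d * 1] (mod p)" using assms(2) by (simp add: cong_def)
  then have t1: "[t = 1] (mod p)" using assms(1) cong_mult_unit by blast
  have pow: "[t ^ (nat p ^ j) = 1] (mod p ^ Suc j)" for j
  proof (induct j)
    case 0
    then show ?case using t1 by simp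
  next
    case (Suc j)
    then show ?case using power_p_cong[OF Suc] by (simp add: power_mult[symmetric] mult.commute)
  qed
  define M where "M = nat p ^ (k - 1)"
  have tM: "[t ^ M = 1] (mod p ^ k)" using pow[of "k - 1"] k_pos by (simp add: M_def)
  have "odd (nat p)" using odd_p p_gt_2 by (simp add: even_nat_iff)
  then have "odd M" by (simp add: M_def)
  then obtain h where h: "Suc M = h * 2" by (metis even_Suc evenE mult.commute)
  have "(t ^ h)\<^sup>2 = t * t ^ M" using h by (metis power_Suc power_mult)
  moreover have "[d * (t * t ^ M) = d * (t * 1)] (mod p ^ k)" by (intro cong_mult cong_refl tM)
  ultimately have "[d * (t ^ h)\<^sup>2 = d * t] (mod p ^ k)" by simp
  then show ?thesis using dt cong_trans by blast
qed

end

section \<open>Invariance of rank and class, and gluing of isometries\<close>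

context bform
begin

lemma unit_value: "(p ^ (k - 1)) *z fr a = 0 \<longleftrightarrow> p dvd a"
proof -
  have "(p ^ (k - 1)) *z fr a = qfrac (p ^ (k - 1) * p) (p ^ (k - 1) * a)"
    using k_split by (simp add: zscale_qfrac mult.commute)
  also have "\<dots> = qfrac p a" by (rule qfrac_cancel) simp
  finally show ?thesis by (simp add: qfrac_eq_0_iff)
qed

text \<open>The cardinality gives the rank, and the number of vectors of norm 1 modulo
  \<open>p\<close> gives the class, since the other factors in \<open>excess_eq\<close> are
  nonzero.\<close>

lemma diag_unique:
  assumes "diag p k b V us" "diag p k b V ws"
  shows "length us = length ws" "chi (prod_list us) = chi (prod_list ws)"
proof -
  have "p ^ (k * length us) = p ^ (k * length ws)"
    using diag_card[OF assms(1) bform_axioms] diag_card[OF assms(2) bform_axioms] by simp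
  then show len: "length us = length ws" using p_gt_2 k_pos by (simp add: power_inject_exp)
  have "cnt p k us 1 = cnt p k ws 1"
    using card_normset[OF assms(1) bform_axioms] card_normset[OF assms(2) bform_axioms] by metis
  then have "excess us 1 = excess ws 1" using len by (simp add: excess_def)
  moreover have "chi (- 1) \<noteq> 0" using chi_unit[of "- 1"] by auto
  ultimately show "chi (prod_list us) = chi (prod_list ws)"
    using excess_eq[of us 1] excess_eq[of ws 1] diag_units[OF assms(1)] diag_units[OF assms(2)] len
    by (simp split: if_splits)
qed

text \<open>Two coordinates represent every unit modulo \<open>p\<close>; rescaling by the factor
  from \<open>square_lift\<close> makes the norm exact.\<close>

lemma unit_norm_vector:
  assumes "diag p k b V (u # w # us)" "coprime e p"
  shows "\<exists>v\<in>V. b v v = fr e"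
proof -
  obtain v1 where v1: "v1 \<in> V" "b v1 v1 = fr u" "coprime u p" "diag p k b (perp b V v1) (w # us)"
    using assms(1) by (blast elim: diag_ConsE)
  obtain v2 where v2: "v2 \<in> perp b V v1" "b v2 v2 = fr w" "coprime w p"
    using v1(4) by (blast elim: diag_ConsE)
  have v2V: "v2 \<in> V" "b v2 v1 = 0" "b v1 v2 = 0" using v2(1) v1(1) b_sym by (auto simp: perp_def)
  obtain x y where xy: "[u * x\<^sup>2 + w * y\<^sup>2 = e] (mod p)" using binary_represents v1(3) v2(3) by blast
  then have "coprime (u * x\<^sup>2 + w * y\<^sup>2) p" using assms(2) by (metis cong_imp_coprime cong_sym)
  then obtain z where z: "[(u * x\<^sup>2 + w * y\<^sup>2) * z\<^sup>2 = e] (mod p ^ k)" using square_lift xy by blast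
  let ?v = "z *z (x *z v1 + y *z v2)"
  have "b ?v ?v = fr ((u * x\<^sup>2 + w * y\<^sup>2) * z\<^sup>2)"
    using v1 v2 v2V by (simp add: b_simps closed zscale_simps zscale_qfrac qfrac_add[symmetric] power2_eq_square algebra_simps)
  also have "\<dots> = fr e" using z qfrac_eq_iff by simp
  finally show ?thesis using v1 v2V by (intro bexI[of _ ?v]) (auto simp: closed)
qed

lemma isom_extend:
  assumes W: "bform p k W c" and v: "v \<in> V" "b v v = fr u" "coprime u p" and w: "w \<in> W" "c w w = fr u"
    and f: "isom (perp b V v) b (perp c W w) c f"
  shows "\<exists>F. isom V b W c F"
proof -
  interpret W: bform p k W c by (rule W)
  let ?h = "\<lambda>(a, y). a *z v + y" and ?h' = "\<lambda>(a, y). a *z w + y"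
  let ?D = "{0..<p ^ k} \<times> perp b V v"
  note bij = line_decomp_bij[OF v] and bij' = W.line_decomp_bij[OF w v(3)]
  define F where "F = ?h' \<circ> map_prod id f \<circ> inv_into ?D ?h"
  have "bij_betw (map_prod id f) ?D ({0..<p ^ k} \<times> perp c W w)"
    using isomD(1)[OF f] by (intro bij_betw_map_prod bij_betw_id)
  from bij_betw_trans[OF bij_betw_inv_into[OF bij] bij_betw_trans[OF this bij']]
  have "bij_betw F V W" by (simp only: F_def comp_assoc)
  \<comment> \<open>\<open>F\<close> is defined through the reduced coefficient, but
    \<open>p ^ k\<close> kills both \<open>v\<close> and \<open>w\<close>, so the formula holds for
    every integer \<open>a\<close>.\<close>
  moreover have F: "F (a *z v + y) = a *z w + f y" if y: "y \<in> perp b V v" for a y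
  proof -
    have "a mod p ^ k \<in> {0..<p ^ k}" using p_pow_pos[of k] by simp
    then have mem: "(a mod p ^ k, y) \<in> ?D" using y by simp
    have "a *z v = (a mod p ^ k) *z v" "a *z w = (a mod p ^ k) *z w"
      by (intro scale_cong v W.scale_cong w; simp add: cong_def)+
    moreover have "inv_into ?D ?h (?h (a mod p ^ k, y)) = (a mod p ^ k, y)"
      using bij mem by (intro inv_into_f_f) (auto simp: bij_betw_def)
    ultimately show ?thesis by (simp add: F_def)
  qed
  moreover have "F (x + x') = F x + F x' \<and> c (F x) (F x') = b x x'" if x: "x \<in> V" "x' \<in> V" for x x'
  proof -
    obtain a y where ay: "y \<in> perp b V v" "x = a *z v + y" using line_decomp[OF v x(1)] by blast
    obtain a' y' where ay': "y' \<in> perp b V v" "x' = a' *z v + y'" using line_decomp[OF v x(2)] by blast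
    have sum: "x + x' = (a + a') *z v + (y + y')" using ay ay' by (simp add: zscale_simps)
    interpret P: bform p k "perp b V v" b by (rule perp_bform) fact
    have yy: "y + y' \<in> perp b V v" using ay ay' P.add_V by blast
    have fy: "f y \<in> W" "f y' \<in> W" "c (f y) w = 0" "c (f y') w = 0" "c w (f y) = 0" "c w (f y') = 0"
      using isomD(2)[OF f ay(1)] isomD(2)[OF f ay'(1)] w W.b_sym by (auto simp: perp_def)
    have y: "y \<in> V" "y' \<in> V" "b y v = 0" "b y' v = 0" "b v y = 0" "b v y' = 0"
      using ay ay' v b_sym by (auto simp: perp_def)
    have "c (f y) (f y') = b y y'" using isomD(4)[OF f] ay ay' by blast
    then have "c (a *z w + f y) (a' *z w + f y') = b (a *z v + y) (a' *z v + y')"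
      using fy y v w by (simp add: b_simps closed W.b_simps W.closed)
    moreover have "f (y + y') = f y + f y'" using isomD(3)[OF f] ay ay' by blast
    then have "F (x + x') = F x + F x'"
      unfolding sum F[OF yy] using ay ay' by (simp add: F zscale_simps)
    ultimately show ?thesis using ay ay' by (simp add: F)
  qed
  ultimately show ?thesis unfolding isom_def by blast
qed

end

section \<open>Orthogonal summands and orthogonal bases\<close>

context form_space
begin

text \<open>Only pairings inside \<open>W\<close> matter, since the \<open>U\<close> part of every
  vector pairs to zero with \<open>W\<close>.\<close>

lemma orth_summand:
  assumes W: "W \<subseteq> V" "0 \<in> W" "\<And>x y. x \<in> W \<Longrightarrow> y \<in> W \<Longrightarrow> x + y \<in> W"
    and U: "U \<subseteq> V" and dec: "\<And>x. x \<in> V \<Longrightarrow> \<exists>w\<in>W. \<exists>u\<in>U. x = w + u"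
    and orth: "\<And>w u. w \<in> W \<Longrightarrow> u \<in> U \<Longrightarrow> b w u = 0"
  shows "form_space p k W b"
proof -
  interpret W: bform p k W b using W by (rule subspace)
  show ?thesis
  proof
    fix x assume x: "x \<in> W" and *: "\<And>y. y \<in> W \<Longrightarrow> b x y = 0"
    show "x = 0"
    proof (rule nondeg)
      fix y assume "y \<in> V"
      then obtain w u where wu: "w \<in> W" "u \<in> U" "y = w + u" using dec by blast
      then have "b x y = b x w + b x u" using x W(1) U by (auto simp: b_add_right subset_iff)
      then show "b x y = 0" using * orth x wu by simp
    qed (use x W in auto)
  next
    fix x assume x: "x \<in> W" and *: "\<And>y. y \<in> W \<Longrightarrow> (p ^ (k - 1)) *z b x y = 0"
    have "\<exists>y\<in>V. x = p *z y"
    proof (rule p_divisible)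
      fix y assume "y \<in> V"
      then obtain w u where wu: "w \<in> W" "u \<in> U" "y = w + u" using dec by blast
      then have "b x y = b x w + b x u" using x W(1) U by (auto simp: b_add_right subset_iff)
      then show "(p ^ (k - 1)) *z b x y = 0" using * orth x wu by simp
    qed (use x W in auto)
    then obtain w u where wu: "w \<in> W" "u \<in> U" "x = p *z (w + u)" using dec by blast
    have V: "w \<in> V" "u \<in> V" "x \<in> V" using wu x W U by auto
    \<comment> \<open>This vector equals \<open>p *z u\<close>. It lies in \<open>W\<close>, hence
      is orthogonal to \<open>U\<close>; as a multiple of \<open>u\<close> it is orthogonal to
      \<open>W\<close> too.\<close>
    have "x - p *z w = 0"
    proof (rule nondeg)
      fix y assume "y \<in> V"
      then obtain w' u' where wu': "w' \<in> W" "u' \<in> U" "y = w' + u'" using dec by blast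
      have V': "w' \<in> V" "u' \<in> V" using wu' W U by auto
      have "x - p *z w \<in> W" using x wu W.closed by blast
      then have "b (x - p *z w) u' = 0" using orth wu' by blast
      moreover have "x - p *z w = p *z u" using wu by (simp add: zscale_simps)
      then have "b (x - p *z w) w' = 0"
        using V V' orth[OF wu'(1) wu(2)] by (simp add: b_scale_left b_sym[of u w'])
      ultimately show "b (x - p *z w) y = 0" using V V' wu' by (simp add: b_add_right closed)
    qed (use V in \<open>auto simp: closed\<close>)
    then show "\<exists>y\<in>W. x = p *z y" using wu by auto
  qed
qed

lemma perp_form_space:
  assumes v: "v \<in> V" "b v v = fr u" "coprime u p"
  shows "form_space p k (perp b V v) b"
proof (rule orth_summand[where U = "range (\<lambda>a. a *z v)"])
  interpret P: bform p k "perp b V v" b by (rule perp_bform) fact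
  show "0 \<in> perp b V v" "\<And>x y. x \<in> perp b V v \<Longrightarrow> y \<in> perp b V v \<Longrightarrow> x + y \<in> perp b V v"
    using P.add_V by auto
  show "range (\<lambda>a. a *z v) \<subseteq> V" using v closed by auto
  show "b w x = 0" if "w \<in> perp b V v" "x \<in> range (\<lambda>a. a *z v)" for w x
    using that v by (auto simp: perp_def b_simps)
  fix x assume "x \<in> V"
  then obtain a y where "y \<in> perp b V v" "x = a *z v + y" using line_decomp[OF v] by blast
  then show "\<exists>w\<in>perp b V v. \<exists>u\<in>range (\<lambda>a. a *z v). x = w + u"
    by (intro bexI[of _ y] bexI[of _ "a *z v"]) (auto simp: add.commute)
qed (auto simp: perp_def)

text \<open>Otherwise every vector would be divisible by \<open>p\<close>, hence by
  \<open>p ^ k\<close>, hence zero.\<close>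

lemma exists_indivisible:
  assumes "V \<noteq> {0}"
  obtains x where "x \<in> V" "\<not> (\<exists>y\<in>V. x = p *z y)"
proof -
  have "\<exists>x\<in>V. \<not> (\<exists>y\<in>V. x = p *z y)"
  proof (rule ccontr)
    assume "\<not> ?thesis"
    then have *: "\<exists>y\<in>V. x = p *z y" if "x \<in> V" for x using that by blast
    have "\<exists>y\<in>V. x = (p ^ j) *z y" if "x \<in> V" for x j
    proof (induct j)
      case (Suc j)
      then obtain y where y: "y \<in> V" "x = (p ^ j) *z y" by blast
      then obtain z where "z \<in> V" "y = p *z z" using * by blast
      then show ?case using y by (auto simp: mult.commute)
    qed (use that in auto)
    from this[of _ k] have "x = 0" if "x \<in> V" for x using that torsion by blast
    then show False using assms zero_V by blast
  qed
  then show ?thesis using that by blast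
qed

lemma exists_unit_pair:
  assumes "x \<in> V" "\<not> (\<exists>y\<in>V. x = p *z y)"
  obtains y a where "y \<in> V" "b x y = fr a" "coprime a p"
proof -
  obtain y where y: "y \<in> V" "(p ^ (k - 1)) *z b x y \<noteq> 0" using p_divisible assms by blast
  obtain a where a: "b x y = fr a" using b_frac assms y by blast
  then show ?thesis using y that unit_value coprime_iff by metis
qed

text \<open>Polarization: if \<open>x\<close>, \<open>y\<close> and \<open>x + y\<close> all had
  norms divisible by \<open>p\<close>, then so would be \<open>2 * a\<close>, although
  \<open>a\<close> is a unit and \<open>p\<close> is odd.\<close>

lemma exists_unit_norm:
  assumes "V \<noteq> {0}"
  obtains v u where "v \<in> V" "b v v = fr u" "coprime u p"
proof -
  obtain x where x: "x \<in> V" "\<not> (\<exists>y\<in>V. x = p *z y)" using exists_indivisible assms by blast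
  obtain y a where y: "y \<in> V" "b x y = fr a" "coprime a p" using exists_unit_pair x by blast
  obtain c d where cd: "b x x = fr c" "b y y = fr d" using b_frac x y by metis
  have sum: "b (x + y) (x + y) = fr (c + d + 2 * a)"
    using x y cd b_sym[of y x] by (simp add: b_simps closed qfrac_add[symmetric] ac_simps)
  have "\<not> p dvd c \<or> \<not> p dvd d \<or> \<not> p dvd c + d + 2 * a"
  proof (rule ccontr)
    assume "\<not> ?thesis"
    then have "p dvd c + d + 2 * a" "p dvd c + d" by auto
    from dvd_diff[OF this] have "p dvd 2 * a" by simp
    then show False using y(3) prime_p p_gt_2 by (auto simp: prime_dvd_mult_iff coprime_iff dest: zdvd_imp_le)
  qed
  then show ?thesis
  proof (elim disjE)
    assume "\<not> p dvd c" then show ?thesis using that[of x c] x cd coprime_iff by simp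
  next
    assume "\<not> p dvd d" then show ?thesis using that[of y d] y cd coprime_iff by simp
  next
    assume "\<not> p dvd c + d + 2 * a"
    then show ?thesis using that[OF add_V[OF x(1) y(1)] sum] coprime_iff by simp
  qed
qed

end

lemma diag_exists:
  assumes "form_space p k V b"
  shows "\<exists>us. diag p k b V us"
  using assms
proof (induction "card V" arbitrary: V rule: less_induct)
  case less
  interpret form_space p k V b by fact
  show ?case
  proof (cases "V = {0}")
    case True
    then show ?thesis using diag_Nil by blast
  next
    case False
    then obtain v u where v: "v \<in> V" "b v v = fr u" "coprime u p" using exists_unit_norm by blast
    have "v \<notin> perp b V v"
    proof
      assume "v \<in> perp b V v"
      then have "fr u = 0" using v by (simp add: perp_def)
      then have "p ^ k dvd u" using qfrac_eq_0_iff[of "p ^ k" u] by simp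
      moreover have "p dvd p ^ k" using k_pos by simp
      ultimately have "p dvd u" by (rule dvd_trans[rotated])
      then show False using v(3) coprime_iff by blast
    qed
    then have "perp b V v \<noteq> V" using v(1) by metis
    moreover have "perp b V v \<subseteq> V" by (auto simp: perp_def)
    ultimately have "perp b V v \<subset> V" by blast
    then have "card (perp b V v) < card V" by (intro psubset_card_mono finite_V)
    then obtain us where "diag p k b (perp b V v) us" using less(1) perp_form_space[OF v] by blast
    then show ?thesis using diag_Cons[where b = b, OF v] by blast
  qed
qed

text \<open>A common norm is found in both spaces and the two lines are matched. The complements
  again have equal rank and class by \<open>diag_unique\<close>, which takes the place of Witt
  cancellation.\<close>

lemma (in odd_prime_power) isom_exists:
  assumes "form_space p k V b" "form_space p k W c" "diag p k b V us" "diag p k c W ws"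
    and "length us = length ws" "chi (prod_list us) = chi (prod_list ws)"
  shows "\<exists>f. isom V b W c f"
  using assms
proof (induction "length us" arbitrary: V W us ws)
  case 0
  then have "V = {0}" "W = {0}" by (auto elim: diag_NilE)
  interpret V: form_space p k V b by fact
  interpret W: form_space p k W c by fact
  have "isom V b W c (\<lambda>_. 0)"
    using \<open>V = {0}\<close> \<open>W = {0}\<close> V.b_zero_left W.b_zero_left by (auto simp: isom_def bij_betw_def)
  then show ?case by blast
next
  case (Suc n)
  interpret V: form_space p k V b by fact
  interpret W: form_space p k W c by fact
  \<comment> \<open>Rank at least 2 represents 1 in both spaces. In rank 1 the classes of
    \<open>u\<close> and \<open>w\<close> agree, so rescaling the generator of \<open>V\<close>
    produces the norm \<open>w\<close>.\<close>
  have "\<exists>v w e. v \<in> V \<and> b v v = qfrac (p ^ k) e \<and> w \<in> W \<and> c w w = qfrac (p ^ k) e \<and> coprime e p"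
  proof (cases n)
    case 0
    then have "length us = Suc 0" "length ws = Suc 0" using Suc.hyps(2) Suc.prems(5) by simp_all
    then obtain u w where uw: "us = [u]" "ws = [w]" by (metis length_Suc_conv length_0_conv)
    obtain v1 where v1: "v1 \<in> V" "b v1 v1 = qfrac (p ^ k) u" "coprime u p"
      using Suc.prems(3) uw by (auto elim: diag_ConsE)
    obtain w1 where w1: "w1 \<in> W" "c w1 w1 = qfrac (p ^ k) w" "coprime w p"
      using Suc.prems(4) uw by (auto elim: diag_ConsE)
    have "chi (u * w) = 1" using Suc.prems(6) uw chi_unit[OF w1(3)] by (auto simp: chi_mult)
    then obtain x where x: "[x\<^sup>2 = u * w] (mod p)" using chi_eq_1D by blast
    obtain u' where u': "[u * u' = 1] (mod p)" "coprime u' p" using inverse_mod_p v1(3) by blast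
    have "[u'\<^sup>2 * u * x\<^sup>2 = u'\<^sup>2 * u * (u * w)] (mod p)" using x by (rule cong_scalar_left)
    also have "u'\<^sup>2 * u * (u * w) = (u * u')\<^sup>2 * w" by (simp add: power2_eq_square)
    also have "[(u * u')\<^sup>2 * w = 1\<^sup>2 * w] (mod p)" by (intro cong_mult cong_pow cong_refl u')
    finally have xw: "[u * (u' * x)\<^sup>2 = w] (mod p)" by (simp add: power_mult_distrib ac_simps)
    then have "coprime (u * (u' * x)\<^sup>2) p" using w1(3) by (metis cong_imp_coprime cong_sym)
    then obtain z where z: "[u * (u' * x)\<^sup>2 * z\<^sup>2 = w] (mod p ^ k)" using square_lift xw by blast
    let ?v = "(u' * x * z) *z v1"
    have "b ?v ?v = qfrac (p ^ k) (u * (u' * x)\<^sup>2 * z\<^sup>2)"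
      using v1 by (simp add: V.b_simps V.closed zscale_qfrac power2_eq_square ac_simps)
    also have "\<dots> = qfrac (p ^ k) w" using z qfrac_eq_iff by simp
    finally show ?thesis using w1 V.scale_V[OF v1(1)] by blast
  next
    case (Suc m)
    then have "length us = Suc (Suc m)" "length ws = Suc (Suc m)" using Suc.hyps(2) Suc.prems(5) by simp_all
    then obtain u1 u2 us' w1 w2 ws' where eq: "us = u1 # u2 # us'" "ws = w1 # w2 # ws'"
      by (metis length_Suc_conv)
    obtain v w where "v \<in> V" "b v v = qfrac (p ^ k) 1" "w \<in> W" "c w w = qfrac (p ^ k) 1"
      using V.unit_norm_vector[OF Suc.prems(3)[unfolded eq] coprime_1_left]
        W.unit_norm_vector[OF Suc.prems(4)[unfolded eq] coprime_1_left] by blast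
    then show ?thesis using coprime_1_left by blast
  qed
  then obtain v w e where v: "v \<in> V" "b v v = qfrac (p ^ k) e" and w: "w \<in> W" "c w w = qfrac (p ^ k) e" and e: "coprime e p"
    by blast
  note fs = V.perp_form_space[OF v e] W.perp_form_space[OF w e]
  obtain us' ws' where d: "diag p k b (perp b V v) us'" "diag p k c (perp c W w) ws'"
    using diag_exists[OF fs(1)] diag_exists[OF fs(2)] by blast
  then have "diag p k b V (e # us')" "diag p k c W (e # ws')" using diag_Cons[where b = b, OF v e] diag_Cons[where b = c, OF w e] by blast+
  note us = V.diag_unique[OF Suc.prems(3) this(1)] and ws = W.diag_unique[OF Suc.prems(4) this(2)]
  have len: "n = length us'" "length us' = length ws'" using us(1) ws(1) Suc.hyps(2) Suc.prems(5) by simp_all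
  have "chi e * chi (prod_list us') = chi e * chi (prod_list ws')"
    using us(2) ws(2) Suc.prems(6) by (simp only: prod_list.Cons chi_mult)
  then have "chi (prod_list us') = chi (prod_list ws')" using chi_unit[OF e] by (elim disjE) simp_all
  then obtain f where "isom (perp b V v) b (perp c W w) c f"
    using Suc.hyps(1)[OF len(1) fs d len(2)] by blast
  then show ?case using V.isom_extend[OF W.bform_axioms v e w] by blast
qed


section \<open>Isometries of prime power order\<close>

text \<open>The least period of a point divides \<open>q ^ r\<close>, so it is a power of
  \<open>q\<close>, and it does not divide \<open>q ^ j\<close>. Every orbit length is therefore a
  multiple of \<open>q ^ (j + 1)\<close>.\<close>

lemma prime_power_orbits:
  fixes g :: "'a \<Rightarrow> 'a"
  assumes q: "prime (q::nat)" and S: "finite S" "\<And>x. x \<in> S \<Longrightarrow> g x \<in> S"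
    and per: "\<And>x. x \<in> S \<Longrightarrow> (g ^^ (q ^ r)) x = x" and free: "\<And>x. x \<in> S \<Longrightarrow> (g ^^ (q ^ j)) x \<noteq> x"
  shows "q ^ Suc j dvd card S"
proof -
  define orb where "orb x = (\<lambda>i. (g ^^ i) x) ` UNIV" for x
  have funpow_S: "(g ^^ i) x \<in> S" if "x \<in> S" for i x
    using that S(2) by (induct i) auto
  have orb_dvd: "q ^ Suc j dvd card (orb x)" if x: "x \<in> S" for x
  proof -
    define d where "d = (LEAST d. d > 0 \<and> (g ^^ d) x = x)"
    have "q ^ r > 0 \<and> (g ^^ (q ^ r)) x = x" using per x q by (simp add: prime_gt_0_nat)
    then have "d > 0 \<and> (g ^^ d) x = x" unfolding d_def by (rule LeastI)
    then have d: "d > 0" "(g ^^ d) x = x" by auto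
    have least: "(g ^^ i) x \<noteq> x" if "0 < i" "i < d" for i
      using that not_less_Least unfolding d_def by blast
    have dvd_iff: "d dvd i" if "(g ^^ i) x = x" for i
    proof -
      have "(g ^^ (i mod d)) x = x" using that d funpow_mod_eq by metis
      then show ?thesis using least[of "i mod d"] d by (auto simp: dvd_eq_mod_eq_0)
    qed
    have "inj_on (\<lambda>i. (g ^^ i) x) {..<d}"
    proof (rule linorder_inj_onI)
      fix i l assume "i < l" and il: "i \<in> {..<d}" "l \<in> {..<d}"
      show "(g ^^ i) x \<noteq> (g ^^ l) x"
      proof
        assume "(g ^^ i) x = (g ^^ l) x"
        then have "(g ^^ (d - l + i)) x = (g ^^ (d - l + l)) x" by (simp only: funpow_add comp_apply)
        then have "(g ^^ (d - l + i)) x = x" using il d by simp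
        moreover have "0 < d - l + i" and lt: "d - l + i < d" using \<open>i < l\<close> il by auto
        ultimately show False using least[OF _ lt] by simp
      qed
    qed auto
    moreover have "orb x = (\<lambda>i. (g ^^ i) x) ` {..<d}"
    proof
      show "orb x \<subseteq> (\<lambda>i. (g ^^ i) x) ` {..<d}"
      proof (clarsimp simp: orb_def)
        fix i
        have "(g ^^ i) x = (g ^^ (i mod d)) x" using d funpow_mod_eq by metis
        then show "(g ^^ i) x \<in> (\<lambda>i. (g ^^ i) x) ` {..<d}" using d by auto
      qed
    qed (auto simp: orb_def)
    ultimately have "card (orb x) = d" by (simp add: card_image)
    moreover obtain i where i: "d = q ^ i"
      using dvd_iff[OF per[OF x]] q divides_primepow_nat by blast
    moreover have "Suc j \<le> i"
    proof (rule ccontr)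
      assume "\<not> Suc j \<le> i"
      then have "i \<le> j" by simp
      then obtain m where "q ^ j = d * m" using i by (metis le_imp_power_dvd dvdE)
      then have "(g ^^ (q ^ j)) x = ((g ^^ d) ^^ m) x" by (simp add: funpow_mult)
      also have "\<dots> = x" using d(2) by (induct m) auto
      finally show False using free x by blast
    qed
    ultimately show ?thesis by (metis le_imp_power_dvd)
  qed
  \<comment> \<open>Every forward orbit is a cycle: continuing from the \<open>i\<close>-th iterate
    up to exponent \<open>q ^ r * i\<close> leads back to \<open>x\<close>. Hence orbits are equal
    or disjoint.\<close>
  have return: "x \<in> orb ((g ^^ i) x)" if "x \<in> S" for x i
  proof -
    have "((g ^^ (q ^ r)) ^^ i) x = x" using per that by (induct i) auto
    then have "(g ^^ (q ^ r * i)) x = x" by (simp add: funpow_mult)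
    moreover have "1 \<le> q ^ r" using prime_ge_1_nat[OF q] by (rule one_le_power)
    from mult_le_mono1[OF this, of i] have "i \<le> q ^ r * i" by (simp only: mult_1)
    then have "(g ^^ (q ^ r * i)) x = (g ^^ (q ^ r * i - i)) ((g ^^ i) x)"
      by (metis comp_apply funpow_add le_add_diff_inverse2)
    ultimately show ?thesis unfolding orb_def by (metis rangeI)
  qed
  have sub: "orb ((g ^^ i) x) \<subseteq> orb x" for x i
  proof
    fix y assume "y \<in> orb ((g ^^ i) x)"
    then obtain l where "y = (g ^^ l) ((g ^^ i) x)" by (auto simp: orb_def)
    then have "y = (g ^^ (l + i)) x" by (simp add: funpow_add)
    then show "y \<in> orb x" unfolding orb_def by blast
  qed
  have self: "x \<in> orb x" for x unfolding orb_def by (rule image_eqI[of _ _ 0]) auto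
  have eq: "orb ((g ^^ i) x) = orb x" if xS: "x \<in> S" for x i
  proof
    obtain l where "x = (g ^^ l) ((g ^^ i) x)" using return[OF xS] unfolding orb_def by blast
    then show "orb x \<subseteq> orb ((g ^^ i) x)" using sub by metis
  qed (rule sub)
  have union: "\<Union> (orb ` S) = S" using self funpow_S by (auto simp: orb_def)
  have "q ^ Suc j dvd card (\<Union> (orb ` S))"
  proof (rule dvd_partition)
    show "finite (\<Union> (orb ` S))" using union S by simp
    show "\<forall>c\<in>orb ` S. q ^ Suc j dvd card c" using orb_dvd by blast
    show "\<forall>c1\<in>orb ` S. \<forall>c2\<in>orb ` S. c1 \<noteq> c2 \<longrightarrow> c1 \<inter> c2 = {}"
    proof (intro ballI impI, rule ccontr)
      fix c1 c2 assume "c1 \<in> orb ` S" "c2 \<in> orb ` S" "c1 \<noteq> c2" "c1 \<inter> c2 \<noteq> {}"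
      then obtain x y z where "x \<in> S" "y \<in> S" "c1 = orb x" "c2 = orb y" "z \<in> orb x" "z \<in> orb y" by blast
      then obtain i l where "z = (g ^^ i) x" "z = (g ^^ l) y" unfolding orb_def by blast
      then show False using eq \<open>x \<in> S\<close> \<open>y \<in> S\<close> \<open>c1 = orb x\<close> \<open>c2 = orb y\<close> \<open>c1 \<noteq> c2\<close> by metis
    qed
  qed
  then show ?thesis using union by simp
qed

lemma isom_id: "isom V b V b (\<lambda>x. x)"
  by (simp add: isom_def bij_betw_def)

lemma isom_funpow: "isom V b V b g \<Longrightarrow> isom V b V b (g ^^ i)"
  by (induct i) (auto simp: isom_comp id_def isom_id)

lemma (in bform) isom_scale: "isom V b W c f \<Longrightarrow> x \<in> V \<Longrightarrow> f (a *z x) = a *z f x"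
  using isomD(3) by (rule additive_zscale) (auto simp: scale_V)

lemma (in bform) isom_zero: "isom V b W c f \<Longrightarrow> f 0 = 0"
  using isom_scale[of W c f 0 0] by simp

lemma (in bform) isom_sum:
  assumes "isom V b W c f" "\<And>i. i \<in> I \<Longrightarrow> h i \<in> V"
  shows "f (sum h I) = (\<Sum>i\<in>I. f (h i))"
  using assms(2)
proof (induct I rule: infinite_finite_induct)
  case (insert i I)
  then show ?case using isomD(3)[OF assms(1)] by (simp add: sum_V)
qed (simp_all add: isom_zero[OF assms(1)])

section \<open>Closed formulas for the counts in even and odd rank\<close>

context odd_prime_power
begin

lemma cnt_nonneg: "cnt p k us c \<ge> 0"
  by (induct us arbitrary: c) (auto intro: sum_nonneg)

text \<open>If every unit were a square, each of the \<open>p - 1\<close> nonzero residues would be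
  a value of squaring twice as often as the average, which exceeds the number of arguments for
  \<open>p > 2\<close>.\<close>

lemma exists_nonresidue: "\<exists>c. coprime c p \<and> chi c = - 1"
proof (rule ccontr)
  assume "\<not> ?thesis"
  then have one: "chi c = 1" if "coprime c p" for c using chi_unit[OF that] that by blast
  have unit: "p * cnt p k [1] (0 - e) = 2 * p ^ k" if "e \<in> {1..<p}" for e
  proof -
    have "coprime (- e) p" using that by (simp add: coprime_iff zdvd_not_zless)
    then show ?thesis using excess_single[of 1 "- e"] one by (simp add: excess_def)
  qed
  have ins: "{0..<p} = insert 0 {1..<p}" by auto
  have "p * p ^ k = (\<Sum>e\<in>{0..<p}. p * cnt p k [1] (0 - e))"
    using cnt_total[of "[1]" 0] by (simp del: cnt.simps add: sum_distrib_left[symmetric])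
  also have "\<dots> = p * cnt p k [1] 0 + (\<Sum>e\<in>{1..<p}. 2 * p ^ k)"
    unfolding ins using unit by (simp del: cnt.simps)
  also have "\<dots> \<ge> (p - 1) * (2 * p ^ k)" using cnt_nonneg[of "[1]" 0] p_gt_2 by (simp del: cnt.simps)
  finally have "(p - 2) * p ^ k \<le> 0" by (simp add: algebra_simps)
  then show False using p_gt_2 p_pow_pos[of k] by (simp add: mult_le_0_iff)
qed

lemma cnt_even:
  assumes "\<forall>u\<in>set us. coprime u p" "coprime c p" "length us = 2 * N"
  shows "p * cnt p k us c = (p * (p ^ (k - 1))\<^sup>2) ^ N * (p ^ N - chi (- 1) ^ N * chi (prod_list us))"
proof -
  have "p ^ (k * length us) = (p ^ k * p ^ k) ^ N"
    by (simp add: assms(3) power_mult power_mult_distrib[symmetric] power2_eq_square)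
  also have "p ^ k * p ^ k = p * (p * (p ^ (k - 1))\<^sup>2)" unfolding k_split by (simp add: power2_eq_square)
  finally have "p ^ (k * length us) = p ^ N * (p * (p ^ (k - 1))\<^sup>2) ^ N" by (simp only: power_mult_distrib)
  then show ?thesis using excess_eq[OF assms(1,2)] assms(3) by (simp add: excess_def algebra_simps)
qed

text \<open>Unlike in \<open>cnt_even\<close>, the class of \<open>c\<close> enters; comparing the
  two classes is what rules out odd rank for free automorphisms.\<close>

lemma cnt_odd:
  assumes "\<forall>u\<in>set us. coprime u p" "coprime c p" "length us = 2 * N + 1"
  shows "p * cnt p k us c = p ^ k * (p * (p ^ (k - 1))\<^sup>2) ^ N * (p ^ N + chi (- 1) ^ N * chi (prod_list us) * chi c)"
proof -
  have "p ^ (k * length us) = p ^ k * (p ^ k * p ^ k) ^ N"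
    by (simp add: assms(3) power_mult power_add power_mult_distrib[symmetric] power2_eq_square)
  also have "p ^ k * p ^ k = p * (p * (p ^ (k - 1))\<^sup>2)" unfolding k_split by (simp add: power2_eq_square)
  finally have "p ^ (k * length us) = p ^ k * (p ^ N * (p * (p ^ (k - 1))\<^sup>2) ^ N)" by (simp only: power_mult_distrib)
  then show ?thesis using excess_eq[OF assms(1,2)] assms(3) by (simp add: excess_def algebra_simps)
qed

lemma chi_disc_unit:
  assumes "\<forall>u\<in>set us. coprime u p"
  shows "chi (- 1) ^ N * chi (prod_list us) = 1 \<or> chi (- 1) ^ N * chi (prod_list us) = - 1"
proof -
  have "coprime (prod_list us) p" using assms by (induct us) auto
  moreover have "chi (- 1) ^ N = 1 \<or> chi (- 1) ^ N = - 1"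
    using chi_unit[of "- 1"] by (induct N) auto
  ultimately show ?thesis using chi_unit[of "prod_list us"] by auto
qed

end

context bform
begin

text \<open>An automorphism whose power \<open>g ^^ q ^ j\<close> has no fixed points acts on the vectors of norm \<open>c \<noteq> 0\<close>
  with orbits of length divisible by \<open>q ^ (j + 1)\<close>.\<close>

lemma free_automorphism:
  assumes d: "diag p k b V us" and g: "isom V b V b g"
    and q: "prime q" "odd q" "coprime (int q) p"
    and per: "\<And>x. x \<in> V \<Longrightarrow> (g ^^ (q ^ r)) x = x"
    and free: "\<And>x. x \<in> V \<Longrightarrow> (g ^^ (q ^ j)) x = x \<Longrightarrow> x = 0"
  obtains N where "length us = 2 * N" "int (q ^ Suc j) dvd p ^ N - chi (- 1) ^ N * chi (prod_list us)"
proof -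
  have units: "\<forall>u\<in>set us. coprime u p" using d by (rule diag_units)
  have dvd_cnt: "int (q ^ Suc j) dvd p * cnt p k us c" if c: "coprime c p" for c
  proof -
    have "0 \<notin> normset p k b V c" using normset_iff[of 0 0 c] c by (auto simp: coprime_iff cong_sym_eq[of 0] cong_0_iff)
    moreover have "g x \<in> normset p k b V c" if "x \<in> normset p k b V c" for x
      using that isomD(2,4)[OF g] by (auto simp: normset_def)
    moreover have "normset p k b V c \<subseteq> V" by (auto simp: normset_def)
    moreover from this have "finite (normset p k b V c)" using finite_V finite_subset by blast
    ultimately have "q ^ Suc j dvd card (normset p k b V c)"
      using per free q by (intro prime_power_orbits[where g = g and r = r]) (auto simp: subset_iff)
    then have "int (q ^ Suc j) dvd int (card (normset p k b V c))" by (simp only: of_nat_dvd_iff)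
    then show ?thesis unfolding card_normset[OF d bform_axioms] by simp
  qed
  have cop: "coprime (int (q ^ Suc j)) (p ^ i)" for i using q(3) by simp
  have copP: "coprime (int (q ^ Suc j)) ((p * (p ^ (k - 1))\<^sup>2) ^ N)" for N
    using q(3) by simp
  show ?thesis
  proof (cases "even (length us)")
    case True
    then obtain N where N: "length us = 2 * N" by (elim evenE)
    have "int (q ^ Suc j) dvd (p * (p ^ (k - 1))\<^sup>2) ^ N * (p ^ N - chi (- 1) ^ N * chi (prod_list us))"
      using dvd_cnt[of 1] cnt_even[OF units _ N, of 1] by simp
    then have "int (q ^ Suc j) dvd p ^ N - chi (- 1) ^ N * chi (prod_list us)"
      by (simp only: coprime_dvd_mult_right_iff[OF copP])
    then show ?thesis using that N by blast
  next
    case False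
    then obtain N where N: "length us = 2 * N + 1" by (elim oddE)
    let ?e = "chi (- 1) ^ N * chi (prod_list us)"
    \<comment> \<open>With \<open>c = 1\<close> and \<open>c\<close> a nonresidue, \<open>q\<close>
      divides both \<open>p ^ N + ?e\<close> and \<open>p ^ N - ?e\<close>, hence it divides
      2.\<close>
    have "int q dvd p ^ N + ?e * chi c" if c: "coprime c p" for c
    proof -
      have "int (q ^ Suc j) dvd p ^ k * (p * (p ^ (k - 1))\<^sup>2) ^ N * (p ^ N + ?e * chi c)"
        using dvd_cnt[OF c] cnt_odd[OF units c N] by simp
      then have "int (q ^ Suc j) dvd p ^ N + ?e * chi c"
        by (simp only: mult.assoc coprime_dvd_mult_right_iff[OF copP] coprime_dvd_mult_right_iff[OF cop])
      moreover have "int q dvd int (q ^ Suc j)" by simp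
      ultimately show ?thesis by (rule dvd_trans[rotated])
    qed
    moreover obtain c where "coprime c p" "chi c = - 1" using exists_nonresidue by blast
    ultimately have "int q dvd p ^ N + ?e * 1" "int q dvd p ^ N + ?e * (- 1)"
      using chi_one coprime_1_left by metis+
    then have "int q dvd (p ^ N + ?e * 1) - (p ^ N + ?e * (- 1))" by (rule dvd_diff)
    also have "(p ^ N + ?e * 1) - (p ^ N + ?e * (- 1)) = 2 * ?e" by simp
    finally have "int q dvd 2" using chi_disc_unit[OF units, of N] by (elim disjE) simp_all
    then have "q dvd 2" by (metis of_nat_dvd_iff of_nat_numeral)
    then have "q = 2" using q(1) primes_dvd_imp_eq two_is_prime_nat by blast
    then show ?thesis using q(2) by simp
  qed
qed

end

section \<open>Splitting off the fixed vectors of a power\<close>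

context form_space
begin

text \<open>Maschke averaging for the powers of \<open>h = g ^^ d\<close>: \<open>T\<close> is their
  sum, and \<open>T\<close> divided by the unit \<open>q\<close> is the orthogonal projection to the
  fixed vectors of \<open>h\<close>. The kernel \<open>W\<close> is the complement, and it is
  \<open>g\<close>-invariant because \<open>T\<close> commutes with \<open>g\<close>.\<close>

lemma moving_part:
  assumes g: "isom V b V b g" and q: "coprime (int q) p" "q > 0"
    and per: "\<And>x. x \<in> V \<Longrightarrow> (g ^^ (d * q)) x = x" and move: "\<exists>x\<in>V. (g ^^ d) x \<noteq> x"
  obtains W where "W \<subseteq> V" "W \<noteq> {0}" "form_space p k W b" "isom W b W b g"
    "\<And>x. x \<in> W \<Longrightarrow> (g ^^ d) x = x \<Longrightarrow> x = 0"
proof -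
  define h where "h = g ^^ d"
  define T where "T x = (\<Sum>i<q. (h ^^ i) x)" for x
  have hi: "isom V b V b (h ^^ i)" for i unfolding h_def by (intro isom_funpow g)
  have h: "isom V b V b h" using hi[of 1] by simp
  have hV: "(h ^^ i) x \<in> V" if "x \<in> V" for i x using isomD(2)[OF hi] that .
  have hq: "(h ^^ q) x = x" if "x \<in> V" for x using per[OF that] by (simp add: h_def funpow_mult)
  have TV: "T x \<in> V" if "x \<in> V" for x unfolding T_def using hV that by (intro sum_V) auto
  have T_add: "T (x + y) = T x + T y" if "x \<in> V" "y \<in> V" for x y
    unfolding T_def using isomD(3)[OF hi] that by (simp add: sum.distrib)
  have T_scale: "T (a *z x) = a *z T x" if "x \<in> V" for a x
    using T_add by (rule additive_zscale) (auto simp: scale_V that)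
  have hT: "h (T x) = T x" if "x \<in> V" for x
  proof -
    have "h (T x) = (\<Sum>i<q. (h ^^ Suc i) x)"
      unfolding T_def by (subst isom_sum[OF h]) (auto simp: hV that)
    moreover have "(h ^^ 0) x + (\<Sum>i<q. (h ^^ Suc i) x) = T x + (h ^^ q) x"
      unfolding T_def by (rule trans[OF sum.lessThan_Suc_shift[where g = "\<lambda>i. (h ^^ i) x", symmetric] sum.lessThan_Suc])
    ultimately show ?thesis using hq that by simp
  qed
  have fix_T: "T x = int q *z x" if "h x = x" for x
  proof -
    have "(h ^^ i) x = x" for i using that by (induct i) auto
    then have "T x = (\<Sum>i<q. x)" by (simp add: T_def)
    also have "\<dots> = int q *z x"
    proof (induct q)
      case (Suc n)
      then show ?case using zscale_succ[of "int n" x] by (simp add: add.commute)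
    qed simp
    finally show ?thesis .
  qed
  obtain q' where q': "[int q * q' = 1] (mod p ^ k)" using unit_inverse[OF q(1)] by blast
  have inv: "q' *z int q *z x = x" if "x \<in> V" for x
    using scale_cong[OF that q'] by (simp add: mult.commute)
  define W where "W = {x \<in> V. T x = 0}"
  define U where "U = {x \<in> V. h x = x}"
  have WV: "W \<subseteq> V" by (auto simp: W_def)
  have W0: "0 \<in> W" using T_scale[of 0 0] by (simp add: W_def)
  have Wadd: "x + y \<in> W" if "x \<in> W" "y \<in> W" for x y using that T_add by (auto simp: W_def add_V)
  have dec: "\<exists>w\<in>W. \<exists>u\<in>U. x = w + u" if x: "x \<in> V" for x
  proof (intro bexI)
    have TU: "h (q' *z T x) = q' *z T x" using isom_scale[OF h] hT TV x by simp
    then show "q' *z T x \<in> U" using TV x by (simp add: U_def scale_V)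
    have "T (q' *z T x) = T x" using T_scale[OF TV[OF x]] fix_T[OF hT[OF x]] inv TV x by simp
    then have "T (x - q' *z T x) = 0"
      using T_add[of "x - q' *z T x" "q' *z T x"] x TV by (simp add: closed)
    then show "x - q' *z T x \<in> W" using x TV by (simp add: W_def closed)
  qed simp
  have orth: "b w u = 0" if "w \<in> W" "u \<in> U" for w u
  proof -
    have wu: "w \<in> V" "u \<in> V" "T w = 0" "h u = u" using that by (auto simp: W_def U_def)
    have hu: "(h ^^ i) u = u" for i using wu by (induct i) auto
    \<comment> \<open>Every power of \<open>h\<close> fixes \<open>u\<close>, so the
      \<open>q\<close> terms of \<open>b (T w) u\<close> coincide.\<close>
    have "b ((h ^^ i) w) u = b w u" for i using isomD(4)[OF hi wu(1,2)] hu by metis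
    moreover have "b (T w) u = (\<Sum>i<q. b ((h ^^ i) w) u)"
      unfolding T_def using wu hV by (intro b_sum_left) auto
    ultimately have "b (T w) u = (\<Sum>i<q. b w u)" by simp
    also have "\<dots> = int q *z b w u"
    proof (induct q)
      case (Suc n)
      then show ?case using zscale_succ[of "int n" "b w u"] by (simp add: add.commute)
    qed simp
    finally have "q' *z int q *z b w u = 0" using wu by simp
    then have "b (q' *z int q *z w) u = 0" using wu by (simp add: b_scale_left closed)
    then show ?thesis using inv wu by simp
  qed
  have fs: "form_space p k W b"
  proof (rule orth_summand[where U = U])
    show "U \<subseteq> V" by (auto simp: U_def)
  qed (fact WV W0 Wadd dec orth)+
  obtain x where x: "x \<in> V" "h x \<noteq> x" using move by (auto simp: h_def)
  then obtain w u where "w \<in> W" "u \<in> U" "x = w + u" using dec by blast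
  then have "w \<noteq> 0" using x by (auto simp: U_def)
  then have W_nontrivial: "W \<noteq> {0}" using \<open>w \<in> W\<close> by blast
  have gW: "g x \<in> W" if "x \<in> W" for x
  proof -
    have x: "x \<in> V" "T x = 0" using that by (auto simp: W_def)
    have comm: "(h ^^ i) (g x) = g ((h ^^ i) x)" for i
      unfolding h_def funpow_mult by (rule funpow_swap1[symmetric])
    have "g (T x) = T (g x)" unfolding T_def comm by (rule isom_sum[OF g]) (use hV x in auto)
    then show ?thesis using x isom_zero[OF g] isomD(2)[OF g] by (simp add: W_def)
  qed
  then have "g ` W \<subseteq> W" by blast
  moreover have "inj_on g W" using isomD(1)[OF g] WV inj_on_subset unfolding bij_betw_def by blast
  ultimately have bij: "bij_betw g W W"
    unfolding bij_betw_def using endo_inj_surj[of W g] finite_subset[OF WV finite_V] by blast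
  have isom: "isom W b W b g"
    unfolding isom_def using bij isomD(3,4)[OF g] WV by (meson subsetD)
  have free: "x = 0" if "x \<in> W" "(g ^^ d) x = x" for x
  proof -
    have "x \<in> V" "int q *z x = 0" using that fix_T[of x] by (auto simp: W_def h_def)
    then show ?thesis using inv[of x] by simp
  qed
  show ?thesis by (rule that[OF WV W_nontrivial fs isom free])
qed

text \<open>On the moving part \<open>W\<close> the power \<open>g ^^ (q ^ (r - 1))\<close> fixes
  only 0, and \<open>free_automorphism\<close> applies with \<open>j = r - 1\<close>. If
  \<open>W\<close> has full rank it is all of \<open>V\<close>, which transfers the sign to
  \<open>us\<close>.\<close>

lemma automorphism_order_bound:
  assumes d: "diag p k b V us" and g: "isom V b V b g"
    and q: "prime q" "odd q" "coprime (int q) p" and r: "r > 0"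
    and per: "\<And>x. x \<in> V \<Longrightarrow> (g ^^ (q ^ r)) x = x" and move: "\<exists>x\<in>V. (g ^^ (q ^ (r - 1))) x \<noteq> x"
  obtains N e where "N > 0" "e = 1 \<or> e = - 1" "int (q ^ r) dvd p ^ N - e" "2 * N \<le> length us"
    "2 * N = length us \<Longrightarrow> e = chi (- 1) ^ N * chi (prod_list us)"
proof -
  have qr: "q ^ (r - 1) * q = q ^ r" using r by (cases r) auto
  obtain W where W: "W \<subseteq> V" "W \<noteq> {0}" "form_space p k W b" "isom W b W b g"
    and free: "\<And>x. x \<in> W \<Longrightarrow> (g ^^ (q ^ (r - 1))) x = x \<Longrightarrow> x = 0"
    by (rule moving_part[OF g q(3) prime_gt_0_nat[OF q(1)] _ move, unfolded qr, OF per], assumption) (rule that)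
  interpret W: form_space p k W b by fact
  obtain ws where ws: "diag p k b W ws" using diag_exists W(3) by blast
  obtain N where N: "length ws = 2 * N" "int (q ^ Suc (r - 1)) dvd p ^ N - chi (- 1) ^ N * chi (prod_list ws)"
    using W.free_automorphism[OF ws W(4) q, of r "r - 1"] per W(1) free by blast
  have "N > 0"
  proof (rule ccontr)
    assume "\<not> N > 0"
    then have "ws = []" using N by simp
    then show False using ws W(2) by (auto elim: diag_NilE)
  qed
  have units: "\<forall>u\<in>set ws. coprime u p" using ws by (rule diag_units)
  have cards: "int (card W) = p ^ (k * length ws)" "int (card V) = p ^ (k * length us)"
    using diag_card[OF ws W.bform_axioms] diag_card[OF d bform_axioms] by auto
  have "card W \<le> card V" using W(1) finite_V by (rule card_mono[rotated])
  then have "p ^ (k * length ws) \<le> p ^ (k * length us)" using cards by linarith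
  then have "length ws \<le> length us" using p_gt_2 k_pos by (simp add: power_increasing_iff)
  moreover have "chi (prod_list ws) = chi (prod_list us)" if "length ws = length us"
  proof -
    have "card W = card V" using cards that by simp
    then have "W = V" using W(1) finite_V card_subset_eq by blast
    then show ?thesis using diag_unique(2) d ws by blast
  qed
  moreover have "chi (- 1) ^ N * chi (prod_list ws) = 1 \<or> chi (- 1) ^ N * chi (prod_list ws) = - 1"
    using chi_disc_unit[OF units] by blast
  ultimately show ?thesis
    using that[of N "chi (- 1) ^ N * chi (prod_list ws)"] N r \<open>N > 0\<close> by simp
qed

end


section \<open>Indecomposable isometries\<close>

text \<open>The polynomial \<open>f\<close> evaluated at the operator \<open>g\<close> by Horner's
  scheme, applied to \<open>x\<close>.\<close>

definition act :: "('v::ab_group_add \<Rightarrow> 'v) \<Rightarrow> int poly \<Rightarrow> 'v \<Rightarrow> 'v" where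
  "act g f = fold_coeffs (\<lambda>a F x. a *z x + g (F x)) f (\<lambda>x. 0)"

text \<open>The binomial coefficients strictly between the ends vanish modulo \<open>P\<close>;
  iterating gives additivity of the \<open>P ^ M\<close>-th power. It is applied to integer
  polynomials.\<close>

lemma add_power_prime_dvd:
  fixes x y :: "'a::comm_ring_1"
  assumes "prime (P::nat)"
  shows "of_nat P dvd (x + y) ^ (P ^ M) - (x ^ (P ^ M) + y ^ (P ^ M))"
proof (induct M)
  case (Suc M)
  have one: "of_nat P dvd (u + v) ^ P - (u ^ P + v ^ P)" for u v :: 'a
  proof -
    have P: "P > 0" using assms by (rule prime_gt_0_nat)
    let ?f = "\<lambda>i. of_nat (P choose i) * u ^ i * v ^ (P - i) :: 'a"
    have "(u + v) ^ P = (\<Sum>i\<le>P. ?f i)" by (rule binomial_ring)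
    also have "{..P} = insert 0 (insert P {0<..<P})" using P by auto
    then have "(\<Sum>i\<le>P. ?f i) = ?f 0 + (?f P + (\<Sum>i\<in>{0<..<P}. ?f i))"
      using P by (simp only: sum.insert finite_insert finite_greaterThanLessThan) simp
    finally have "(u + v) ^ P - (u ^ P + v ^ P) = (\<Sum>i\<in>{0<..<P}. ?f i)" by simp
    also have "of_nat P dvd \<dots>"
    proof (rule dvd_sum)
      fix i assume i: "i \<in> {0<..<P}"
      then have "P dvd (P choose i)" using assms by (intro dvd_choose_prime) auto
      then have "(of_nat P :: 'a) dvd of_nat (P choose i)" by (elim dvdE) simp
      then show "of_nat P dvd ?f i" by (intro dvd_mult2)
    qed
    finally show ?thesis .
  qed
  let ?u = "(x + y) ^ (P ^ M)" and ?v = "x ^ (P ^ M) + y ^ (P ^ M)"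
  have "?u - ?v dvd ?u ^ P - ?v ^ P" using power_diff_expand[of ?u P ?v] by (auto intro: dvdI)
  then have "of_nat P dvd ?u ^ P - ?v ^ P" using Suc dvd_trans by blast
  moreover have "of_nat P dvd ?v ^ P - ((x ^ (P ^ M)) ^ P + (y ^ (P ^ M)) ^ P)" by (rule one)
  ultimately have "of_nat P dvd (?u ^ P - ?v ^ P) + (?v ^ P - ((x ^ (P ^ M)) ^ P + (y ^ (P ^ M)) ^ P))"
    by (rule dvd_add)
  also have "\<dots> = ?u ^ P - ((x ^ (P ^ M)) ^ P + (y ^ (P ^ M)) ^ P)" by (simp add: algebra_simps)
  also have "\<dots> = (x + y) ^ (P ^ Suc M) - (x ^ (P ^ Suc M) + y ^ (P ^ Suc M))"
    by (simp only: power_Suc2 power_mult)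
  finally show ?case .
qed simp

lemma (in odd_prime_power) fermat: "[z ^ nat p = z] (mod p)"
proof (cases "p dvd z")
  case True
  have "nat p > 0" by simp
  then have "z dvd z ^ nat p" by (intro dvd_power disjI1)
  then have "p dvd z ^ nat p" using True by (rule dvd_trans[rotated])
  then show ?thesis using True by (simp add: cong_iff_dvd_diff)
next
  case False
  define h where "h = (nat p - 1) div 2"
  have "odd (nat p)" using odd_p p_gt_2 by (simp add: even_nat_iff)
  then have h: "nat p = h * 2 + 1" by (auto simp: h_def elim!: oddE)
  have "(chi z)\<^sup>2 = 1" using chi_unit[of z] False by (auto simp: coprime_iff)
  moreover have "[(chi z)\<^sup>2 = (z ^ h)\<^sup>2] (mod p)" unfolding h_def by (intro cong_pow chi_euler)
  ultimately have "[z * 1 = z * (z ^ h)\<^sup>2] (mod p)" by (metis cong_scalar_left)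
  moreover have "z ^ nat p = z * (z ^ h)\<^sup>2" unfolding h by (simp add: power_mult)
  ultimately show ?thesis by (simp add: cong_sym)
qed

locale automorphism = form_space +
  fixes g and L :: nat
  assumes g: "isom V b V b g" and L: "L > 0" and period: "x \<in> V \<Longrightarrow> (g ^^ L) x = x"
begin

text \<open>The inverse of \<open>g\<close>, written as a power so that it is visibly an isometry
  and a polynomial in \<open>g\<close>.\<close>

definition gi where "gi = g ^^ (L - 1)"

lemma gi: "isom V b V b gi" unfolding gi_def by (rule isom_funpow[OF g])

lemma gV: "x \<in> V \<Longrightarrow> g x \<in> V" and giV: "x \<in> V \<Longrightarrow> gi x \<in> V"
  using isomD(2)[OF g] isomD(2)[OF gi] by blast+

lemma g_gi: "x \<in> V \<Longrightarrow> g (gi x) = x"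
proof -
  assume x: "x \<in> V"
  have "g (gi x) = (g ^^ Suc (L - 1)) x" by (simp add: gi_def)
  then show ?thesis using period[OF x] L by simp
qed

lemma gi_g: "x \<in> V \<Longrightarrow> gi (g x) = x"
proof -
  assume x: "x \<in> V"
  have "gi (g x) = (g ^^ Suc (L - 1)) x" by (simp only: gi_def funpow_Suc_right comp_apply)
  then show ?thesis using period[OF x] L by simp
qed

end

section \<open>Integer polynomials in an isometry\<close>

context bform
begin

lemma act_0 [simp]: "act T 0 x = 0" by (simp add: act_def)

context
  fixes T assumes T: "isom V b V b T"
begin

lemma act_pCons: "act T (pCons a f) x = a *z x + T (act T f x)"
proof (cases "a = 0 \<and> f = 0")
  case True
  then show ?thesis using isom_zero[OF T] by (simp add: act_def)
next
  case False
  then have "a \<noteq> 0 \<or> f \<noteq> 0" by blast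
  then show ?thesis by (cases "f = 0") (auto simp: act_def)
qed

lemma TV: "x \<in> V \<Longrightarrow> T x \<in> V" using isomD(2)[OF T] .
lemma T_add: "x \<in> V \<Longrightarrow> y \<in> V \<Longrightarrow> T (x + y) = T x + T y" using isomD(3)[OF T] .
lemma T_scale: "x \<in> V \<Longrightarrow> T (a *z x) = a *z T x" using isom_scale[OF T] .

lemma act_V: "x \<in> V \<Longrightarrow> act T f x \<in> V"
  by (induct f) (auto simp: act_pCons closed TV)

lemma act_add: "x \<in> V \<Longrightarrow> act T (f + h) x = act T f x + act T h x"
proof (induct f h rule: poly_induct2)
  case (pCons a f c h)
  then show ?case by (simp add: act_pCons T_add act_V zscale_simps)
qed simp

lemma act_const: "act T [:a:] x = a *z x"
  using isom_zero[OF T] by (simp add: act_pCons)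

lemma act_1 [simp]: "act T 1 x = x"
  by (simp only: one_pCons act_const zscale_one)

lemma act_smult: "x \<in> V \<Longrightarrow> act T (smult a f) x = a *z act T f x"
  by (induct f) (simp_all add: act_pCons T_scale act_V zscale_simps)

lemma act_uminus: "x \<in> V \<Longrightarrow> act T (- f) x = - act T f x"
  using act_smult[of x "- 1" f] by simp

lemma act_diff: "x \<in> V \<Longrightarrow> act T (f - h) x = act T f x - act T h x"
  using act_add[of x f "- h"] act_uminus by simp

lemma act_vector_add: "x \<in> V \<Longrightarrow> y \<in> V \<Longrightarrow> act T f (x + y) = act T f x + act T f y"
  by (induct f) (simp_all add: act_pCons T_add act_V zscale_simps ac_simps)

lemma act_vector_scale: "x \<in> V \<Longrightarrow> act T f (a *z x) = a *z act T f x"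
  by (rule additive_zscale[where V = V]) (simp_all add: act_vector_add scale_V)

lemma act_commute: "x \<in> V \<Longrightarrow> act T f (T x) = T (act T f x)"
  by (induct f) (simp_all add: act_pCons T_add T_scale act_V TV scale_V isom_zero[OF T])

lemma act_mult: "x \<in> V \<Longrightarrow> act T (f * h) x = act T f (act T h x)"
proof (induct f)
  case (pCons a f)
  have "act T (pCons a f * h) x = act T (smult a h) x + act T (pCons 0 (f * h)) x"
    using pCons by (simp add: act_add)
  then show ?case using pCons by (simp add: act_pCons act_smult)
qed simp

lemma act_X: "act T [:0, 1:] x = T x"
  using isom_zero[OF T] by (simp add: act_pCons)

lemma act_X_power: "x \<in> V \<Longrightarrow> act T ([:0, 1:] ^ j) x = (T ^^ j) x"
proof (induct j arbitrary: x)
  case (Suc j)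
  have "act T ([:0, 1:] ^ Suc j) x = act T [:0, 1:] (act T ([:0, 1:] ^ j) x)"
    using Suc.prems unfolding power_Suc by (rule act_mult)
  then show ?case using Suc by (simp add: act_X)
qed simp

end

lemma act_cong:
  assumes "isom V b V b T" "isom V b V b T'" "\<And>x. x \<in> V \<Longrightarrow> T x = T' x" "x \<in> V"
  shows "act T f x = act T' f x"
  using assms by (induct f) (simp_all add: act_pCons act_V)

end

section \<open>Self-adjoint polynomials and the Frobenius power\<close>

context automorphism
begin

text \<open>The adjoint of an isometry is its inverse; this passes to polynomials coefficient by
  coefficient.\<close>

lemma act_adjoint: "x \<in> V \<Longrightarrow> y \<in> V \<Longrightarrow> b (act g f x) y = b x (act gi f y)"
proof (induct f arbitrary: y)
  case (pCons a f)
  have F: "act g f x \<in> V" "act gi f (gi y) \<in> V" using act_V[OF g] act_V[OF gi] giV pCons by auto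
  have "b (g (act g f x)) y = b (g (act g f x)) (g (gi y))" using g_gi pCons by simp
  also have "\<dots> = b (act g f x) (gi y)" using isomD(4)[OF g] F giV pCons by simp
  also have "\<dots> = b x (act gi f (gi y))" using pCons giV by simp
  also have "act gi f (gi y) = gi (act gi f y)" using act_commute[OF gi] pCons by simp
  finally show ?case
    using pCons F act_commute[OF gi] by (simp add: act_pCons[OF g] act_pCons[OF gi] b_simps closed gV)
qed simp

text \<open>The polynomials in \<open>g\<close> that act as self-adjoint operators, and the ideals of those mapping \<open>V\<close> into \<open>p ^ j V\<close>.\<close>

definition selfadj :: "int poly set" where
  "selfadj = {f. \<forall>x\<in>V. act gi f x = act g f x}"

definition pideal :: "nat \<Rightarrow> int poly set" where
  "pideal j = {f. \<forall>x\<in>V. \<exists>y\<in>V. act g f x = (p ^ j) *z y}"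

lemma selfadjD: "f \<in> selfadj \<Longrightarrow> x \<in> V \<Longrightarrow> act gi f x = act g f x"
  by (simp add: selfadj_def)

lemma selfadj_const: "[:a:] \<in> selfadj"
  by (simp add: selfadj_def act_const[OF g] act_const[OF gi])

lemma selfadj_add: "f \<in> selfadj \<Longrightarrow> h \<in> selfadj \<Longrightarrow> f + h \<in> selfadj"
  by (simp add: selfadj_def act_add[OF g] act_add[OF gi])

lemma selfadj_diff: "f \<in> selfadj \<Longrightarrow> h \<in> selfadj \<Longrightarrow> f - h \<in> selfadj"
  by (simp add: selfadj_def act_diff[OF g] act_diff[OF gi])

lemma selfadj_mult: "f \<in> selfadj \<Longrightarrow> h \<in> selfadj \<Longrightarrow> f * h \<in> selfadj"
  by (simp add: selfadj_def act_mult[OF g] act_mult[OF gi] act_V[OF g])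

lemma selfadj_power: "f \<in> selfadj \<Longrightarrow> f ^ n \<in> selfadj"
proof (induct n)
  case 0
  then show ?case using selfadj_const[of 1] by (simp only: one_pCons power_0)
qed (simp add: selfadj_mult)

lemma pideal_add: "f \<in> pideal j \<Longrightarrow> h \<in> pideal j \<Longrightarrow> f + h \<in> pideal j"
  unfolding pideal_def
proof (intro CollectI ballI)
  fix x assume "f \<in> {f. \<forall>x\<in>V. \<exists>y\<in>V. act g f x = (p ^ j) *z y}"
    "h \<in> {f. \<forall>x\<in>V. \<exists>y\<in>V. act g f x = (p ^ j) *z y}" and x: "x \<in> V"
  then obtain y z where "y \<in> V" "act g f x = (p ^ j) *z y" "z \<in> V" "act g h x = (p ^ j) *z z" by blast
  then show "\<exists>y\<in>V. act g (f + h) x = (p ^ j) *z y"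
    using x by (intro bexI[of _ "y + z"]) (simp_all add: act_add[OF g] add_V zscale_simps)
qed

lemma pideal_mult_left: "f \<in> pideal j \<Longrightarrow> h * f \<in> pideal j"
  unfolding pideal_def
proof (intro CollectI ballI)
  fix x assume "f \<in> {f. \<forall>x\<in>V. \<exists>y\<in>V. act g f x = (p ^ j) *z y}" and x: "x \<in> V"
  then obtain y where "y \<in> V" "act g f x = (p ^ j) *z y" by blast
  then show "\<exists>y\<in>V. act g (h * f) x = (p ^ j) *z y"
    using x by (intro bexI[of _ "act g h y"]) (simp_all add: act_mult[OF g] act_V[OF g] act_vector_scale[OF g])
qed

lemma pideal_mult_right: "f \<in> pideal j \<Longrightarrow> f * h \<in> pideal j"
  using pideal_mult_left[of f j h] by (simp add: mult.commute)

lemma pideal_uminus: "f \<in> pideal j \<Longrightarrow> - f \<in> pideal j"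
  using pideal_mult_left[of f j "- 1"] by simp

lemma pideal_diff: "f \<in> pideal j \<Longrightarrow> h \<in> pideal j \<Longrightarrow> f - h \<in> pideal j"
  using pideal_add[of f j "- h"] pideal_uminus by simp

lemma pideal_mult: "f \<in> pideal i \<Longrightarrow> h \<in> pideal j \<Longrightarrow> f * h \<in> pideal (i + j)"
  unfolding pideal_def[of "i + j"]
proof (intro CollectI ballI)
  fix x assume f: "f \<in> pideal i" and h: "h \<in> pideal j" and x: "x \<in> V"
  obtain y where y: "y \<in> V" "act g h x = (p ^ j) *z y" using h x by (auto simp: pideal_def)
  obtain z where z: "z \<in> V" "act g f y = (p ^ i) *z z" using f y by (auto simp: pideal_def)
  have "act g (f * h) x = (p ^ (i + j)) *z z"
    using x y z by (simp add: act_mult[OF g] act_vector_scale[OF g] power_add mult.commute)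
  then show "\<exists>y\<in>V. act g (f * h) x = (p ^ (i + j)) *z y" using z(1) by blast
qed

lemma pideal_k: "f \<in> pideal k \<Longrightarrow> x \<in> V \<Longrightarrow> act g f x = 0"
  using torsion by (auto simp: pideal_def)

lemma pideal_0: "(\<And>x. x \<in> V \<Longrightarrow> act g f x = 0) \<Longrightarrow> f \<in> pideal j"
  unfolding pideal_def by (auto intro!: bexI[of _ 0])

lemma pideal_p: "of_nat (nat p) dvd f \<Longrightarrow> f \<in> pideal 1"
proof (elim dvdE)
  fix h assume h: "f = of_nat (nat p) * h"
  have "of_nat (nat p) = [:p:]" using p_pos by (simp add: of_nat_poly less_imp_le)
  then have "act g f x = (p ^ 1) *z act g h x" if "x \<in> V" for x
    using that h by (simp add: act_smult[OF g])
  then show ?thesis using act_V[OF g] unfolding pideal_def by blast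
qed

lemma pideal_power_diff: "f - h \<in> pideal (Suc 0) \<Longrightarrow> f ^ n - h ^ n \<in> pideal (Suc 0)"
proof -
  assume "f - h \<in> pideal (Suc 0)"
  moreover obtain s where "f ^ n - h ^ n = (f - h) * s" using power_diff_expand by blast
  ultimately show ?thesis by (simp only: pideal_mult_right)
qed

lemma pideal_mono: "f \<in> pideal (Suc j) \<Longrightarrow> f \<in> pideal (Suc 0)"
  unfolding pideal_def
proof (intro CollectI ballI)
  fix x assume "f \<in> {f. \<forall>x\<in>V. \<exists>y\<in>V. act g f x = (p ^ Suc j) *z y}" "x \<in> V"
  then obtain y where "y \<in> V" "act g f x = (p ^ Suc j) *z y" by blast
  then show "\<exists>y\<in>V. act g f x = (p ^ Suc 0) *z y"
    by (intro bexI[of _ "(p ^ j) *z y"]) (simp_all add: scale_V)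
qed

text \<open>The operator version of \<open>power_p_cong\<close>: each \<open>p\<close>-th power
  gains one factor \<open>p\<close>. At \<open>j = k - 1\<close> the difference acts as zero, which
  is how idempotents modulo \<open>p\<close> become genuine ones.\<close>

lemma pideal_lift:
  assumes "f - h \<in> pideal 1"
  shows "f ^ (nat p ^ j) - h ^ (nat p ^ j) \<in> pideal (Suc j)"
proof (induct j)
  case (Suc j)
  let ?f = "f ^ (nat p ^ j)" and ?h = "h ^ (nat p ^ j)"
  obtain s where s: "?f ^ nat p - ?h ^ nat p = (?f - ?h) * ((?f - ?h) * s + of_nat (nat p) * ?h ^ (nat p - 1))"
    using power_diff_expand by blast
  have "of_nat (nat p) * ?h ^ (nat p - 1) \<in> pideal (Suc 0)"
    using pideal_p[OF dvd_triv_left] by (simp only: One_nat_def)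
  then have "(?f - ?h) * s + of_nat (nat p) * ?h ^ (nat p - 1) \<in> pideal (Suc 0)"
    by (rule pideal_add[OF pideal_mult_right[OF pideal_mono[OF Suc]]])
  then have "(?f - ?h) * ((?f - ?h) * s + of_nat (nat p) * ?h ^ (nat p - 1)) \<in> pideal (Suc j + Suc 0)"
    by (rule pideal_mult[OF Suc])
  then show ?case unfolding s[symmetric] by (simp add: power_mult[symmetric] mult.commute)
qed (use assms in simp)

text \<open>Frobenius: modulo \<open>p\<close>, raising to the power \<open>p ^ M\<close> replaces \<open>g\<close> by \<open>g ^^ p ^ M\<close>.\<close>

lemma frobenius:
  assumes x: "x \<in> V"
  shows "\<exists>y\<in>V. act g (f ^ (nat p ^ M)) x - act (g ^^ (nat p ^ M)) f x = p *z y"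
  using x
proof (induct f arbitrary: x)
  case 0
  then show ?case using p_gt_2 by (intro bexI[of _ 0]) (simp_all add: power_0_left)
next
  case (pCons a f)
  let ?Q = "nat p ^ M" and ?G = "g ^^ (nat p ^ M)"
  have G: "isom V b V b ?G" by (rule isom_funpow[OF g])
  have split: "pCons a f = [:a:] + [:0, 1:] * f" by simp
  have "prime (nat p)" using prime_p by simp
  then have "of_nat (nat p) dvd ([:a:] + [:0, 1:] * f) ^ ?Q - ([:a:] ^ ?Q + ([:0, 1:] * f) ^ ?Q)"
    by (rule add_power_prime_dvd)
  then have "of_nat (nat p) dvd (pCons a f) ^ ?Q - ([:a:] ^ ?Q + ([:0, 1:] * f) ^ ?Q)"
    by (simp only: split[symmetric])
  then have "(pCons a f) ^ ?Q - ([:a:] ^ ?Q + ([:0, 1:] * f) ^ ?Q) \<in> pideal 1" by (rule pideal_p)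
  then obtain y1 where y1: "y1 \<in> V" "act g ((pCons a f) ^ ?Q - ([:a:] ^ ?Q + ([:0, 1:] * f) ^ ?Q)) x = p *z y1"
    using pCons by (auto simp: pideal_def)
  \<comment> \<open>Fermat's theorem, iterated: modulo \<open>p\<close> the coefficients are
    unchanged and only the operator is replaced.\<close>
  have "[a ^ ?Q = a] (mod p)"
  proof (induct M)
    case (Suc M)
    have "[(a ^ (nat p ^ M)) ^ nat p = a ^ (nat p ^ M)] (mod p)" by (rule fermat)
    then have "[(a ^ (nat p ^ M)) ^ nat p = a] (mod p)" using Suc by (rule cong_trans)
    then show ?case by (simp add: power_mult[symmetric] mult.commute)
  qed simp
  then obtain m where m: "a ^ ?Q = a + p * m" by (metis cong_iff_lin cong_sym)
  obtain y where y: "y \<in> V" "act g (f ^ ?Q) x - act ?G f x = p *z y" using pCons by blast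
  have V: "act g (f ^ ?Q) x \<in> V" "act ?G f x \<in> V" "?G y \<in> V"
    using act_V[OF g] act_V[OF G] isomD(2)[OF G] pCons y by auto
  have "act g ([:a:] ^ ?Q) x = (a ^ ?Q) *z x" by (simp add: poly_const_pow act_const[OF g])
  moreover have "act g (([:0, 1:] * f) ^ ?Q) x = ?G (act g (f ^ ?Q) x)"
    unfolding power_mult_distrib using pCons V act_mult[OF g] act_X_power[OF g] by simp
  ultimately have "act g ((pCons a f) ^ ?Q) x = p *z y1 + ((a ^ ?Q) *z x + ?G (act g (f ^ ?Q) x))"
    using y1 pCons by (simp add: act_diff[OF g] act_add[OF g] algebra_simps)
  also have "act g (f ^ ?Q) x = act ?G f x + p *z y" using y by (simp add: algebra_simps)
  also have "?G (act ?G f x + p *z y) = ?G (act ?G f x) + p *z ?G y"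
    using V y isomD(3)[OF G] isom_scale[OF G] by (simp add: closed)
  finally have "act g ((pCons a f) ^ ?Q) x - act ?G (pCons a f) x = p *z (y1 + m *z x + ?G y)"
    unfolding m by (simp add: act_pCons[OF G] zscale_simps)
  then show ?case using y1 V pCons by (intro bexI[of _ "y1 + m *z x + ?G y"]) (auto simp: closed)
qed

end


section \<open>Indecomposable automorphisms and the bound on their rank\<close>

context automorphism
begin

definition indecomposable where
  "indecomposable \<longleftrightarrow> (\<forall>W. W \<subseteq> V \<longrightarrow> form_space p k W b \<longrightarrow> isom W b W b g \<longrightarrow> W = {0} \<or> W = V)"

lemma invariant_isom:
  assumes "W \<subseteq> V" "\<And>x. x \<in> W \<Longrightarrow> g x \<in> W"
  shows "isom W b W b g"
proof -
  have "g ` W \<subseteq> W" using assms(2) by blast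
  moreover have "inj_on g W" using isomD(1)[OF g] assms(1) inj_on_subset unfolding bij_betw_def by blast
  ultimately have "bij_betw g W W"
    unfolding bij_betw_def using endo_inj_surj[of W g] finite_subset[OF assms(1) finite_V] by blast
  then show ?thesis unfolding isom_def using isomD(3,4)[OF g] assms(1) by (meson subsetD)
qed

text \<open>A self-adjoint idempotent has orthogonal image and kernel. The image is thus a form
  space, and it is \<open>g\<close>-invariant because polynomials in \<open>g\<close> commute with
  \<open>g\<close>.\<close>

lemma idempotent_trivial:
  assumes ind: indecomposable and e: "e \<in> selfadj"
    and idem: "\<And>x. x \<in> V \<Longrightarrow> act g e (act g e x) = act g e x"
  shows "(\<forall>x\<in>V. act g e x = 0) \<or> (\<forall>x\<in>V. act g e x = x)"
proof -
  define W where "W = {x \<in> V. act g e x = x}"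
  define Z where "Z = {x \<in> V. act g e x = 0}"
  have WV: "W \<subseteq> V" "Z \<subseteq> V" by (auto simp: W_def Z_def)
  have fs: "form_space p k W b"
  proof (rule orth_summand[OF WV(1) _ _ WV(2)])
    show "0 \<in> W" using act_vector_scale[OF g, of 0 e 0] by (simp add: W_def)
    show "x + y \<in> W" if "x \<in> W" "y \<in> W" for x y
      using that by (simp add: W_def act_vector_add[OF g] add_V)
    show "\<exists>w\<in>W. \<exists>u\<in>Z. x = w + u" if x: "x \<in> V" for x
    proof (intro bexI)
      show "x = act g e x + (x - act g e x)" by simp
      show "act g e x \<in> W" using x idem act_V[OF g] by (simp add: W_def)
      have "act g e ((x - act g e x) + act g e x) = act g e (x - act g e x) + act g e (act g e x)"
        using x act_V[OF g] by (intro act_vector_add[OF g] closed) auto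
      then have "act g e (x - act g e x) = 0" using idem x by simp
      then show "x - act g e x \<in> Z" using x act_V[OF g] by (simp add: Z_def closed)
    qed
    show "b w u = 0" if "w \<in> W" "u \<in> Z" for w u
    proof -
      have "b (act g e w) u = b w (act gi e u)" using that by (intro act_adjoint) (auto simp: W_def Z_def)
      also have "act gi e u = 0" using that selfadjD[OF e] by (auto simp: Z_def)
      finally show ?thesis using that by (auto simp: W_def)
    qed
  qed
  have "isom W b W b g"
    using WV(1) by (rule invariant_isom) (auto simp: W_def act_commute[OF g] gV)
  then consider "W = {0}" | "W = V" using ind fs WV(1) unfolding indecomposable_def by blast
  then show ?thesis
  proof cases
    case 1
    have "act g e x = 0" if "x \<in> V" for x
    proof -
      have "act g e x \<in> W" using that idem act_V[OF g] by (simp add: W_def)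
      then show ?thesis using 1 by blast
    qed
    then show ?thesis by blast
  next
    case 2
    then show ?thesis by (auto simp: W_def)
  qed
qed

text \<open>If \<open>Q\<close> is 1 or -1 modulo \<open>L\<close>, then \<open>g ^^ Q\<close> is
  \<open>g\<close> or its inverse, and a self-adjoint polynomial takes the same value at both;
  Frobenius then gives \<open>c ^ Q = c\<close> modulo \<open>p\<close>. Admitting both signs is
  what makes \<open>min_exp\<close> the relevant exponent.\<close>

lemma frobenius_selfadj:
  assumes Q: "Q = nat p ^ M" "[Q = 1] (mod L) \<or> [Q = L - 1] (mod L)" and c: "c \<in> selfadj"
  shows "c ^ Q - c \<in> pideal 1"
  unfolding pideal_def
proof (intro CollectI ballI)
  fix x assume x: "x \<in> V"
  have G: "isom V b V b (g ^^ Q)" by (rule isom_funpow[OF g])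
  have red: "(g ^^ i) z = (g ^^ j) z" if "[i = j] (mod L)" "z \<in> V" for i j z
    using that funpow_mod_eq[OF period] unfolding cong_def by metis
  have "act (g ^^ Q) c x = act g c x"
    using Q(2)
  proof
    assume "[Q = 1] (mod L)"
    then have "(g ^^ Q) z = g z" if "z \<in> V" for z using red[of Q 1 z] that by simp
    then show ?thesis using x by (intro act_cong[OF G g])
  next
    assume "[Q = L - 1] (mod L)"
    then have "(g ^^ Q) z = gi z" if "z \<in> V" for z using red[of Q "L - 1" z] that by (simp add: gi_def)
    then have "act (g ^^ Q) c x = act gi c x" using x by (intro act_cong[OF G gi])
    then show ?thesis using selfadjD[OF c x] by simp
  qed
  moreover obtain y where "y \<in> V" "act g (c ^ Q) x - act (g ^^ Q) c x = p *z y"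
    using frobenius[OF x] Q(1) by blast
  ultimately show "\<exists>y\<in>V. act g (c ^ Q - c) x = (p ^ 1) *z y"
    using x by (auto simp: act_diff[OF g])
qed

text \<open>This makes the self-adjoint polynomials modulo \<open>p\<close> a field. Modulo
  \<open>p\<close> the power \<open>f = c ^ (Q - 1)\<close> is idempotent; \<open>e = f ^ n\<close>
  with \<open>n = p ^ (k - 1)\<close> is an idempotent operator, so indecomposability leaves 0 or
  1.\<close>

lemma pideal_dichotomy:
  assumes Q: "Q = nat p ^ M" "M > 0" "[Q = 1] (mod L) \<or> [Q = L - 1] (mod L)"
    and ind: indecomposable and c: "c \<in> selfadj"
  shows "c \<in> pideal 1 \<or> c ^ (Q - 1) - 1 \<in> pideal 1"
proof -
  have "nat p \<le> nat p ^ M" using p_gt_2 Q(2) self_le_power[of "nat p" M] by simp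
  then have Q2: "Q \<ge> 2" using p_gt_2 Q(1) by linarith
  note frob = frobenius_selfadj[OF Q(1,3)]
  define f where "f = c ^ (Q - 1)"
  define n where "n = nat p ^ (k - 1)"
  have "n > 0" using p_gt_2 by (simp add: n_def)
  define e where "e = f ^ n"
  have "f * f - f = (c ^ Q - c) * c ^ (Q - 2)"
  proof -
    have Qe: "Q = Suc (Suc (Q - 2))" using Q2 by simp
    have pow: "c ^ (Q - 1) = c * c ^ (Q - 2)" "c ^ Q = c * (c * c ^ (Q - 2))" by (subst Qe, simp)+
    show ?thesis unfolding f_def pow by (simp add: algebra_simps)
  qed
  then have ff: "f * f - f \<in> pideal 1" using frob[OF c] by (simp only: pideal_mult_right)
  then have "(f * f) ^ n - f ^ n \<in> pideal (Suc (k - 1))" unfolding n_def by (rule pideal_lift)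
  then have "e * e - e \<in> pideal k" using k_pos by (simp add: e_def power_mult_distrib)
  then have "act g e (act g e x) = act g e x" if "x \<in> V" for x
    using that pideal_k[of "e * e - e" x] by (simp add: act_diff[OF g] act_mult[OF g])
  moreover have "e \<in> selfadj" unfolding e_def f_def by (intro selfadj_power c)
  ultimately consider "\<forall>x\<in>V. act g e x = 0" | "\<forall>x\<in>V. act g e x = x" using idempotent_trivial[OF ind] by blast
  then show ?thesis
  proof cases
    case 1
    then have e0: "e \<in> pideal 1" by (intro pideal_0) blast
    have pow: "c ^ (Q ^ j) - c \<in> pideal 1" for j
    proof (induct j)
      case (Suc j)
      have "(c ^ (Q ^ j)) ^ Q - c ^ Q \<in> pideal (Suc 0)" using Suc by (intro pideal_power_diff) simp
      then have "((c ^ (Q ^ j)) ^ Q - c ^ Q) + (c ^ Q - c) \<in> pideal 1"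
        using frob[OF c] by (intro pideal_add) simp_all
      then show ?case by (simp add: power_mult[symmetric] mult.commute)
    qed (use pideal_0[of 0] in simp)
    \<comment> \<open>Then \<open>e = c ^ j\<close>, and \<open>Q ^ j\<close> is larger than
      \<open>j\<close>. So \<open>c ^ (Q ^ j)\<close>, which is congruent to \<open>c\<close>, is a
      multiple of \<open>e\<close> and vanishes modulo \<open>p\<close>.\<close>
    define j where "j = (Q - 1) * n"
    have "j < 2 ^ j" by (rule less_exp)
    also have "2 ^ j \<le> Q ^ j" using Q2 by (rule power_mono) simp
    finally have "Q ^ j = j + (Q ^ j - j)" by simp
    then have "c ^ (Q ^ j) = e * c ^ (Q ^ j - j)" by (metis e_def f_def j_def power_add power_mult)
    then have "c ^ (Q ^ j) \<in> pideal 1" using e0 by (simp only: pideal_mult_right)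
    from pideal_diff[OF this pow[of j]] have "c \<in> pideal 1" by simp
    then show ?thesis by blast
  next
    case 2
    then have e1: "e - 1 \<in> pideal 1" by (intro pideal_0) (simp add: act_diff[OF g] act_1[OF g])
    \<comment> \<open>Powers of \<open>f\<close> stay congruent to \<open>f\<close>, so
      \<open>e\<close> being the identity makes \<open>f\<close> congruent to 1.\<close>
    have fn: "f ^ Suc i - f \<in> pideal 1" for i
    proof (induct i)
      case (Suc i)
      have eq: "f ^ Suc (Suc i) - f = f * (f ^ Suc i - f) + (f * f - f)" by (simp add: algebra_simps)
      show ?case unfolding eq by (rule pideal_add[OF pideal_mult_left[OF Suc] ff])
    qed (use pideal_0[of 0] in simp)
    obtain i where "n = Suc i" using \<open>n > 0\<close> by (cases n) auto
    then have "e - f \<in> pideal 1" using fn by (simp only: e_def)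
    from pideal_diff[OF e1 this] have "f - 1 \<in> pideal 1" by simp
    then show ?thesis by (simp add: f_def)
  qed
qed

text \<open>Linear factors are divided off as over an integral domain, with congruence modulo
  \<open>pideal 1\<close> in place of a quotient ring; \<open>dom\<close> is the absence of zero
  divisors.\<close>

lemma roots_bound:
  fixes G :: "int poly poly"
  assumes dom: "\<And>a c. a \<in> selfadj \<Longrightarrow> a \<notin> pideal 1 \<Longrightarrow> a * c \<in> pideal 1 \<Longrightarrow> c \<in> pideal 1"
    and one: "1 \<notin> pideal 1"
    and "finite T" "T \<subseteq> selfadj" "\<And>a c. a \<in> T \<Longrightarrow> c \<in> T \<Longrightarrow> a \<noteq> c \<Longrightarrow> a - c \<notin> pideal 1"
    and "lead_coeff G = 1" "\<And>c. c \<in> T \<Longrightarrow> poly G c \<in> pideal 1"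
  shows "card T \<le> degree G"
  using assms(3-)
proof (induction "degree G" arbitrary: G T)
  case 0
  then have "G = [:1:]" by (metis degree_0_id lead_coeff_pCons(1) coeff_pCons_0)
  then have "T = {}" using 0(6) one by auto
  then show ?case by simp
next
  case (Suc n)
  show ?case
  proof (cases "T = {}")
    case False
    then obtain c where c: "c \<in> T" by blast
    define H where "H = synthetic_div G c"
    have G: "[:- c, 1:] * H + [:poly G c:] = G" unfolding H_def by (rule synthetic_div_correct')
    have deg: "degree H = n" using Suc(2) by (simp add: H_def degree_synthetic_div)
    have H0: "H \<noteq> 0"
    proof
      assume "H = 0"
      then have "degree G = 0" unfolding H_def synthetic_div_eq_0_iff .
      then show False using Suc(2) by simp
    qed
    have degm: "degree ([:- c, 1:] * H) = Suc n" using H0 deg by (subst degree_mult_eq) auto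
    have "coeff [:poly G c:] (Suc n) = 0" by simp
    then have "coeff G (Suc n) = coeff ([:- c, 1:] * H) (Suc n)" using G by (metis add.right_neutral coeff_add)
    also have "\<dots> = lead_coeff ([:- c, 1:] * H)" by (simp only: degm)
    also have "\<dots> = lead_coeff H" by (simp only: lead_coeff_mult) simp
    finally have lead: "lead_coeff H = 1" using Suc(2,6) by simp
    have "card (T - {c}) \<le> degree H"
    proof (rule Suc(1)[OF deg[symmetric]])
      fix d assume d: "d \<in> T - {c}"
      have "poly G d - poly G c = (d - c) * poly H d"
        by (subst G[symmetric]) (simp add: algebra_simps)
      then have "(d - c) * poly H d \<in> pideal 1" using pideal_diff[OF Suc(7) Suc(7)] d c by (metis DiffD1)
      moreover have "d - c \<notin> pideal 1" using Suc(5)[of d c] d c by blast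
      moreover have "d \<in> selfadj" "c \<in> selfadj" using Suc(4) d c by blast+
      then have "d - c \<in> selfadj" by (rule selfadj_diff)
      ultimately show "poly H d \<in> pideal 1" using dom by blast
    qed (use Suc lead in auto)
    then show ?thesis using c Suc(2,3) deg by (simp add: card_Diff_singleton)
  qed simp
qed

text \<open>The self-adjoint elements are roots of \<open>X ^ Q - X\<close> modulo \<open>p\<close>,
  so at most \<open>Q\<close> of them are incongruent. As \<open>\<tau> = g + g^(-1)\<close> is
  self-adjoint and \<open>g^2 = \<tau> g - 1\<close>, every polynomial in \<open>g\<close> acts as
  \<open>a + g c\<close> with \<open>a\<close>, \<open>c\<close> self-adjoint. Applied to the
  generator \<open>v\<close>, this leaves at most \<open>Q * Q = p ^ (2 * M)\<close> elements in
  V/pV.\<close>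

theorem rank_bound:
  assumes Q: "Q = nat p ^ M" "M > 0" "[Q = 1] (mod L) \<or> [Q = L - 1] (mod L)"
    and ind: indecomposable and nontriv: "V \<noteq> {0}" and v: "v \<in> V"
    and cyc: "\<And>x. x \<in> V \<Longrightarrow> \<exists>f. x = act g f v" and d: "diag p k b V us"
  shows "length us \<le> 2 * M"
proof -
  note dich = pideal_dichotomy[OF Q ind]
  have one: "1 \<notin> pideal 1"
  proof
    assume "1 \<in> pideal 1"
    then have "\<exists>y\<in>V. x = p *z y" if "x \<in> V" for x
      using that by (auto simp: pideal_def act_1[OF g])
    then show False using exists_indivisible[OF nontriv] by blast
  qed
  have "nat p \<le> nat p ^ M" using p_gt_2 Q(2) self_le_power[of "nat p" M] by simp
  then have Q2: "Q \<ge> 2" using p_gt_2 Q(1) by linarith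
  \<comment> \<open>\<open>a ^ (Q - 1)\<close> is 1 modulo \<open>p\<close>, so \<open>a\<close> can
    be cancelled.\<close>
  have dom: "c \<in> pideal 1" if a: "a \<in> selfadj" "a \<notin> pideal 1" "a * c \<in> pideal 1" for a c
  proof -
    have 1: "(a ^ (Q - 1) - 1) * c \<in> pideal 1" using dich[OF a(1)] a(2) pideal_mult_right by blast
    have "a ^ (Q - 1) = a ^ (Q - 2) * a" using Q2 by (metis Suc_1 Suc_diff_Suc Suc_le_lessD power_Suc2)
    then have 2: "a ^ (Q - 1) * c \<in> pideal 1"
      using pideal_mult_left[OF a(3), of "a ^ (Q - 2)"] by (simp only: mult.assoc)
    from pideal_diff[OF 2 1] show ?thesis by (simp add: algebra_simps)
  qed
  \<comment> \<open>Multiplication by \<open>p ^ (k - 1)\<close> identifies V/pV with a subgroup of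
    \<open>V\<close>, so the count takes place inside \<open>V\<close>; \<open>m c\<close> depends
    on \<open>c\<close> only modulo \<open>pideal 1\<close>.\<close>
  define m where "m c = (p ^ (k - 1)) *z act g c v" for c
  have mV: "m c \<in> V" for c unfolding m_def using v act_V[OF g] scale_V by blast
  define A where "A = m ` selfadj"
  have finA: "finite A" by (rule finite_subset[OF _ finite_V]) (auto simp: A_def mV)
  \<comment> \<open>One polynomial for each value of \<open>m\<close>: distinct chosen polynomials
    have distinct values, hence are incongruent modulo \<open>p\<close> as
    \<open>roots_bound\<close> demands.\<close>
  define rep where "rep y = (SOME c. c \<in> selfadj \<and> m c = y)" for y
  have rep: "rep y \<in> selfadj \<and> m (rep y) = y" if "y \<in> A" for y
  proof -
    have "\<exists>c. c \<in> selfadj \<and> m c = y" using that by (auto simp: A_def)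
    then show ?thesis unfolding rep_def by (rule someI_ex)
  qed
  have inj: "inj_on rep A" by (rule inj_on_inverseI[of _ m]) (use rep in blast)
  define G :: "int poly poly" where "G = monom 1 Q - monom 1 1"
  have coeffG: "coeff G Q = 1" using Q2 by (simp add: G_def)
  have degG: "degree G = Q"
  proof (rule antisym)
    show "degree G \<le> Q" unfolding G_def using Q2 by (intro degree_diff_le) (auto simp: degree_monom_eq)
    show "Q \<le> degree G" using coeffG by (intro le_degree) simp
  qed
  have "card (rep ` A) \<le> degree G"
  proof (rule roots_bound[OF dom one])
    show "rep ` A \<subseteq> selfadj" using rep by blast
    show "lead_coeff G = 1" using coeffG degG by simp
    fix a c assume "a \<in> rep ` A" "c \<in> rep ` A" "a \<noteq> c"
    then have ac: "m a \<noteq> m c" using rep by auto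
    show "a - c \<notin> pideal 1"
    proof
      assume "a - c \<in> pideal 1"
      then obtain y where y: "y \<in> V" "act g (a - c) v = p *z y" using v by (auto simp: pideal_def)
      have "m a - m c = (p ^ (k - 1)) *z act g (a - c) v"
        unfolding m_def using v by (simp add: act_diff[OF g] zscale_simps)
      also have "\<dots> = (p ^ k) *z y" using y k_split by (simp add: mult.commute)
      finally show False using ac torsion y by simp
    qed
  next
    fix c assume "c \<in> rep ` A"
    then show "poly G c \<in> pideal 1"
      using frobenius_selfadj[OF Q(1,3)] rep by (auto simp: G_def poly_monom)
  qed (use finA in auto)
  then have cardA: "card A \<le> Q" using card_image[OF inj] degG by simp
  define \<tau> :: "int poly" where "\<tau> = [:0, 1:] ^ 1 + [:0, 1:] ^ (L - 1)"
  have tau_g: "act g \<tau> x = g x + gi x" if "x \<in> V" for x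
    using that by (simp only: \<tau>_def act_add[OF g] act_X_power[OF g] gi_def) simp
  have tau: "\<tau> \<in> selfadj"
    unfolding selfadj_def
  proof (intro CollectI ballI)
    fix x assume x: "x \<in> V"
    \<comment> \<open>The inverse of the inverse, in terms of powers; replacing \<open>g\<close> by
      \<open>gi\<close> therefore swaps the two terms of \<tau>.\<close>
    have "(gi ^^ (L - 1)) x = g x"
    proof -
      have "(gi ^^ i) ((g ^^ i) y) = y" if "y \<in> V" for i y
        using that
      proof (induct i arbitrary: y)
        case (Suc i)
        then have "(g ^^ i) y \<in> V" using isomD(2)[OF isom_funpow[OF g]] by blast
        then have "gi ((g ^^ Suc i) y) = (g ^^ i) y" using gi_g by simp
        moreover have "(gi ^^ Suc i) ((g ^^ Suc i) y) = (gi ^^ i) (gi ((g ^^ Suc i) y))"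
          by (simp only: funpow_Suc_right[where f = gi] comp_apply)
        ultimately show ?case using Suc by metis
      qed simp
      from this[of "g x" "L - 1"] have "(gi ^^ (L - 1)) ((g ^^ (L - 1)) (g x)) = g x" using gV x by blast
      moreover have "(g ^^ (L - 1)) (g x) = x" using gi_g[OF x] by (simp add: gi_def)
      ultimately show ?thesis by simp
    qed
    then show "act gi \<tau> x = act g \<tau> x"
      using x tau_g by (simp only: \<tau>_def act_add[OF gi] act_X_power[OF gi]) (simp add: add.commute)
  qed
  \<comment> \<open>Horner step: a second application of \<open>g\<close> is removed by rewriting
    \<open>g (g c)\<close> as \<open>g (\<tau> c) - c\<close>.\<close>
  have dec: "\<exists>a\<in>selfadj. \<exists>c\<in>selfadj. act g f v = act g a v + g (act g c v)" for f
  proof (induct f)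
    case 0
    have "(0::int poly) \<in> selfadj" using selfadj_const[of 0] by simp
    then show ?case using isom_zero[OF g] by (intro bexI[of _ 0]) auto
  next
    case (pCons n f)
    then obtain a c where ac: "a \<in> selfadj" "c \<in> selfadj" "act g f v = act g a v + g (act g c v)" by blast
    let ?a = "act g a v" and ?c = "act g c v"
    have V: "?a \<in> V" "?c \<in> V" "g ?c \<in> V" "g (g ?c) \<in> V" using v act_V[OF g] gV by auto
    have "act g (\<tau> * c) v = g ?c + gi ?c" using v V tau_g by (simp add: act_mult[OF g])
    then have "g (act g (\<tau> * c) v) = g (g ?c) + ?c" using V giV T_add[OF g] g_gi by simp
    then have gg: "g (g ?c) = g (act g (\<tau> * c) v) - ?c" by simp
    have "act g (pCons n f) v = n *z v + (g ?a + g (g ?c))"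
      using V ac(3) T_add[OF g] by (simp add: act_pCons[OF g])
    also have "\<dots> = act g ([:n:] - c) v + g (act g (a + \<tau> * c) v)"
      unfolding gg using v V act_V[OF g] T_add[OF g] by (simp add: act_diff[OF g] act_add[OF g] act_const[OF g] algebra_simps)
    finally show ?case using ac tau by (intro bexI[of _ "[:n:] - c"] bexI[of _ "a + \<tau> * c"])
        (auto intro: selfadj_const selfadj_diff selfadj_add selfadj_mult)
  qed
  have "(*z) (p ^ (k - 1)) ` V \<subseteq> (\<lambda>(y, z). y + g z) ` (A \<times> A)"
  proof
    fix y assume "y \<in> (*z) (p ^ (k - 1)) ` V"
    then obtain f where f: "y = (p ^ (k - 1)) *z act g f v" using cyc by blast
    obtain a c where ac: "a \<in> selfadj" "c \<in> selfadj" "act g f v = act g a v + g (act g c v)" using dec by blast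
    have "y = m a + g (m c)"
      using f ac v act_V[OF g] T_scale[OF g] by (simp add: m_def zscale_simps)
    then show "y \<in> (\<lambda>(y, z). y + g z) ` (A \<times> A)"
      using ac by (intro image_eqI[of _ _ "(m a, m c)"]) (auto simp: A_def)
  qed
  then have "card ((*z) (p ^ (k - 1)) ` V) \<le> card (A \<times> A)"
    using finA by (meson card_image_le card_mono finite_SigmaI finite_imageI le_trans)
  also have "\<dots> \<le> Q * Q" unfolding card_cartesian_product using cardA cardA by (rule mult_le_mono)
  finally have "int (card ((*z) (p ^ (k - 1)) ` V)) \<le> int (Q * Q)" by (simp only: of_nat_le_iff)
  moreover have "int (card ((*z) (p ^ (k - 1)) ` V)) = p ^ length us"
    using diag_card_image[OF d bform_axioms, of "k - 1"] k_pos by simp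
  moreover have "int (Q * Q) = p ^ (2 * M)" using Q(1) p_gt_2 by (simp add: mult_2 power_add)
  ultimately show ?thesis using p_gt_2 by (simp add: power_increasing_iff)
qed

end


section \<open>Powers of one prime modulo another\<close>

text \<open>With \<open>t = a - 1\<close> divisible by \<open>n\<close>, each \<open>a ^ j\<close>
  is \<open>1 + j * t\<close> modulo the square of \<open>n\<close>, and the sum of the
  \<open>j\<close> is a multiple of \<open>n\<close> because \<open>n\<close> is odd.\<close>

lemma power_diff_1_cong_sum:
  fixes a :: int
  assumes "odd n" "int n dvd a - 1"
  shows "[(\<Sum>j<n. a ^ j) = int n] (mod (int n)\<^sup>2)"
proof -
  define t where "t = a - 1"
  have nt: "int n dvd t" using assms(2) by (simp add: t_def)
  have t2: "(int n)\<^sup>2 dvd t\<^sup>2" using nt by (rule dvd_power_same)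
  have pow: "[a ^ j = 1 + int j * t] (mod (int n)\<^sup>2)" for j
  proof (induct j)
    case (Suc j)
    have "[a ^ Suc j = a * (1 + int j * t)] (mod (int n)\<^sup>2)" using Suc by (simp add: cong_scalar_left)
    also have "a * (1 + int j * t) = (1 + int (Suc j) * t) + int j * t\<^sup>2"
      by (simp add: t_def power2_eq_square algebra_simps)
    also have "[(1 + int (Suc j) * t) + int j * t\<^sup>2 = (1 + int (Suc j) * t) + 0] (mod (int n)\<^sup>2)"
      using t2 by (intro cong_add cong_refl) (simp add: cong_0_iff)
    finally show ?case by simp
  qed simp
  obtain h where h: "n = 2 * h + 1" using assms(1) by (elim oddE)
  have sum: "2 * (\<Sum>j<m. int j) = int m * (int m - 1)" for m
    by (induct m) (simp_all add: algebra_simps)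
  have gauss: "(\<Sum>j<n. int j) = int n * int h" using sum[of n] h by simp
  have "[(\<Sum>j<n. a ^ j) = (\<Sum>j<n. 1 + int j * t)] (mod (int n)\<^sup>2)" by (intro cong_sum pow)
  also have "(\<Sum>j<n. 1 + int j * t) = int n + (\<Sum>j<n. int j) * t" by (simp add: sum.distrib sum_distrib_right)
  also have "\<dots> = int n + int h * (int n * t)" unfolding gauss by simp
  also have "[int n + int h * (int n * t) = int n + 0] (mod (int n)\<^sup>2)"
  proof (intro cong_add cong_refl)
    have "int n * int n dvd int n * t" using nt by (intro mult_dvd_mono) auto
    then show "[int h * (int n * t) = 0] (mod (int n)\<^sup>2)" by (simp add: cong_0_iff power2_eq_square)
  qed
  finally show ?thesis by simp
qed

text \<open>The cofactor of \<open>a - 1\<close> in \<open>a ^ q - 1\<close> is \<open>q\<close>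
  times a number that is 1 modulo \<open>q\<close>, so the exponent of \<open>q\<close> grows by
  exactly one.\<close>

lemma power_minus_1_exact:
  fixes a :: int and q :: nat
  assumes q: "prime q" "odd q" and s: "s > 0" "int q ^ s dvd a - 1" "\<not> int q ^ Suc s dvd a - 1"
  shows "int q ^ Suc s dvd a ^ q - 1" "\<not> int q ^ Suc (Suc s) dvd a ^ q - 1"
proof -
  have qp: "prime (int q)" using q by simp
  have q0: "int q \<noteq> 0" using q(1) by (simp add: prime_gt_0_nat)
  have "int q dvd int q ^ s" using s(1) by (intro dvd_power) simp
  then have qa: "int q dvd a - 1" using s(2) by (rule dvd_trans)
  let ?S = "\<Sum>j<q. a ^ j"
  have eq: "a ^ q - 1 = (a - 1) * ?S" by (rule power_diff_1_eq)
  obtain c where "?S = int q + (int q)\<^sup>2 * c"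
    using cong_sym[OF power_diff_1_cong_sum[OF q(2) qa]] unfolding cong_iff_lin by blast
  then have S: "?S = int q * (1 + int q * c)" by (simp add: power2_eq_square algebra_simps)
  obtain a' where a': "a - 1 = int q ^ s * a'" using s(2) by (elim dvdE)
  have na: "\<not> int q dvd a'"
  proof
    assume "int q dvd a'"
    then have "int q ^ s * int q dvd int q ^ s * a'" by (intro mult_dvd_mono) auto
    then show False using s(3) a' by (simp add: mult.commute)
  qed
  have prod: "a ^ q - 1 = int q ^ Suc s * (a' * (1 + int q * c))"
    unfolding eq S a' by (simp add: ac_simps)
  then show "int q ^ Suc s dvd a ^ q - 1" by simp
  show "\<not> int q ^ Suc (Suc s) dvd a ^ q - 1"
  proof
    assume "int q ^ Suc (Suc s) dvd a ^ q - 1"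
    then have "int q ^ Suc s * int q dvd int q ^ Suc s * (a' * (1 + int q * c))"
      unfolding prod by (simp only: power_Suc2)
    then have "int q dvd a' * (1 + int q * c)" using q0 by (simp only: dvd_mult_cancel_left) simp
    then have "int q dvd 1 + int q * c" using na prime_dvd_multD[OF qp] by blast
    then have "int q dvd (1 + int q * c) - int q * c" by (rule dvd_diff) simp
    then show False using qp by (simp add: prime_nat_iff)
  qed
qed

text \<open>The cofactor of \<open>a - 1\<close> in \<open>a ^ d - 1\<close> is congruent to
  \<open>d\<close> modulo \<open>q\<close>. When \<open>q\<close> divides it, one factor
  \<open>q\<close> moves from \<open>d\<close> into the base, and \<open>s\<close> grows by exactly
  one.\<close>

lemma lifting_the_exponent:
  fixes a :: int and q :: nat
  assumes q: "prime q" "odd q" and "s > 0" "int q ^ s dvd a - 1" "\<not> int q ^ Suc s dvd a - 1"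
    and "int q ^ (s + i) dvd a ^ d - 1"
  shows "q ^ i dvd d"
  using assms(3-)
proof (induction i arbitrary: a s d)
  case (Suc i)
  have qp: "prime (int q)" using q by simp
  have q0: "int q \<noteq> 0" using q(1) by (simp add: prime_gt_0_nat)
  have "int q dvd int q ^ s" using Suc.prems(1) by (intro dvd_power) simp
  then have qa: "int q dvd a - 1" using Suc.prems(2) by (rule dvd_trans)
  let ?S = "\<Sum>j<d. a ^ j"
  have eq: "a ^ d - 1 = (a - 1) * ?S" by (rule power_diff_1_eq)
  obtain a' where a': "a - 1 = int q ^ s * a'" using Suc.prems(2) by (elim dvdE)
  have na: "\<not> int q dvd a'"
  proof
    assume "int q dvd a'"
    then have "int q ^ s * int q dvd int q ^ s * a'" by (intro mult_dvd_mono) auto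
    then show False using Suc.prems(3) a' by (simp add: mult.commute)
  qed
  have "int q ^ s * int q ^ Suc i dvd int q ^ s * (a' * ?S)"
    using Suc.prems(4) unfolding eq a' power_add by (simp only: mult.assoc)
  then have "int q ^ Suc i dvd a' * ?S" using q0 by (simp only: dvd_mult_cancel_left) simp
  moreover have "int q dvd int q ^ Suc i" by simp
  ultimately have "int q dvd a' * ?S" using dvd_trans by blast
  then have qS: "int q dvd ?S" using na prime_dvd_multD[OF qp] by blast
  have "[a = 1] (mod int q)" using qa by (simp add: cong_iff_dvd_diff)
  then have "[a ^ j = 1 ^ j] (mod int q)" for j by (rule cong_pow)
  then have "[?S = (\<Sum>j<d. 1 ^ j)] (mod int q)" by (intro cong_sum)
  then have "[?S = int d] (mod int q)" by simp
  then have "int q dvd int d" using qS cong_dvd_iff by blast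
  then have "q dvd d" by (simp only: of_nat_dvd_iff)
  then obtain d' where d: "d = q * d'" by (elim dvdE)
  note ex = power_minus_1_exact[OF q Suc.prems(1-3)]
  have "q ^ i dvd d'"
  proof (rule Suc.IH[OF _ ex])
    show "int q ^ (Suc s + i) dvd (a ^ q) ^ d' - 1"
      using Suc.prems(4) by (simp add: d power_mult)
  qed simp
  then show ?case unfolding d power_Suc by (intro mult_dvd_mono) auto
qed simp

locale two_odd_primes =
  fixes p q :: nat
  assumes pr: "prime p" "odd p" and qr: "prime q" "odd q" and pq: "p \<noteq> q"
begin

abbreviation "m \<equiv> min_exp q p"
abbreviation "\<eta> \<equiv> eta q p"
abbreviation "s \<equiv> multiplicity q (p ^ (2 * m) - 1)"

lemma q_gt_2: "q > 2"
  using qr prime_ge_2_nat[of q] by (cases "q = 2") auto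

lemma p_pow_pos: "p ^ n > 0"
  using pr(1) by (simp add: prime_gt_0_nat)

text \<open>Passing to the integers removes the truncated subtraction, as \<open>p ^ t\<close> is at
  least 1.\<close>

lemma dvd_minus_1_iff: "n dvd p ^ t - 1 \<longleftrightarrow> int n dvd int p ^ t - 1"
proof -
  have "1 \<le> p ^ t" using p_pow_pos[of t] by linarith
  from of_nat_diff[OF this, where 'a = int] have "int (p ^ t - 1) = int p ^ t - 1"
    by (simp only: of_nat_power of_nat_1)
  then show ?thesis by (metis of_nat_dvd_iff)
qed

lemma dvd_plus_1_iff: "n dvd p ^ t + 1 \<longleftrightarrow> int n dvd int p ^ t + 1"
  by (metis (mono_tags) of_nat_1 of_nat_add of_nat_dvd_iff of_nat_power)

text \<open>Fermat's theorem makes \<open>q - 1\<close> a candidate, so the least exponent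
  exists.\<close>

lemma min_exp: "0 < m" "q dvd p ^ m - 1 \<or> q dvd p ^ m + 1"
proof -
  have "\<not> q dvd p" using pr(1) qr(1) pq primes_dvd_imp_eq by blast
  then have "[p ^ (q - 1) = 1] (mod q)" using qr(1) by (intro fermat_theorem)
  then have "q dvd p ^ (q - 1) - 1"
    by (rule cong_to_1_nat)
  moreover have "0 < q - 1" using q_gt_2 by simp
  ultimately have "0 < q - 1 \<and> (q dvd p ^ (q - 1) - 1 \<or> q dvd p ^ (q - 1) + 1)" by blast
  then have "0 < m \<and> (q dvd p ^ m - 1 \<or> q dvd p ^ m + 1)"
    unfolding min_exp_def by (rule LeastI)
  then show "0 < m" "q dvd p ^ m - 1 \<or> q dvd p ^ m + 1" by blast+
qed

lemma min_exp_le: "0 < t \<Longrightarrow> q dvd p ^ t - 1 \<or> q dvd p ^ t + 1 \<Longrightarrow> m \<le> t"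
  unfolding min_exp_def by (rule Least_le) (rule conjI)

lemma eta_values: "\<eta> = 1 \<or> \<eta> = - 1"
  by (simp add: eta_def)

lemma eta_pow_values: "\<eta> ^ n = 1 \<or> \<eta> ^ n = - 1"
  using eta_values by (induct n) auto

lemma eta_cong: "[int p ^ m = \<eta>] (mod int q)"
proof (cases "q dvd p ^ m - 1")
  case True
  then have "int q dvd int p ^ m - 1" by (simp only: dvd_minus_1_iff)
  then show ?thesis using True by (simp add: eta_def cong_iff_dvd_diff)
next
  case False
  then have "q dvd p ^ m + 1" using min_exp by blast
  then have "int q dvd int p ^ m + 1" by (simp only: dvd_plus_1_iff)
  then show ?thesis using False by (simp add: eta_def cong_iff_dvd_diff)
qed

lemma sign_eq:
  fixes a c :: int
  assumes "[a = c] (mod int q)" "a = 1 \<or> a = - 1" "c = 1 \<or> c = - 1"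
  shows "a = c"
proof (rule ccontr)
  assume "a \<noteq> c"
  then have "int q dvd 2" using assms by (auto simp: cong_iff_dvd_diff)
  then have "q dvd 2" by (metis of_nat_dvd_iff of_nat_numeral)
  then show False using q_gt_2 dvd_imp_le by fastforce
qed

text \<open>Division of \<open>N\<close> by \<open>m\<close> leaves a remainder \<open>t < m\<close>
  for which \<open>p ^ t\<close> is 1 or -1 modulo \<open>q\<close>; minimality of \<open>m\<close>
  forces \<open>t = 0\<close>. The sign then follows, since 1 and -1 differ modulo an odd
  prime.\<close>

lemma sign_exponent:
  assumes "int q dvd int p ^ N - e" "e = 1 \<or> e = - 1"
  shows "m dvd N" "e = \<eta> ^ (N div m)"
proof -
  define t where "t = N mod m"
  let ?w = "\<eta> ^ (N div m)"
  have N: "N = m * (N div m) + t" by (simp add: t_def)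
  have "int p ^ N = int p ^ (m * (N div m) + t)" using N by (rule arg_cong)
  then have "int p ^ N = (int p ^ m) ^ (N div m) * int p ^ t" by (simp only: power_add power_mult)
  moreover have "[(int p ^ m) ^ (N div m) * int p ^ t = ?w * int p ^ t] (mod int q)"
    by (intro cong_mult cong_pow eta_cong cong_refl)
  moreover have "[int p ^ N = e] (mod int q)" using assms(1) by (simp add: cong_iff_dvd_diff)
  ultimately have "[?w * int p ^ t = e] (mod int q)" by (simp only: cong_def)
  then have "[?w * (?w * int p ^ t) = ?w * e] (mod int q)" by (rule cong_scalar_left)
  moreover have "?w * ?w = 1" using eta_pow_values[of "N div m"] by auto
  ultimately have pt: "[int p ^ t = ?w * e] (mod int q)" by (simp flip: mult.assoc)
  have we: "?w * e = 1 \<or> ?w * e = - 1" using assms(2) eta_pow_values[of "N div m"] by auto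
  have t0: "t = 0"
  proof (rule ccontr)
    assume "t \<noteq> 0"
    have "int q dvd int p ^ t - 1 \<or> int q dvd int p ^ t + 1"
      using we
    proof
      assume "?w * e = 1" then show ?thesis using pt by (simp add: cong_iff_dvd_diff)
    next
      assume "?w * e = - 1" then show ?thesis using pt by (simp add: cong_iff_dvd_diff)
    qed
    then have "q dvd p ^ t - 1 \<or> q dvd p ^ t + 1" by (simp only: dvd_minus_1_iff dvd_plus_1_iff)
    then have "m \<le> t" by (rule min_exp_le[rotated]) (use \<open>t \<noteq> 0\<close> in simp)
    then show False using mod_less_divisor[OF min_exp(1), of N] unfolding t_def by linarith
  qed
  then show "m dvd N" by (simp add: t_def dvd_eq_mod_eq_0)
  have "[?w * e = 1] (mod int q)" using pt t0 by (simp add: cong_sym)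
  then have "?w * e = 1" using we by (rule sign_eq) simp
  then show "e = ?w" using assms(2) eta_pow_values[of "N div m"] by auto
qed

lemma base_exact: "s > 0" "int q ^ s dvd int p ^ (2 * m) - 1" "\<not> int q ^ Suc s dvd int p ^ (2 * m) - 1"
proof -
  have p2: "p ^ (2 * m) > 1" using min_exp(1) by (intro one_less_power prime_gt_1_nat pr) simp
  have nz: "p ^ (2 * m) - 1 \<noteq> 0" using p2 by simp
  have nu: "\<not> is_unit q" using qr(1) by auto
  have iff: "q ^ n dvd p ^ (2 * m) - 1 \<longleftrightarrow> n \<le> s" for n by (rule power_dvd_iff_le_multiplicity[OF nz nu])
  have "[(int p ^ m) ^ 2 = \<eta> ^ 2] (mod int q)" by (intro cong_pow eta_cong)
  moreover have "\<eta> ^ 2 = 1" using eta_values by auto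
  ultimately have "int q dvd int p ^ (2 * m) - 1" by (simp add: cong_iff_dvd_diff power_mult[symmetric] mult.commute)
  then have "q ^ 1 dvd p ^ (2 * m) - 1" by (simp only: dvd_minus_1_iff power_one_right)
  then have "1 \<le> s" by (simp only: iff)
  then show "s > 0" by simp
  have "q ^ s dvd p ^ (2 * m) - 1" by (rule multiplicity_dvd)
  then show "int q ^ s dvd int p ^ (2 * m) - 1" by (simp only: dvd_minus_1_iff of_nat_power)
  have "\<not> q ^ Suc s dvd p ^ (2 * m) - 1" by (simp only: iff not_less_eq_eq order_refl not_False_eq_True)
  then show "\<not> int q ^ Suc s dvd int p ^ (2 * m) - 1" by (simp only: dvd_minus_1_iff of_nat_power not_False_eq_True)
qed

text \<open>Multiplying by \<open>p ^ N + e\<close> gives \<open>p ^ (2 * N) - 1\<close>, that is, a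
  power of \<open>p ^ (2 * m)\<close> minus 1. The exponent of \<open>q\<close> in
  \<open>p ^ (2 * m) - 1\<close> is exactly \<open>s\<close>, so the exponent can be lifted.\<close>

lemma exponent_lower_bound:
  assumes "int (q ^ r) dvd int p ^ N - e" "e = 1 \<or> e = - 1" "N > 0" "r > 0"
  shows "m dvd N" "e = \<eta> ^ (N div m)" "q ^ (r - s) \<le> N div m"
proof -
  have "int q dvd int (q ^ r)" using assms(4) by (simp add: dvd_power)
  then have qd: "int q dvd int p ^ N - e" using assms(1) by (rule dvd_trans)
  show mN: "m dvd N" and "e = \<eta> ^ (N div m)" using sign_exponent[OF qd assms(2)] by auto
  have pos: "N div m > 0" using mN assms(3) by (auto elim!: dvdE)
  show "q ^ (r - s) \<le> N div m"
  proof (cases "r \<le> s")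
    case True
    then show ?thesis using pos by simp
  next
    case False
    have "int (q ^ r) dvd (int p ^ N - e) * (int p ^ N + e)" using assms(1) by (rule dvd_mult2)
    also have "(int p ^ N - e) * (int p ^ N + e) = int p ^ (2 * N) - e * e"
      by (simp add: algebra_simps power_add mult_2_right)
    also have "e * e = 1" using assms(2) by auto
    also have "int p ^ (2 * N) = (int p ^ (2 * m)) ^ (N div m)"
    proof -
      have "m * (N div m) = N" using mN by simp
      then show ?thesis by (simp only: power_mult[symmetric] mult.assoc)
    qed
    finally have "int q ^ (s + (r - s)) dvd (int p ^ (2 * m)) ^ (N div m) - 1" using False by simp
    then have "q ^ (r - s) dvd N div m" by (rule lifting_the_exponent[OF qr base_exact])
    then show ?thesis using pos by (rule dvd_imp_le)
  qed
qed

text \<open>Raising \<open>p ^ (2 * m)\<close> to the power \<open>q ^ (r - s)\<close> gains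
  \<open>r - s\<close> factors \<open>q\<close>. Of the two factors of the resulting difference, the
  one with \<open>+ \<eta>\<close> is prime to \<open>q\<close>, so the other takes the whole
  power.\<close>

lemma exponent_attained: "int (q ^ r) dvd int p ^ (m * q ^ (r - s)) - \<eta>"
proof -
  \<comment> \<open>\<open>power_p_cong\<close> is reused with \<open>q\<close> as the
    prime.\<close>
  interpret Q: odd_prime_power "int q" 1 using qr by unfold_locales auto
  define a where "a = int p ^ (2 * m)"
  let ?M = "m * q ^ (r - s)"
  have lift: "[a ^ (q ^ i) = 1] (mod int q ^ (s + i))" for i
  proof (induct i)
    case 0
    then show ?case using base_exact(2) by (simp add: a_def cong_iff_dvd_diff)
  next
    case (Suc i)
    have si: "s + i = Suc (s + i - 1)" using base_exact(1) by simp
    from Suc have "[(a ^ (q ^ i)) ^ nat (int q) = 1 ^ nat (int q)] (mod int q ^ Suc (Suc (s + i - 1)))"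
      by (intro Q.power_p_cong) (simp only: si[symmetric])
    then have "[(a ^ (q ^ i)) ^ q = 1] (mod int q ^ Suc (s + i))"
      by (simp only: si[symmetric] nat_int power_one)
    then show ?case by (simp only: power_mult[symmetric] power_Suc2[symmetric] add_Suc_right)
  qed
  have "int q ^ r dvd int q ^ (s + (r - s))" by (intro le_imp_power_dvd) simp
  moreover have "int q ^ (s + (r - s)) dvd a ^ (q ^ (r - s)) - 1" using lift by (simp only: cong_iff_dvd_diff)
  ultimately have "int q ^ r dvd a ^ (q ^ (r - s)) - 1" by (rule dvd_trans)
  also have "a ^ (q ^ (r - s)) = int p ^ ?M * int p ^ ?M"
    by (simp add: a_def power_mult[symmetric] power_add[symmetric] mult_2[symmetric] ac_simps)
  also have "int p ^ ?M * int p ^ ?M - 1 = (int p ^ ?M + \<eta>) * (int p ^ ?M - \<eta>)"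
    using eta_values by (auto simp: algebra_simps)
  finally have dv: "int q ^ r dvd (int p ^ ?M + \<eta>) * (int p ^ ?M - \<eta>)" .
  have "[(int p ^ m) ^ (q ^ (r - s)) = \<eta> ^ (q ^ (r - s))] (mod int q)" by (intro cong_pow eta_cong)
  moreover have "\<eta> ^ (q ^ (r - s)) = \<eta>" using eta_values qr(2) by auto
  ultimately have cong: "[int p ^ ?M = \<eta>] (mod int q)" by (simp add: power_mult)
  have "\<not> int q dvd int p ^ ?M + \<eta>"
  proof
    assume "int q dvd int p ^ ?M + \<eta>"
    then have "[int p ^ ?M = - \<eta>] (mod int q)" by (simp add: cong_iff_dvd_diff)
    then have "[\<eta> = - \<eta>] (mod int q)" using cong by (simp only: cong_def)
    then have "\<eta> = - \<eta>" using eta_values by (intro sign_eq) auto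
    then show False using eta_values by auto
  qed
  then have "coprime (int q ^ r) (int p ^ ?M + \<eta>)"
    using qr(1) by (intro coprime_power_left_iff[THEN iffD2] disjI1 prime_imp_coprime) auto
  then have "int q ^ r dvd int p ^ ?M - \<eta>" using dv by (simp only: coprime_dvd_mult_right_iff)
  then show ?thesis by simp
qed

end


section \<open>Standard spaces and cyclic shifts\<close>

text \<open>Multiplication of the integers modulo \<open>K\<close>, carried over to fractions over
  \<open>K\<close>; by \<open>qmul_qfrac\<close> the choice of numerators does not matter.\<close>

definition qmul :: "int \<Rightarrow> qz \<Rightarrow> qz \<Rightarrow> qz" where
  "qmul K x y = qfrac K ((SOME a. x = qfrac K a) * (SOME a. y = qfrac K a))"

lemma qmul_qfrac: assumes "K > 0" shows "qmul K (qfrac K a) (qfrac K c) = qfrac K (a * c)"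
proof -
  have "[(SOME a'. qfrac K a = qfrac K a') = a] (mod K)" for a
    using someI[of "\<lambda>a'. qfrac K a = qfrac K a'" a] qfrac_eq_iff[OF assms] by (metis cong_sym)
  then show ?thesis unfolding qmul_def qfrac_eq_iff[OF assms] by (intro cong_mult)
qed

definition std_space :: "nat \<Rightarrow> int \<Rightarrow> (nat \<Rightarrow> qz) set" where
  "std_space n K = {x. (\<forall>i<n. K *z x i = 0) \<and> (\<forall>i\<ge>n. x i = 0)}"

text \<open>The number of summands is kept apart from the rank of the space: the spaces for all
  \<open>n \<le> N\<close> are then nested and carry one form, and \<open>std_diag\<close> runs
  through them.\<close>

definition std_b :: "nat \<Rightarrow> int \<Rightarrow> (nat \<Rightarrow> qz) \<Rightarrow> (nat \<Rightarrow> qz) \<Rightarrow> qz" where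
  "std_b n K x y = (\<Sum>i<n. qmul K (x i) (y i))"

definition std_unit :: "int \<Rightarrow> nat \<Rightarrow> nat \<Rightarrow> qz" where
  "std_unit K i = (\<lambda>j. if j = i then qfrac K 1 else 0)"

lemma std_space_torsion: "x \<in> std_space n K \<Longrightarrow> K *z x i = 0"
  by (cases "i < n") (auto simp: std_space_def)

lemma std_space_frac:
  assumes "K > 0" "x \<in> std_space n K"
  obtains a where "\<And>i. x i = qfrac K (a i)" "\<And>i. i \<ge> n \<Longrightarrow> a i = 0" "\<And>i. a i \<in> {0..<K}"
proof -
  have "\<exists>a. x i = qfrac K a \<and> (i \<ge> n \<longrightarrow> a = 0) \<and> a \<in> {0..<K}" for i
  proof (cases "i \<ge> n")
    case True
    then show ?thesis using assms by (intro exI[of _ 0]) (auto simp: std_space_def)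
  next
    case False
    obtain a where "x i = qfrac K a" using qfrac_exists[OF assms(1) std_space_torsion[OF assms(2)]] by blast
    also have "\<dots> = qfrac K (a mod K)" using qfrac_eq_iff[OF assms(1)] by (simp add: cong_def)
    finally show ?thesis using False assms(1) by (intro exI[of _ "a mod K"]) auto
  qed
  then obtain a where "\<And>i. x i = qfrac K (a i) \<and> (i \<ge> n \<longrightarrow> a i = 0) \<and> a i \<in> {0..<K}" by metis
  then show ?thesis using that by blast
qed

lemma std_unit_mem: "K > 0 \<Longrightarrow> i < n \<Longrightarrow> std_unit K i \<in> std_space n K"
  by (auto simp: std_space_def std_unit_def zscale_qfrac qfrac_eq_0_iff)

lemma std_space_closed:
  assumes "x \<in> std_space n K" "y \<in> std_space n K"
  shows "x + y \<in> std_space n K" "a *z x \<in> std_space n K"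
proof -
  show "x + y \<in> std_space n K" using assms by (auto simp: std_space_def zscale_simps)
  have "K *z a *z x i = a *z K *z x i" for i by (simp add: mult.commute)
  then show "a *z x \<in> std_space n K"
    using assms by (auto simp: std_space_def zscale_fun_apply simp del: zscale.scale_scale)
qed

lemma std_b_frac: "K > 0 \<Longrightarrow> (\<And>i. x i = qfrac K (a i)) \<Longrightarrow> (\<And>i. y i = qfrac K (c i)) \<Longrightarrow>
    std_b n K x y = (\<Sum>i<n. qfrac K (a i * c i))"
  by (simp add: std_b_def qmul_qfrac)

lemma qmul_zero: "K > 0 \<Longrightarrow> K *z x = 0 \<Longrightarrow> qmul K x 0 = 0"
  by (metis mult_zero_right qfrac_0 qfrac_exists qmul_qfrac)

lemma std_b_unit:
  assumes "K > 0" "x \<in> std_space n K" "i < N" shows "std_b N K x (std_unit K i) = x i"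
proof -
  have "std_b N K x (std_unit K i) = (\<Sum>j<N. if j = i then x i else 0)"
    unfolding std_b_def
  proof (rule sum.cong[OF refl])
    fix j
    obtain a where a: "x i = qfrac K a" using qfrac_exists[OF assms(1) std_space_torsion[OF assms(2)]] by blast
    show "qmul K (x j) (std_unit K i j) = (if j = i then x i else 0)"
      using a qmul_qfrac[OF assms(1), of a 1] qmul_zero[OF assms(1) std_space_torsion[OF assms(2)]]
      by (simp add: std_unit_def)
  qed
  then show ?thesis using assms(3) by simp
qed

lemma finite_std_space: assumes "K > 0" shows "finite (std_space n K)"
proof (rule finite_subset)
  show "std_space n K \<subseteq> (\<lambda>f i. if i < n then qfrac K (f i) else 0) ` ({..<n} \<rightarrow>\<^sub>E {0..<K})"
  proof
    fix x assume x: "x \<in> std_space n K"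
    then obtain a where a: "\<And>i. x i = qfrac K (a i)" "\<And>i. a i \<in> {0..<K}" using std_space_frac assms by metis
    show "x \<in> (\<lambda>f i. if i < n then qfrac K (f i) else 0) ` ({..<n} \<rightarrow>\<^sub>E {0..<K})"
      using a x by (intro image_eqI[of _ _ "restrict a {..<n}"]) (auto simp: std_space_def fun_eq_iff)
  qed
qed (simp add: finite_PiE)

context odd_prime_power
begin

text \<open>Coordinatewise, \<open>p ^ k\<close> divides \<open>p ^ (k - 1) * a\<close> only if
  \<open>p\<close> divides \<open>a\<close>. This is where freeness yields
  \<open>p_divisible\<close>.\<close>

lemma std_space_divisible:
  assumes x: "x \<in> std_space n (p ^ k)" and 0: "(p ^ (k - 1)) *z x = 0"
  shows "\<exists>y\<in>std_space n (p ^ k). x = p *z y"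
proof -
  let ?K = "p ^ k"
  have K: "?K > 0" by simp
  have "\<exists>c. x i = qfrac ?K (p * c) \<and> (i \<ge> n \<longrightarrow> c = 0)" for i
  proof (cases "i < n")
    case True
    obtain a where a: "x i = qfrac ?K a" using qfrac_exists[OF K std_space_torsion[OF x]] by blast
    have "(p ^ (k - 1)) *z x i = 0" using fun_cong[OF 0, of i] by (simp add: zscale_fun_apply)
    then have "p ^ k dvd p ^ (k - 1) * a" using a by (simp add: zscale_qfrac qfrac_eq_0_iff)
    then have "p dvd a" using k_split by (simp add: mult.commute)
    then show ?thesis using a True by auto
  next
    case False
    then show ?thesis using x by (intro exI[of _ 0]) (auto simp: std_space_def)
  qed
  then obtain c where c: "\<And>i. x i = qfrac ?K (p * c i)" "\<And>i. i \<ge> n \<Longrightarrow> c i = 0" by metis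
  have "x = p *z (\<lambda>i. qfrac ?K (c i))" using c by (auto simp: zscale_fun_apply zscale_qfrac)
  moreover have "(\<lambda>i. qfrac ?K (c i)) \<in> std_space n ?K"
    using c by (auto simp: std_space_def zscale_qfrac qfrac_eq_0_iff)
  ultimately show ?thesis by blast
qed

lemma std_form_space:
  assumes "n \<le> N"
  shows "form_space p k (std_space n (p ^ k)) (std_b N (p ^ k))"
proof -
  let ?K = "p ^ k" and ?V = "std_space n (p ^ k)"
  have K: "?K > 0" by simp
  have frac: "\<exists>a. \<forall>i. x i = qfrac ?K (a i)" if "x \<in> ?V" for x
    using std_space_frac[OF K that] by metis
  show ?thesis
  proof
    show "finite ?V" by (rule finite_std_space[OF K])
    show "0 \<in> ?V" by (simp add: std_space_def)
    show "x + y \<in> ?V" if "x \<in> ?V" "y \<in> ?V" for x y using that by (rule std_space_closed)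
    show "?K *z x = 0" if "x \<in> ?V" for x
      using std_space_torsion[OF that] by (auto simp: zscale_fun_apply)
    show "std_b N ?K (x + y) z = std_b N ?K x z + std_b N ?K y z" if xyz: "x \<in> ?V" "y \<in> ?V" "z \<in> ?V" for x y z
    proof -
      obtain a c d where f: "\<And>i. x i = qfrac ?K (a i)" "\<And>i. y i = qfrac ?K (c i)" "\<And>i. z i = qfrac ?K (d i)"
        using frac xyz by metis
      then have "std_b N ?K (x + y) z = (\<Sum>i<N. qfrac ?K ((a i + c i) * d i))"
        by (intro std_b_frac[OF K]) (simp_all add: qfrac_add)
      also have "\<dots> = (\<Sum>i<N. qfrac ?K (a i * d i)) + (\<Sum>i<N. qfrac ?K (c i * d i))"
        by (simp add: distrib_right qfrac_add sum.distrib)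
      finally show ?thesis using f by (simp add: std_b_frac[OF K])
    qed
    show "std_b N ?K x y = std_b N ?K y x" for x y
      unfolding std_b_def qmul_def by (simp only: mult.commute)
    show "x = 0" if x: "x \<in> ?V" and *: "\<And>y. y \<in> ?V \<Longrightarrow> std_b N ?K x y = 0" for x
    proof
      fix i
      show "x i = 0 i"
      proof (cases "i < n")
        case True
        then show ?thesis using std_b_unit[OF K x, of i N] *[OF std_unit_mem[OF K True]] assms by simp
      qed (use x in \<open>auto simp: std_space_def\<close>)
    qed
    show "\<exists>y\<in>?V. x = p *z y"
      if x: "x \<in> ?V" and *: "\<And>y. y \<in> ?V \<Longrightarrow> (p ^ (k - 1)) *z std_b N ?K x y = 0" for x
    proof (rule std_space_divisible[OF x])
      show "(p ^ (k - 1)) *z x = 0"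
      proof
        fix i
        show "((p ^ (k - 1)) *z x) i = 0 i"
        proof (cases "i < n")
          case True
          then show ?thesis
            using *[OF std_unit_mem[OF K True]] std_b_unit[OF K x, of i N] assms by (simp add: zscale_fun_apply)
        qed (use x in \<open>auto simp: std_space_def zscale_fun_apply\<close>)
      qed
    qed
  qed
qed

lemma std_diag: "n \<le> N \<Longrightarrow> diag p k (std_b N (p ^ k)) (std_space n (p ^ k)) (replicate n 1)"
proof (induct n)
  case 0
  have "std_space 0 (p ^ k) = {0}" by (auto simp: std_space_def)
  then show ?case using diag_Nil by simp
next
  case (Suc n)
  let ?K = "p ^ k" and ?e = "std_unit (p ^ k) n"
  have e: "?e \<in> std_space (Suc n) ?K" by (rule std_unit_mem) simp_all
  have bx: "std_b N ?K x ?e = x n" if "x \<in> std_space (Suc n) ?K" for x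
    using that Suc by (intro std_b_unit) auto
  have "perp (std_b N ?K) (std_space (Suc n) ?K) ?e = std_space n ?K"
  proof
    show "perp (std_b N ?K) (std_space (Suc n) ?K) ?e \<subseteq> std_space n ?K"
    proof
      fix x assume "x \<in> perp (std_b N ?K) (std_space (Suc n) ?K) ?e"
      then have "x \<in> std_space (Suc n) ?K" "x n = 0" using bx by (auto simp: perp_def)
      then show "x \<in> std_space n ?K" unfolding std_space_def
        by (auto simp: less_Suc_eq) (metis Suc_leI le_neq_implies_less)
    qed
    show "std_space n ?K \<subseteq> perp (std_b N ?K) (std_space (Suc n) ?K) ?e"
    proof
      fix x assume x: "x \<in> std_space n ?K"
      then have x': "x \<in> std_space (Suc n) ?K" by (auto simp: std_space_def less_Suc_eq)
      have "x n = 0" using x by (simp add: std_space_def)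
      then show "x \<in> perp (std_b N ?K) (std_space (Suc n) ?K) ?e" using x' bx by (simp add: perp_def)
    qed
  qed
  then have d: "diag p k (std_b N ?K) (perp (std_b N ?K) (std_space (Suc n) ?K) ?e) (replicate n 1)" using Suc by simp
  have "std_b N ?K ?e ?e = qfrac ?K 1" using bx[OF e] by (simp add: std_unit_def)
  from diag_Cons[where b = "std_b N ?K", OF e this coprime_1_left d] show ?case by simp
qed

end

section \<open>The cyclic shift and its blocks\<close>

text \<open>Coordinate \<open>i\<close> moves to \<open>i + 1\<close>; adding \<open>L - 1\<close>
  modulo \<open>L\<close> is subtraction of 1 without truncation.\<close>

definition shift :: "nat \<Rightarrow> (nat \<Rightarrow> qz) \<Rightarrow> nat \<Rightarrow> qz" where
  "shift L x i = (if i < L then x ((i + (L - 1)) mod L) else 0)"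

lemma shift_funpow:
  assumes "i < L" shows "(shift L ^^ j) x i = x ((i + j * (L - 1)) mod L)"
  using assms
proof (induct j arbitrary: i)
  case (Suc j)
  have "(shift L ^^ Suc j) x i = (shift L ^^ j) x ((i + (L - 1)) mod L)" using Suc by (simp add: shift_def)
  also have "\<dots> = x (((i + (L - 1)) mod L + j * (L - 1)) mod L)" using Suc by simp
  also have "((i + (L - 1)) mod L + j * (L - 1)) mod L = (i + Suc j * (L - 1)) mod L"
    by (simp only: mod_add_left_eq mult_Suc add.assoc)
  finally show ?case .
qed simp

lemma shift_unit:
  assumes "Suc j < L" shows "shift L (std_unit K j) = std_unit K (Suc j)"
proof
  fix i
  have "(i + (L - 1)) mod L = j \<longleftrightarrow> i = Suc j" if i: "i < L"
  proof (cases i)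
    case 0
    then show ?thesis using assms by auto
  next
    case (Suc i')
    then have "i + (L - 1) = i' + L" using assms by simp
    then have "(i + (L - 1)) mod L = i'" using i Suc by simp
    then show ?thesis using Suc by simp
  qed
  then show "shift L (std_unit K j) i = std_unit K (Suc j) i"
    using assms by (auto simp: shift_def std_unit_def)
qed

lemma shift_funpow_unit: "j < L \<Longrightarrow> (shift L ^^ j) (std_unit K 0) = std_unit K j"
proof (induct j)
  case (Suc j)
  then show ?case using shift_unit[of j L K] by simp
qed simp

text \<open>Nondegeneracy makes a form-preserving additive map injective, and on a finite set it is
  then bijective.\<close>

lemma (in form_space) isom_endoI:
  assumes "\<And>x. x \<in> V \<Longrightarrow> f x \<in> V" "\<And>x y. x \<in> V \<Longrightarrow> y \<in> V \<Longrightarrow> f (x + y) = f x + f y"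
    "\<And>x y. x \<in> V \<Longrightarrow> y \<in> V \<Longrightarrow> b (f x) (f y) = b x y"
  shows "isom V b V b f"
proof -
  have "inj_on f V"
  proof (rule inj_onI)
    fix x y assume xy: "x \<in> V" "y \<in> V" "f x = f y"
    have "x - y = 0"
    proof (rule nondeg)
      fix z assume z: "z \<in> V"
      have "f x = f (x - y) + f y" using assms(2)[of "x - y" y] xy by (simp add: closed)
      then have "f (x - y) = 0" using xy by simp
      then have "b (f (x - y)) (f z) = 0" using assms(1)[OF z] by simp
      then show "b (x - y) z = 0" using assms(3) xy z by (simp add: closed)
    qed (use xy in \<open>simp add: closed\<close>)
    then show "x = y" by simp
  qed
  moreover have "f ` V \<subseteq> V" using assms(1) by blast
  ultimately have "bij_betw f V V" unfolding bij_betw_def using endo_inj_surj[OF finite_V, of f] by blast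
  then show ?thesis using assms(2,3) by (simp add: isom_def)
qed

lemma (in odd_prime_power) shift_isom:
  assumes "L > 0"
  shows "isom (std_space L (p ^ k)) (std_b L (p ^ k)) (std_space L (p ^ k)) (std_b L (p ^ k)) (shift L)"
proof -
  interpret form_space p k "std_space L (p ^ k)" "std_b L (p ^ k)" by (rule std_form_space) simp
  let ?c = "\<lambda>i. (i + (L - 1)) mod L"
  have "inj_on ?c {..<L}"
  proof (rule inj_onI)
    fix i j assume ij: "i \<in> {..<L}" "j \<in> {..<L}" "?c i = ?c j"
    then have "[i + (L - 1) = j + (L - 1)] (mod L)" by (simp add: cong_def)
    then have "[i = j] (mod L)" by (simp only: cong_add_rcancel_nat)
    then show "i = j" using ij by (simp add: cong_def)
  qed
  moreover have "?c ` {..<L} \<subseteq> {..<L}" using assms by auto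
  ultimately have bij: "bij_betw ?c {..<L} {..<L}"
    unfolding bij_betw_def using endo_inj_surj[of "{..<L}" ?c] by simp
  show ?thesis
  proof (rule isom_endoI)
    show "shift L x \<in> std_space L (p ^ k)" if "x \<in> std_space L (p ^ k)" for x
      using std_space_torsion[OF that] by (auto simp: std_space_def shift_def)
    show "shift L (x + y) = shift L x + shift L y" for x y by (auto simp: shift_def)
    show "std_b L (p ^ k) (shift L x) (shift L y) = std_b L (p ^ k) x y" for x y
    proof -
      have "std_b L (p ^ k) (shift L x) (shift L y) = (\<Sum>i<L. qmul (p ^ k) (x (?c i)) (y (?c i)))"
        unfolding std_b_def by (rule sum.cong) (auto simp: shift_def)
      then show ?thesis unfolding std_b_def using sum.reindex_bij_betw[OF bij, of "\<lambda>i. qmul (p ^ k) (x i) (y i)"] by simp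
    qed
  qed
qed

text \<open>The projection is assembled along an orthogonal basis of \<open>U\<close>, each line of
  which is split off from the whole of \<open>V\<close> by \<open>line_decomp\<close>.\<close>

lemma (in form_space) subspace_projection:
  assumes "diag p k b U us" "bform p k U b" "U \<subseteq> V" "x \<in> V"
  shows "\<exists>u\<in>U. \<forall>y\<in>U. b (x - u) y = 0"
  using assms
proof (induction arbitrary: x rule: diag.induct)
  case diag_Nil
  then show ?case by simp
next
  case (diag_Cons v U u us)
  interpret U: bform p k U b by fact
  have vV: "v \<in> V" using diag_Cons by blast
  obtain a w where w: "w \<in> perp b V v" "x = a *z v + w"
    using line_decomp[OF vV diag_Cons.hyps(2,3) \<open>x \<in> V\<close>] by blast
  have wV: "w \<in> V" "b w v = 0" using w by (auto simp: perp_def)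
  have P: "bform p k (perp b U v) b" "perp b U v \<subseteq> V"
    using U.perp_bform[OF diag_Cons.hyps(1)] diag_Cons.prems(2) by (auto simp: perp_def)
  obtain u' where u': "u' \<in> perp b U v" "\<forall>y\<in>perp b U v. b (w - u') y = 0"
    using diag_Cons.IH[OF P wV(1)] by blast
  have uV: "u' \<in> U" "u' \<in> V" "b u' v = 0" using u' diag_Cons.prems(2) by (auto simp: perp_def)
  have eq: "x - (a *z v + u') = w - u'" using w by simp
  have "b (x - (a *z v + u')) y = 0" if y: "y \<in> U" for y
  proof -
    obtain c z where z: "z \<in> perp b U v" "y = c *z v + z"
      using U.line_decomp[OF diag_Cons.hyps(1-3) y] by blast
    have zV: "z \<in> V" using z P(2) by blast
    have "b (w - u') z = 0" using u' z by blast
    then show ?thesis unfolding eq using z zV wV uV vV by (simp add: b_simps closed)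
  qed
  then show ?case using uV diag_Cons.hyps(1) by (intro bexI[of _ "a *z v + u'"]) (auto simp: U.closed)
qed

text \<open>The blocks are the indecomposable summands, in the permutation module of a cyclic group of order \<open>q ^ r\<close>,
  of the part on which the subgroup of order \<open>q\<close> acts without fixed points.\<close>

lemma (in two_odd_primes) exists_block:
  assumes k: "k > 0" and r: "r > 0"
  obtains U c and g :: "(nat \<Rightarrow> qz) \<Rightarrow> nat \<Rightarrow> qz" and us where
    "form_space (int p) k U c" "isom U c U c g" "\<And>x. x \<in> U \<Longrightarrow> (g ^^ (q ^ r)) x = x"
    "\<And>x. x \<in> U \<Longrightarrow> (g ^^ (q ^ (r - 1))) x = x \<Longrightarrow> x = 0" "diag (int p) k c U us"
    "length us = 2 * (m * q ^ (r - s))"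
    "Legendre (- 1) (int p) ^ (m * q ^ (r - s)) * Legendre (prod_list us) (int p) = \<eta>"
proof -
  interpret odd_prime_power "int p" k using pr k by unfold_locales auto
  define L where "L = q ^ r"
  define M where "M = m * q ^ (r - s)"
  have q0: "q > 0" using qr(1) by (rule prime_gt_0_nat)
  have L0: "L > 0" using q0 by (simp add: L_def)
  have M0: "M > 0" using q0 min_exp(1) by (simp add: M_def)
  have qL: "q ^ (r - 1) * q = L" using r by (cases r) (auto simp: L_def)
  have cop: "coprime (int q) (int p)"
    using pr(1) qr(1) pq by (simp add: primes_coprime)
  let ?K = "int p ^ k"
  define V where "V = std_space L ?K"
  define b where "b = std_b L ?K"
  let ?g = "shift L" and ?e = "std_unit ?K 0"
  have K: "?K > 0" using pr(1) by (simp add: prime_gt_0_nat)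
  interpret V: form_space "int p" k V b unfolding V_def b_def by (rule std_form_space) simp
  have g: "isom V b V b ?g" unfolding V_def b_def by (rule shift_isom[OF L0])
  have per: "(?g ^^ L) x = x" if "x \<in> V" for x
  proof
    fix i
    have out: "y i = 0" if "y \<in> V" "\<not> i < L" for y using that by (simp add: V_def std_space_def)
    show "(?g ^^ L) x i = x i"
    proof (cases "i < L")
      case True
      then show ?thesis using shift_funpow[OF True, of L x] by simp
    next
      case False
      have "(?g ^^ L) x \<in> V" using isomD(2)[OF isom_funpow[OF g]] that by blast
      then show ?thesis using out False that by metis
    qed
  qed
  have eV: "?e \<in> V" unfolding V_def by (rule std_unit_mem[OF K L0])
  \<comment> \<open>The power shifts the first unit vector by \<open>q ^ (r - 1) < L\<close> places
    to a different one, so the moving part is nonzero.\<close>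
  have "(?g ^^ (q ^ (r - 1))) ?e \<noteq> ?e"
  proof -
    have "q ^ (r - 1) > 0" using q0 by simp
    moreover have "q ^ (r - 1) * 1 < q ^ (r - 1) * q" using q_gt_2 q0 by (intro mult_strict_left_mono) auto
    ultimately have lt: "0 < q ^ (r - 1)" "q ^ (r - 1) < L" using qL by auto
    have "1 < ?K" using p_gt_2 k by (intro one_less_power) auto
    then have "qfrac ?K 1 \<noteq> 0" using qfrac_eq_0_iff[OF K, of 1] zdvd_not_zless[of 1 ?K] by simp
    then have "std_unit ?K (q ^ (r - 1)) 0 \<noteq> std_unit ?K 0 0" using q0 by (simp add: std_unit_def)
    then show ?thesis using shift_funpow_unit[OF lt(2)] by metis
  qed
  then have move: "\<exists>x\<in>V. (?g ^^ (q ^ (r - 1))) x \<noteq> x" using eV by blast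
  obtain W where W: "W \<subseteq> V" "W \<noteq> {0}" "form_space (int p) k W b" "isom W b W b ?g"
    and free: "\<And>x. x \<in> W \<Longrightarrow> (?g ^^ (q ^ (r - 1))) x = x \<Longrightarrow> x = 0"
    by (rule V.moving_part[OF g cop q0 _ move, unfolded qL, OF per], assumption) (rule that)
  \<comment> \<open>A nonzero invariant summand of least cardinality is indecomposable.\<close>
  define S where "S U \<longleftrightarrow> U \<subseteq> W \<and> form_space (int p) k U b \<and> isom U b U b ?g \<and> U \<noteq> {0}" for U
  have "S W" using W by (simp add: S_def)
  then obtain U where U: "S U" and min: "\<And>U'. S U' \<Longrightarrow> card U \<le> card U'"
    using ex_has_least_nat[of S W card] by blast
  have UW: "U \<subseteq> W" "U \<subseteq> V" "isom U b U b ?g" "U \<noteq> {0}" using U W(1) by (auto simp: S_def)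
  interpret U: form_space "int p" k U b using U by (simp add: S_def)
  interpret A: automorphism "int p" k U b ?g L
    using UW(2,3) L0 per by unfold_locales auto
  interpret VA: automorphism "int p" k V b ?g L
    using g L0 per by unfold_locales auto
  obtain us where us: "diag (int p) k b U us" using diag_exists[OF U.form_space_axioms] by blast
  have ind: A.indecomposable
    unfolding A.indecomposable_def
  proof (intro allI impI)
    fix U' assume U': "U' \<subseteq> U" "form_space (int p) k U' b" "isom U' b U' b ?g"
    show "U' = {0} \<or> U' = U"
    proof (cases "U' = {0}")
      case False
      then have "S U'" using U' UW(1) unfolding S_def by blast
      then show ?thesis using min U'(1) U.finite_V card_seteq by metis
    qed simp
  qed
  \<comment> \<open>The unit vectors are the shifts of \<open>?e\<close>, so \<open>?e\<close>
    generates \<open>V\<close>.\<close>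
  have gen: "\<exists>f. x = act ?g f ?e" if "n \<le> L" "x \<in> std_space n ?K" for n x
    using that
  proof (induct n arbitrary: x)
    case 0
    then have "x = 0" by (auto simp: std_space_def)
    then show ?case by (intro exI[of _ 0]) simp
  next
    case (Suc n)
    obtain c where c: "x n = qfrac ?K c" using qfrac_exists[OF K std_space_torsion[OF Suc(3)]] by blast
    have "x(n := 0) \<in> std_space n ?K" using Suc(3) by (auto simp: std_space_def)
    then obtain f where f: "x(n := 0) = act ?g f ?e" using Suc by auto
    have "act ?g (f + smult c ([:0, 1:] ^ n)) ?e = x(n := 0) + c *z std_unit ?K n"
      using eV Suc(2) shift_funpow_unit[of n L ?K]
      by (simp add: V.act_add[OF g] V.act_smult[OF g] V.act_X_power[OF g] f)
    also have "\<dots> = x" using c by (auto simp: zscale_fun_apply zscale_qfrac std_unit_def)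
    finally show ?case by metis
  qed
  \<comment> \<open>The projection of a generator of \<open>V\<close> generates \<open>U\<close>:
    polynomials in the shift preserve \<open>U\<close> and, through their adjoints, also its
    complement.\<close>
  obtain v where v: "v \<in> U" "\<forall>y\<in>U. b (?e - v) y = 0"
    using V.subspace_projection[OF us U.bform_axioms UW(2) eV] by blast
  have vV: "v \<in> V" "?e - v \<in> V" using v UW(2) eV V.closed by auto
  have cyc: "\<exists>f. x = act ?g f v" if x: "x \<in> U" for x
  proof -
    obtain f where f: "x = act ?g f ?e" using gen[of L x] x UW(2) by (auto simp: V_def)
    have "act ?g f (v + (?e - v)) = act ?g f v + act ?g f (?e - v)" using vV by (rule V.act_vector_add[OF g])
    then have eq: "x - act ?g f v = act ?g f (?e - v)" using f by simp
    have av: "act ?g f v \<in> U" using U.act_V[OF UW(3)] v by blast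
    have "x - act ?g f v = 0"
    proof (rule U.nondeg)
      fix y assume y: "y \<in> U"
      have "b (act ?g f (?e - v)) y = b (?e - v) (act VA.gi f y)"
        using vV y UW(2) by (intro VA.act_adjoint) auto
      moreover have "act VA.gi f y \<in> U"
        using U.act_V[OF A.gi] y unfolding A.gi_def VA.gi_def by blast
      ultimately show "b (x - act ?g f v) y = 0" unfolding eq using v by simp
    qed (use x av in \<open>simp add: U.closed\<close>)
    then show ?thesis by (intro exI[of _ f]) simp
  qed
  \<comment> \<open>The orbit count gives \<open>M \<le> N\<close>, and \<open>rank_bound\<close>
    gives \<open>N \<le> M\<close>. Equality then determines the sign.\<close>
  obtain N where N: "length us = 2 * N"
      "int (q ^ Suc (r - 1)) dvd int p ^ N - chi (- 1) ^ N * chi (prod_list us)"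
    by (rule U.free_automorphism[OF us UW(3) qr cop, of r "r - 1"])
      (use per UW free in \<open>auto simp: L_def\<close>)
  let ?e' = "chi (- 1) ^ N * chi (prod_list us)"
  have dv: "int (q ^ r) dvd int p ^ N - ?e'" using N(2) r by simp
  have e': "?e' = 1 \<or> ?e' = - 1" using chi_disc_unit[OF diag_units[OF us]] .
  have "N > 0"
  proof (rule ccontr)
    assume "\<not> N > 0"
    then have "us = []" using N by simp
    then show False using us UW(4) by (auto elim: diag_NilE)
  qed
  note bound = exponent_lower_bound[OF dv e' this r]
  have "M \<le> N" using bound(1,3) unfolding M_def by (metis dvd_mult_div_cancel mult_le_mono2)
  moreover have "length us \<le> 2 * M"
  proof (rule A.rank_bound[OF refl M0 _ ind UW(4) v(1) cyc us])
    have att: "int L dvd int p ^ M - \<eta>" unfolding L_def M_def by (rule exponent_attained)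
    \<comment> \<open>The value of \<eta> decides between the two alternatives, the second meaning
      -1 modulo \<open>L\<close>.\<close>
    show "[nat (int p) ^ M = 1] (mod L) \<or> [nat (int p) ^ M = L - 1] (mod L)"
    proof (cases "\<eta> = 1")
      case True
      then have "[int (p ^ M) = int 1] (mod int L)" using att by (simp add: cong_iff_dvd_diff)
      then have "[p ^ M = 1] (mod L)" by (simp only: cong_int_iff)
      then show ?thesis unfolding nat_int by (rule disjI1)
    next
      case False
      then have "\<eta> = - 1" using eta_values by blast
      then have "int L dvd int p ^ M + 1" using att by simp
      then have "int L dvd (int p ^ M + 1) - int L" by (rule dvd_diff) simp
      moreover have "(int p ^ M + 1) - int L = int (p ^ M) - int (L - 1)" using L0 by (simp add: of_nat_diff)
      ultimately have "[int (p ^ M) = int (L - 1)] (mod int L)" by (simp only: cong_iff_dvd_diff)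
      then have "[p ^ M = L - 1] (mod L)" by (simp only: cong_int_iff)
      then show ?thesis unfolding nat_int by (rule disjI2)
    qed
  qed
  ultimately have NM: "N = M" using N(1) by simp
  have "N div m = q ^ (r - s)" unfolding NM M_def using min_exp(1) by simp
  then have "?e' = \<eta> ^ (q ^ (r - s))" using bound(2) by simp
  also have "\<dots> = \<eta>" using eta_values qr(2) by auto
  finally have sign: "chi (- 1) ^ M * chi (prod_list us) = \<eta>" unfolding NM .
  show ?thesis
  proof (rule that[OF U.form_space_axioms UW(3) _ _ us])
    show "(?g ^^ (q ^ r)) x = x" if "x \<in> U" for x using per that UW(2) unfolding L_def by blast
    show "x = 0" if "x \<in> U" "(?g ^^ (q ^ (r - 1))) x = x" for x using free that UW(1) by blast
    show "length us = 2 * (m * q ^ (r - s))" using N(1) unfolding NM M_def .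
    show "chi (- 1) ^ (m * q ^ (r - s)) * chi (prod_list us) = \<eta>" using sign unfolding M_def .
  qed
qed


section \<open>Orthogonal sums and the theorem for form spaces\<close>

text \<open>Complements of \<open>l\<close> successive vectors of unit norm. All norms are squares
  except possibly the last, which corrects the class. The rank is at least 2 whenever a vector is
  chosen, so every unit is available as a norm.\<close>

lemma (in odd_prime_power) subspace_exists:
  assumes "form_space p k V b" "diag p k b V us" "l < length us" "l > 0" "e = 1 \<or> e = - 1"
  shows "\<exists>W ws. form_space p k W b \<and> diag p k b W ws \<and> length ws = length us - l \<and> chi (prod_list ws) = e"
  using assms
proof (induction l arbitrary: V us)
  case (Suc l)
  interpret V: form_space p k V b by fact
  obtain u w us' where us: "us = u # w # us'"
    using Suc.prems(3) by (metis Suc_length_conv less_Suc_eq_0_disj less_nat_zero_code list.size(3) neq_Nil_conv length_Cons Suc_less_eq)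
  have unit: "chi (prod_list us) = 1 \<or> chi (prod_list us) = - 1"
    using chi_disc_unit[OF diag_units[OF Suc.prems(2)], of 0] by simp
  obtain c where c: "coprime c p" "chi c = (if l = 0 then chi (prod_list us) * e else 1)"
  proof -
    have "(if l = 0 then chi (prod_list us) * e else 1) = 1 \<or> (if l = 0 then chi (prod_list us) * e else 1) = - 1"
      using unit Suc.prems(5) by auto
    then show ?thesis using that[of 1] that exists_nonresidue by fastforce
  qed
  obtain v where v: "v \<in> V" "b v v = V.fr c"
    using V.unit_norm_vector[OF Suc.prems(2)[unfolded us] c(1)] by blast
  have fs: "form_space p k (perp b V v) b" by (rule V.perp_form_space[OF v c(1)])
  obtain ws where ws: "diag p k b (perp b V v) ws" using diag_exists[OF fs] by blast
  have "diag p k b V (c # ws)" by (rule diag_Cons[where b = b, OF v c(1) ws])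
  note uniq = V.diag_unique[OF Suc.prems(2) this]
  have len: "length us = Suc (length ws)" using uniq(1) by simp
  have chi: "chi (prod_list us) = chi c * chi (prod_list ws)" using uniq(2) by (simp add: chi_mult)
  show ?case
  proof (cases "l = 0")
    case True
    have "chi (prod_list ws) = e" using chi c(2) unit True Suc.prems(5) by auto
    then show ?thesis using fs ws len True by (intro exI[of _ "perp b V v"] exI[of _ ws]) simp
  next
    case False
    then have "\<exists>W ws'. form_space p k W b \<and> diag p k b W ws' \<and> length ws' = length ws - l \<and> chi (prod_list ws') = e"
      using Suc.prems(3,5) len by (intro Suc.IH[OF fs ws]) auto
    then show ?thesis using len by simp
  qed
qed simp

definition prod_form :: "('v \<Rightarrow> 'v \<Rightarrow> qz) \<Rightarrow> ('w \<Rightarrow> 'w \<Rightarrow> qz) \<Rightarrow> 'v \<times> 'w \<Rightarrow> 'v \<times> 'w \<Rightarrow> qz" where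
  "prod_form b c x y = b (fst x) (fst y) + c (snd x) (snd y)"

lemma prod_form_space:
  assumes "form_space p k V b" "form_space p k W c"
  shows "form_space p k (V \<times> W) (prod_form b c)"
proof -
  interpret V: form_space p k V b by fact
  interpret W: form_space p k W c by fact
  have l: "prod_form b c x (y, 0) = b (fst x) y" if "x \<in> V \<times> W" "y \<in> V" for x y
    using that W.b_zero_right by (auto simp: prod_form_def)
  have r: "prod_form b c x (0, y) = c (snd x) y" if "x \<in> V \<times> W" "y \<in> W" for x y
    using that V.b_zero_right by (auto simp: prod_form_def)
  show ?thesis
  proof
    show "finite (V \<times> W)" using V.finite_V W.finite_V by simp
    show "0 \<in> V \<times> W" by (simp add: zero_prod_def)
    show "x + y \<in> V \<times> W" if "x \<in> V \<times> W" "y \<in> V \<times> W" for x y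
      using that V.add_V W.add_V by auto
    show "p ^ k *z x = 0" if "x \<in> V \<times> W" for x
      using that V.torsion W.torsion by (cases x) (auto simp: zscale_Pair zero_prod_def)
    show "prod_form b c (x + y) z = prod_form b c x z + prod_form b c y z"
      if "x \<in> V \<times> W" "y \<in> V \<times> W" "z \<in> V \<times> W" for x y z
      using that V.b_add_left W.b_add_left by (auto simp: prod_form_def mem_Times_iff)
    show "prod_form b c x y = prod_form b c y x" if "x \<in> V \<times> W" "y \<in> V \<times> W" for x y
      using that V.b_sym[of "fst x" "fst y"] W.b_sym[of "snd x" "snd y"] by (simp add: prod_form_def mem_Times_iff)
    show "x = 0" if x: "x \<in> V \<times> W" and *: "\<And>y. y \<in> V \<times> W \<Longrightarrow> prod_form b c x y = 0" for x
    proof -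
      have "fst x = 0" using x *[of "(_, 0)"] l by (intro V.nondeg) (auto simp: mem_Times_iff)
      moreover have "snd x = 0" using x *[of "(0, _)"] r by (intro W.nondeg) (auto simp: mem_Times_iff)
      ultimately show ?thesis by (simp add: prod_eq_iff)
    qed
    show "\<exists>y\<in>V \<times> W. x = p *z y"
      if x: "x \<in> V \<times> W" and *: "\<And>y. y \<in> V \<times> W \<Longrightarrow> (p ^ (k - 1)) *z prod_form b c x y = 0" for x
    proof -
      have "\<exists>y\<in>V. fst x = p *z y"
      proof (rule V.p_divisible)
        show "(p ^ (k - 1)) *z b (fst x) y = 0" if "y \<in> V" for y
          using *[of "(y, 0)"] l[OF x that] that by simp
      qed (use x in auto)
      then obtain y where y: "y \<in> V" "fst x = p *z y" by blast
      have "\<exists>y\<in>W. snd x = p *z y"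
      proof (rule W.p_divisible)
        show "(p ^ (k - 1)) *z c (snd x) y = 0" if "y \<in> W" for y
          using *[of "(0, y)"] r[OF x that] that by simp
      qed (use x in auto)
      then obtain z where z: "z \<in> W" "snd x = p *z z" by blast
      have "x = p *z (y, z)" using y z by (simp add: zscale_Pair prod_eq_iff)
      then show ?thesis using y z by blast
    qed
  qed
qed

lemma prod_diag:
  assumes "diag p k b V us" "bform p k V b" "diag p k c W ws" "bform p k W c"
  shows "diag p k (prod_form b c) (V \<times> W) (us @ ws)"
  using assms
proof (induction rule: diag.induct)
  case diag_Nil
  then interpret V: bform p k "{0}" b by blast
  have b0: "b 0 0 = 0" by (rule V.b_zero_left) simp
  from diag_Nil(2,3) show ?case
  proof (induction rule: diag.induct)
    case diag_Nil
    have "{0} \<times> {0} = {0 :: 'a \<times> 'b}" by (simp add: zero_prod_def)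
    then show ?case using diag.diag_Nil by simp
  next
    case (diag_Cons w W u ws)
    interpret W: bform p k W c by fact
    have "perp (prod_form b c) ({0} \<times> W) (0, w) = {0} \<times> perp c W w"
      using b0 by (auto simp: perp_def prod_form_def)
    then have "diag p k (prod_form b c) (perp (prod_form b c) ({0} \<times> W) (0, w)) ([] @ ws)"
      using diag_Cons.IH W.perp_bform[OF diag_Cons.hyps(1)] by simp
    moreover have "prod_form b c (0, w) (0, w) = qfrac (p ^ k) u" using diag_Cons.hyps(2) b0 by (simp add: prod_form_def)
    ultimately show ?case
      using diag.diag_Cons[where b = "prod_form b c" and v = "(0, w)" and V = "{0} \<times> W"] diag_Cons.hyps by simp
  qed
next
  case (diag_Cons v V u us)
  interpret V: bform p k V b by fact
  interpret W: bform p k W c by fact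
  have "perp (prod_form b c) (V \<times> W) (v, 0) = perp b V v \<times> W"
    using W.b_zero_right by (auto simp: perp_def prod_form_def)
  then have "diag p k (prod_form b c) (perp (prod_form b c) (V \<times> W) (v, 0)) (us @ ws)"
    using diag_Cons.IH[OF V.perp_bform[OF diag_Cons.hyps(1)]] diag_Cons.prems by simp
  moreover have "prod_form b c (v, 0) (v, 0) = qfrac (p ^ k) u" using diag_Cons.hyps(2) W.b_zero_left by (simp add: prod_form_def)
  ultimately show ?case
    using diag.diag_Cons[where b = "prod_form b c" and v = "(v, 0)" and V = "V \<times> W"] diag_Cons.hyps by simp
qed

lemma prod_isom:
  assumes "isom V b V b g" "isom W c W c h"
  shows "isom (V \<times> W) (prod_form b c) (V \<times> W) (prod_form b c) (map_prod g h)"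
  unfolding isom_def
proof (intro conjI ballI)
  show "bij_betw (map_prod g h) (V \<times> W) (V \<times> W)"
    by (rule bij_betw_map_prod[OF isomD(1)[OF assms(1)] isomD(1)[OF assms(2)]])
  fix x y assume "x \<in> V \<times> W" "y \<in> V \<times> W"
  then show "map_prod g h (x + y) = map_prod g h x + map_prod g h y"
    "prod_form b c (map_prod g h x) (map_prod g h y) = prod_form b c x y"
    using isomD(3,4)[OF assms(1)] isomD(3,4)[OF assms(2)] by (auto simp: prod_form_def)
qed

lemma map_prod_funpow:
  fixes g :: "'a \<Rightarrow> 'a" and h :: "'b \<Rightarrow> 'b"
  shows "(map_prod g h ^^ n) (x, y) = ((g ^^ n) x, (h ^^ n) y)"
  by (induct n) auto

section \<open>Isometries of order q^r on form spaces\<close>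

context two_odd_primes
begin

text \<open>For \<open>r > 0\<close> this is exact order \<open>q ^ r\<close>: the order divides
  \<open>q ^ r\<close> but not \<open>q ^ (r - 1)\<close>.\<close>

definition order_auto :: "'v::ab_group_add set \<Rightarrow> ('v \<Rightarrow> 'v \<Rightarrow> qz) \<Rightarrow> ('v \<Rightarrow> 'v) \<Rightarrow> nat \<Rightarrow> bool" where
  "order_auto V b g r \<longleftrightarrow> isom V b V b g \<and> (\<forall>x\<in>V. (g ^^ (q ^ r)) x = x) \<and> (\<exists>x\<in>V. (g ^^ (q ^ (r - 1))) x \<noteq> x)"

definition fixed_point_free :: "'v::ab_group_add set \<Rightarrow> ('v \<Rightarrow> 'v) \<Rightarrow> bool" where
  "fixed_point_free V g \<longleftrightarrow> (\<forall>x\<in>V. g x = x \<longrightarrow> x = 0)"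

lemma order_auto_transport:
  assumes V: "form_space P k V b" and f: "isom V b W c f" and g: "order_auto V b g r"
  obtains g' where "order_auto W c g' r" "fixed_point_free V g \<Longrightarrow> fixed_point_free W g'"
proof -
  interpret form_space P k V b by fact
  define g' where "g' = f \<circ> (g \<circ> inv_into V f)"
  have gV: "isom V b V b g" using g by (simp add: order_auto_def)
  have inv: "isom W c V b (inv_into V f)" by (rule isom_inv[OF f add_V])
  have iso: "isom W c W c g'" unfolding g'_def by (intro isom_comp[OF isom_comp[OF inv gV] f])
  have fx: "inv_into V f (f x) = x" if "x \<in> V" for x using isomD(1)[OF f] that by (simp add: bij_betw_def)
  have g'f: "(g' ^^ i) (f x) = f ((g ^^ i) x)" if "x \<in> V" for x i
  proof (induct i)
    case (Suc i)
    have "(g ^^ i) x \<in> V" using isomD(2)[OF isom_funpow[OF gV]] that by blast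
    then show ?case using Suc fx by (simp add: g'_def)
  qed simp
  have surj: "\<exists>x\<in>V. y = f x" if "y \<in> W" for y using isomD(1)[OF f] that by (auto simp: bij_betw_def)
  have inj: "f x = f y \<longleftrightarrow> x = y" if "x \<in> V" "y \<in> V" for x y
    using fx that by metis
  have gi: "(g ^^ i) x \<in> V" if "x \<in> V" for i x using isomD(2)[OF isom_funpow[OF gV]] that by blast
  have "(g' ^^ (q ^ r)) y = y" if y: "y \<in> W" for y
  proof -
    obtain x where x: "x \<in> V" "y = f x" using surj[OF y] by blast
    then show ?thesis using g g'f by (simp add: order_auto_def)
  qed
  moreover have "\<exists>y\<in>W. (g' ^^ (q ^ (r - 1))) y \<noteq> y"
  proof -
    obtain x where x: "x \<in> V" "(g ^^ (q ^ (r - 1))) x \<noteq> x" using g by (auto simp: order_auto_def)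
    then have "(g' ^^ (q ^ (r - 1))) (f x) \<noteq> f x" using g'f inj gi by simp
    then show ?thesis using isomD(2)[OF f] x by blast
  qed
  ultimately have "order_auto W c g' r" using iso by (simp add: order_auto_def)
  moreover have "fixed_point_free W g'" if "fixed_point_free V g"
    unfolding fixed_point_free_def
  proof (intro ballI impI)
    fix y assume y: "y \<in> W" "g' y = y"
    obtain x where x: "x \<in> V" "y = f x" using surj[OF y(1)] by blast
    have "f (g x) = f x" using g'f[of x 1] x y by simp
    then have "g x = x" using inj[of "g x" x] gi[of x 1] x by simp
    then have "x = 0" using that x by (simp add: fixed_point_free_def)
    then show "y = 0" using x isom_zero[OF f] by simp
  qed
  ultimately show ?thesis using that by blast
qed

context
  fixes k r :: nat
  assumes k: "k > 0" and r: "r > 0"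
begin

interpretation odd_prime_power "int p" k
  using pr k by unfold_locales auto

abbreviation "disc_sign us \<equiv> chi (- 1) ^ (length us div 2) * chi (prod_list us)"

lemma coprime_q_p: "coprime (int q) (int p)"
  using pr(1) qr(1) pq by (simp add: primes_coprime)

lemma necessary_rank:
  assumes V: "form_space (int p) k V b" and d: "diag (int p) k b V us" and g: "order_auto V b g r"
  shows "2 * (m * q ^ (r - s)) \<le> length us"
    "length us = 2 * (m * q ^ (r - s)) \<Longrightarrow> disc_sign us = \<eta>"
proof -
  interpret form_space "int p" k V b by fact
  obtain N e where N: "N > 0" "e = 1 \<or> e = - 1" "int (q ^ r) dvd int p ^ N - e" "2 * N \<le> length us"
    "2 * N = length us \<Longrightarrow> e = chi (- 1) ^ N * chi (prod_list us)"
    by (rule automorphism_order_bound[OF d _ qr coprime_q_p r]) (use g in \<open>auto simp: order_auto_def\<close>)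
  note bound = exponent_lower_bound[OF N(3,2,1) r]
  have MN: "m * q ^ (r - s) \<le> N" using bound(1,3) by (metis dvd_mult_div_cancel mult_le_mono2)
  then show "2 * (m * q ^ (r - s)) \<le> length us" using N(4) by linarith
  assume len: "length us = 2 * (m * q ^ (r - s))"
  then have NM: "N = m * q ^ (r - s)" using MN N(4) by linarith
  then have "N div m = q ^ (r - s)" using min_exp(1) by simp
  then have "e = \<eta> ^ (q ^ (r - s))" using bound(2) by simp
  also have "\<dots> = \<eta>" using eta_values qr(2) by auto
  finally show "disc_sign us = \<eta>" using N(5) len NM by simp
qed

text \<open>That \<open>g\<close> itself fixes only 0 gives divisibility by \<open>q\<close>, which
  already determines the shape \<open>2 * m * d\<close> and the sign; the bound on \<open>d\<close>
  comes from the order, through \<open>necessary_rank\<close>.\<close>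

lemma necessary_fixed_point_free:
  assumes V: "form_space (int p) k V b" and d: "diag (int p) k b V us" and g: "order_auto V b g r"
    and free: "fixed_point_free V g"
  obtains d where "length us = 2 * m * d" "q ^ (r - s) \<le> d" "disc_sign us = \<eta> ^ d"
proof -
  interpret form_space "int p" k V b by fact
  obtain N where N: "length us = 2 * N" "int (q ^ Suc 0) dvd int p ^ N - chi (- 1) ^ N * chi (prod_list us)"
    by (rule free_automorphism[OF d _ qr coprime_q_p, of g r 0])
      (use g free in \<open>auto simp: order_auto_def fixed_point_free_def\<close>)
  have e: "chi (- 1) ^ N * chi (prod_list us) = 1 \<or> chi (- 1) ^ N * chi (prod_list us) = - 1"
    using chi_disc_unit[OF diag_units[OF d]] .
  have "int q dvd int p ^ N - chi (- 1) ^ N * chi (prod_list us)" using N(2) by simp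
  note se = sign_exponent[OF this e]
  have Nm: "N = m * (N div m)" using se(1) by simp
  have "m * q ^ (r - s) \<le> m * (N div m)" using necessary_rank(1)[OF V d g] N(1) Nm by linarith
  then have "q ^ (r - s) \<le> N div m" using min_exp(1) by simp
  moreover have "length us = 2 * m * (N div m)" using N(1) Nm by (metis mult.assoc)
  moreover have "disc_sign us = \<eta> ^ (N div m)" using se(2) N(1) by simp
  ultimately show ?thesis using that by blast
qed

text \<open>By the classification \<open>V\<close> is isometric to the orthogonal sum of
  \<open>U\<close> and \<open>W\<close>, and the sum of the two automorphisms is transported along
  that isometry.\<close>

lemma sum_auto:
  fixes V :: "'v::ab_group_add set" and U :: "'u::ab_group_add set"
  assumes V: "form_space (int p) k V b" and dV: "diag (int p) k b V us"
    and U: "form_space (int p) k U c" and dU: "diag (int p) k c U us'"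
    and W: "form_space (int p) k W d" and dW: "diag (int p) k d W ws"
    and len: "length us = length us' + length ws"
    and chi: "chi (prod_list us) = chi (prod_list us') * chi (prod_list ws)"
    and g: "isom U c U c g" "\<And>x. x \<in> U \<Longrightarrow> (g ^^ (q ^ r)) x = x"
    and h: "isom W d W d h" "\<And>x. x \<in> W \<Longrightarrow> (h ^^ (q ^ r)) x = x"
    and move: "(\<exists>x\<in>U. (g ^^ (q ^ (r - 1))) x \<noteq> x) \<or> (\<exists>x\<in>W. (h ^^ (q ^ (r - 1))) x \<noteq> x)"
  obtains g' where "order_auto V b g' r"
    "fixed_point_free U g \<Longrightarrow> fixed_point_free W h \<Longrightarrow> fixed_point_free V g'"
proof -
  interpret U: form_space "int p" k U c by fact
  interpret W: form_space "int p" k W d by fact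
  have X: "form_space (int p) k (U \<times> W) (prod_form c d)" by (rule prod_form_space[OF U W])
  have dX: "diag (int p) k (prod_form c d) (U \<times> W) (us' @ ws)"
    by (rule prod_diag[OF dU U.bform_axioms dW W.bform_axioms])
  obtain f where f: "isom (U \<times> W) (prod_form c d) V b f"
    using isom_exists[OF X V dX dV] len chi by (auto simp: chi_mult)
  have "\<exists>x\<in>U \<times> W. (map_prod g h ^^ (q ^ (r - 1))) x \<noteq> x"
    using move
  proof
    assume "\<exists>x\<in>U. (g ^^ (q ^ (r - 1))) x \<noteq> x"
    then obtain x where "x \<in> U" "(g ^^ (q ^ (r - 1))) x \<noteq> x" by blast
    then show ?thesis by (intro bexI[of _ "(x, 0)"]) (auto simp: map_prod_funpow)
  next
    assume "\<exists>x\<in>W. (h ^^ (q ^ (r - 1))) x \<noteq> x"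
    then obtain x where "x \<in> W" "(h ^^ (q ^ (r - 1))) x \<noteq> x" by blast
    then show ?thesis by (intro bexI[of _ "(0, x)"]) (auto simp: map_prod_funpow)
  qed
  then have "order_auto (U \<times> W) (prod_form c d) (map_prod g h) r"
    using prod_isom[OF g(1) h(1)] g(2) h(2) by (auto simp: order_auto_def map_prod_funpow)
  from order_auto_transport[OF X f this] obtain g' where g': "order_auto V b g' r"
    "fixed_point_free (U \<times> W) (map_prod g h) \<Longrightarrow> fixed_point_free V g'" by blast
  moreover have "fixed_point_free (U \<times> W) (map_prod g h)" if "fixed_point_free U g" "fixed_point_free W h"
    using that by (auto simp: fixed_point_free_def zero_prod_def)
  ultimately show ?thesis using that by blast
qed

lemma fixed_point_free_powI:
  assumes "\<And>x. x \<in> V \<Longrightarrow> (g ^^ i) x = x \<Longrightarrow> x = 0"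
  shows "fixed_point_free V g"
  unfolding fixed_point_free_def
proof (intro ballI impI)
  fix x assume x: "x \<in> V" "g x = x"
  have "(g ^^ i) x = x" using x(2) by (induct i) auto
  then show "x = 0" using assms x by blast
qed

text \<open>A block plus the identity. Because at least one dimension is left over, the second
  summand can have either class and so compensate the class of the block.\<close>

lemma sufficient_rank:
  assumes V: "form_space (int p) k V b" and d: "diag (int p) k b V us"
    and len: "2 * (m * q ^ (r - s)) + 1 \<le> length us"
  shows "\<exists>g. order_auto V b g r"
proof -
  let ?M = "m * q ^ (r - s)"
  obtain U c and g :: "(nat \<Rightarrow> qz) \<Rightarrow> nat \<Rightarrow> qz" and us' where U:
    "form_space (int p) k U c" "isom U c U c g" "\<And>x. x \<in> U \<Longrightarrow> (g ^^ (q ^ r)) x = x"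
    "\<And>x. x \<in> U \<Longrightarrow> (g ^^ (q ^ (r - 1))) x = x \<Longrightarrow> x = 0" "diag (int p) k c U us'"
    "length us' = 2 * ?M" "chi (- 1) ^ ?M * chi (prod_list us') = \<eta>"
    by (rule exists_block[OF k r]) (rule that)
  interpret U: form_space "int p" k U c by fact
  have M0: "?M > 0" using min_exp(1) q_gt_2 by simp
  have cU: "chi (prod_list us') = 1 \<or> chi (prod_list us') = - 1"
    using chi_disc_unit[OF diag_units[OF U(5)], of 0] by simp
  have cV: "chi (prod_list us) = 1 \<or> chi (prod_list us) = - 1"
    using chi_disc_unit[OF diag_units[OF d], of 0] by simp
  obtain W ws where W: "form_space (int p) k W b" "diag (int p) k b W ws" "length ws = length us - 2 * ?M"
    "chi (prod_list ws) = chi (prod_list us') * chi (prod_list us)"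
    using subspace_exists[OF V d, of "2 * ?M" "chi (prod_list us') * chi (prod_list us)"] len M0 cU cV by auto
  have "U \<noteq> {0}"
  proof
    assume "U = {0}"
    then have "int (card U) = 1" by simp
    then have "int p ^ (k * length us') = 1" using diag_card[OF U(5) U.bform_axioms] by simp
    moreover have "length us' > 0" using U(6) M0 by linarith
    then have "1 < int p ^ (k * length us')" using p_gt_2 k by (intro one_less_power) auto
    ultimately show False by linarith
  qed
  then obtain x where "x \<in> U" "x \<noteq> 0" using U.zero_V by blast
  then have move: "\<exists>x\<in>U. (g ^^ (q ^ (r - 1))) x \<noteq> x" using U(4) by blast
  obtain g' where "order_auto V b g' r"
  proof (rule sum_auto[OF V d U(1,5) W(1,2) _ _ U(2,3) isom_id])
    show "length us = length us' + length ws" using U(6) W(3) len by simp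
    show "chi (prod_list us) = chi (prod_list us') * chi (prod_list ws)" using W(4) cU by auto
    have "((\<lambda>x. x) ^^ i) x = x" for i and x :: 'a by (induct i) auto
    then show "((\<lambda>x. x) ^^ (q ^ r)) x = x" for x :: 'a .
  qed (use move in auto)
  then show ?thesis by blast
qed

text \<open>One block of order \<open>q ^ r\<close> accounts for \<open>d = q ^ (r - s)\<close>;
  each further block of order \<open>q\<close> adds \<open>2 * m\<close> to the rank and a factor
  \<eta> to the sign.\<close>

lemma sufficient_fixed_point_free:
  assumes "form_space (int p) k V b" "diag (int p) k b V us" "length us = 2 * m * d" "q ^ (r - s) \<le> d"
    "disc_sign us = \<eta> ^ d"
  shows "\<exists>g. order_auto V b g r \<and> fixed_point_free V g"
  using assms(4,1-3,5)
proof (induction d arbitrary: V us rule: dec_induct)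
  case base
  let ?M = "m * q ^ (r - s)"
  obtain U c and g :: "(nat \<Rightarrow> qz) \<Rightarrow> nat \<Rightarrow> qz" and us' where U:
    "form_space (int p) k U c" "isom U c U c g" "\<And>x. x \<in> U \<Longrightarrow> (g ^^ (q ^ r)) x = x"
    "\<And>x. x \<in> U \<Longrightarrow> (g ^^ (q ^ (r - 1))) x = x \<Longrightarrow> x = 0" "diag (int p) k c U us'"
    "length us' = 2 * ?M" "chi (- 1) ^ ?M * chi (prod_list us') = \<eta>"
    by (rule exists_block[OF k r]) (rule that)
  interpret U: form_space "int p" k U c by fact
  have M0: "?M > 0" using min_exp(1) q_gt_2 by simp
  have "U \<noteq> {0}"
  proof
    assume "U = {0}"
    then have "int (card U) = 1" by simp
    then have "int p ^ (k * length us') = 1" using diag_card[OF U(5) U.bform_axioms] by simp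
    moreover have "length us' > 0" using U(6) M0 by linarith
    then have "1 < int p ^ (k * length us')" using p_gt_2 k by (intro one_less_power) auto
    ultimately show False by linarith
  qed
  then obtain x where "x \<in> U" "x \<noteq> 0" using U.zero_V by blast
  then have "order_auto U c g r" using U unfolding order_auto_def by blast
  moreover have "fixed_point_free U g" using U(4) by (rule fixed_point_free_powI)
  moreover have "\<eta> ^ (q ^ (r - s)) = \<eta>" using eta_values qr(2) by auto
  then have "chi (- 1) ^ ?M * chi (prod_list us) = chi (- 1) ^ ?M * chi (prod_list us')"
    using base U(7) by (simp add: mult.assoc)
  then have "chi (prod_list us') = chi (prod_list us)" using chi_unit[of "- 1"] by auto
  then obtain f where "isom U c V b f" using isom_exists[OF U(1) base(1) U(5) base(2)] base(3) U(6) by (auto simp: mult.assoc)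
  ultimately show ?case using order_auto_transport[OF U(1)] by metis
next
  case (step d)
  \<comment> \<open>For order \<open>q\<close> the truncated exponent is 0, so the additional block
    has rank \<open>2 * m\<close>.\<close>
  have s1: "(1::nat) - s = 0" using base_exact(1) by simp
  have one: "0 < (1::nat)" by simp
  obtain U c and g :: "(nat \<Rightarrow> qz) \<Rightarrow> nat \<Rightarrow> qz" and us' where U:
    "form_space (int p) k U c" "isom U c U c g" "\<And>x. x \<in> U \<Longrightarrow> (g ^^ (q ^ 1)) x = x"
    "\<And>x. x \<in> U \<Longrightarrow> (g ^^ (q ^ (1 - 1))) x = x \<Longrightarrow> x = 0" "diag (int p) k c U us'"
    "length us' = 2 * (m * q ^ (1 - s))" "chi (- 1) ^ (m * q ^ (1 - s)) * chi (prod_list us') = \<eta>"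
    by (rule exists_block[OF k one]) (rule that)
  have U6: "length us' = 2 * m" and U7: "chi (- 1) ^ m * chi (prod_list us') = \<eta>" using U(6,7) s1 by simp_all
  have perU: "(g ^^ (q ^ r)) x = x" if "x \<in> U" for x
  proof -
    have "q ^ r = q * q ^ (r - 1)" using r by (cases r) auto
    then have "(g ^^ (q ^ r)) x = ((g ^^ q) ^^ (q ^ (r - 1))) x" by (simp add: funpow_mult)
    moreover have "((g ^^ q) ^^ i) x = x" for i using U(3)[OF that] by (induct i) auto
    ultimately show ?thesis by simp
  qed
  have d0: "d > 0" using step(1) q_gt_2 by (metis gr0I le_zero_eq not_less_zero power_not_zero)
  have cU: "chi (prod_list us') = 1 \<or> chi (prod_list us') = - 1"
    using chi_disc_unit[OF diag_units[OF U(5)], of 0] by simp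
  have cV: "chi (prod_list us) = 1 \<or> chi (prod_list us) = - 1"
    using chi_disc_unit[OF diag_units[OF step(5)], of 0] by simp
  have len: "length us = 2 * m + 2 * m * d" using step(6) by simp
  obtain W ws where W: "form_space (int p) k W b" "diag (int p) k b W ws" "length ws = length us - 2 * m"
    "chi (prod_list ws) = chi (prod_list us') * chi (prod_list us)"
    using subspace_exists[OF step(4,5), of "2 * m" "chi (prod_list us') * chi (prod_list us)"] len min_exp(1) d0 cU cV
    by auto
  have lenW: "length ws = 2 * m * d" using W(3) len by simp
  \<comment> \<open>The class of \<open>W\<close> was chosen so that the discriminants multiply;
    cancelling \<eta> gives the hypothesis of the induction for \<open>W\<close>.\<close>
  have "chi (- 1) ^ (m + m * d) * chi (prod_list us) = \<eta> * \<eta> ^ d" using step(7) step(6) by simp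
  also have "chi (- 1) ^ (m + m * d) * chi (prod_list us) =
      (chi (- 1) ^ m * chi (prod_list us')) * (chi (- 1) ^ (m * d) * chi (prod_list ws))"
    using cU W(4) by (auto simp: power_add)
  finally have "\<eta> * (chi (- 1) ^ (m * d) * chi (prod_list ws)) = \<eta> * \<eta> ^ d" unfolding U7 .
  then have "chi (- 1) ^ (m * d) * chi (prod_list ws) = \<eta> ^ d" using eta_values by auto
  then have "disc_sign ws = \<eta> ^ d" using lenW by simp
  then obtain h where h: "order_auto W b h r" "fixed_point_free W h" using step.IH[OF W(1,2) lenW] by blast
  obtain g' where "order_auto V b g' r" "fixed_point_free U g \<Longrightarrow> fixed_point_free W h \<Longrightarrow> fixed_point_free V g'"
  proof (rule sum_auto[OF step(4,5) U(1,5) W(1,2) _ _ U(2) perU])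
    show "length us = length us' + length ws" using U6 lenW len by simp
    show "chi (prod_list us) = chi (prod_list us') * chi (prod_list ws)" using W(4) cU by auto
    show "isom W b W b h" "\<And>x. x \<in> W \<Longrightarrow> (h ^^ (q ^ r)) x = x" using h(1) by (auto simp: order_auto_def)
    show "(\<exists>x\<in>U. (g ^^ (q ^ (r - 1))) x \<noteq> x) \<or> (\<exists>x\<in>W. (h ^^ (q ^ (r - 1))) x \<noteq> x)"
      using h(1) by (auto simp: order_auto_def)
  qed (assumption, rule that)
  moreover have "fixed_point_free U g" using U(4) by (rule fixed_point_free_powI)
  ultimately show ?case using h(2) by blast
qed

theorem order_auto_iff:
  assumes "form_space (int p) k V b" "diag (int p) k b V us"
  shows "(\<exists>g. order_auto V b g r) \<longleftrightarrow> length us \<ge> 2 * m * q ^ (r - s) + 1 \<or>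
      (length us = 2 * m * q ^ (r - s) \<and> disc_sign us = \<eta>)"
    and "(\<exists>g. order_auto V b g r \<and> fixed_point_free V g) \<longleftrightarrow>
      (\<exists>d. length us = 2 * m * d \<and> d \<ge> q ^ (r - s) \<and> disc_sign us = \<eta> ^ d)"
proof -
  show fpf: "(\<exists>g. order_auto V b g r \<and> fixed_point_free V g) \<longleftrightarrow>
      (\<exists>d. length us = 2 * m * d \<and> d \<ge> q ^ (r - s) \<and> disc_sign us = \<eta> ^ d)"
    using necessary_fixed_point_free[OF assms] sufficient_fixed_point_free[OF assms] by metis
  show "(\<exists>g. order_auto V b g r) \<longleftrightarrow> length us \<ge> 2 * m * q ^ (r - s) + 1 \<or>
      (length us = 2 * m * q ^ (r - s) \<and> disc_sign us = \<eta>)"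
  proof
    assume "\<exists>g. order_auto V b g r"
    then obtain g where g: "order_auto V b g r" by blast
    show "length us \<ge> 2 * m * q ^ (r - s) + 1 \<or> (length us = 2 * m * q ^ (r - s) \<and> disc_sign us = \<eta>)"
      using necessary_rank[OF assms g] by (cases "length us = 2 * m * q ^ (r - s)") (simp_all add: mult.assoc)
  next
    assume "length us \<ge> 2 * m * q ^ (r - s) + 1 \<or> (length us = 2 * m * q ^ (r - s) \<and> disc_sign us = \<eta>)"
    then show "\<exists>g. order_auto V b g r"
    proof
      assume "length us \<ge> 2 * m * q ^ (r - s) + 1"
      then show ?thesis by (intro sufficient_rank[OF assms]) (simp add: mult.assoc)
    next
      \<comment> \<open>Equality is the case of a single block, \<open>d = q ^ (r - s)\<close>; an
        odd power of \<eta> is \<eta>.\<close>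
      assume *: "length us = 2 * m * q ^ (r - s) \<and> disc_sign us = \<eta>"
      moreover have "\<eta> ^ (q ^ (r - s)) = \<eta>" using eta_values qr(2) by auto
      ultimately show ?thesis using sufficient_fixed_point_free[OF assms, of "q ^ (r - s)"] by auto
    qed
  qed
qed

end
end


section \<open>Transfer to module records\<close>

lemma diag_isom:
  assumes "diag p k b V us" "bform p k V b" "isom V b W c f"
  shows "diag p k c W us"
  using assms
proof (induction arbitrary: W rule: diag.induct)
  case diag_Nil
  interpret bform p k "{0}" b by fact
  have "W = {0}" using isomD(1)[OF diag_Nil(2)] isom_zero[OF diag_Nil(2)] by (simp add: bij_betw_def)
  then show ?case using diag.diag_Nil by simp
next
  case (diag_Cons v V u us)
  interpret bform p k V b by fact
  note f = isomD[OF diag_Cons.prems(2)]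
  have "isom (perp b V v) b (perp c W (f v)) c f"
    unfolding isom_def
  proof (intro conjI)
    show "bij_betw f (perp b V v) (perp c W (f v))"
      unfolding bij_betw_def
    proof
      show "inj_on f (perp b V v)"
        using f(1) by (rule inj_on_subset[OF bij_betw_imp_inj_on]) (auto simp: perp_def)
      show "f ` perp b V v = perp c W (f v)"
      proof
        show "f ` perp b V v \<subseteq> perp c W (f v)" using f(2,4) diag_Cons.hyps(1) by (auto simp: perp_def)
        show "perp c W (f v) \<subseteq> f ` perp b V v"
        proof
          fix y assume y: "y \<in> perp c W (f v)"
          then obtain x where x: "x \<in> V" "y = f x" using f(1) by (auto simp: perp_def bij_betw_def)
          then have "b x v = 0" using y f(4)[OF x(1) diag_Cons.hyps(1)] by (simp add: perp_def)
          then show "y \<in> f ` perp b V v" using x by (auto simp: perp_def)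
        qed
      qed
    qed
  qed (use f(3,4) in \<open>auto simp: perp_def\<close>)
  then have "diag p k c (perp c W (f v)) us" using diag_Cons.IH perp_bform[OF diag_Cons.hyps(1)] by blast
  moreover have "c (f v) (f v) = qfrac (p ^ k) u" using f(4) diag_Cons.hyps by simp
  ultimately show ?case
    using diag.diag_Cons[where b = c and v = "f v" and V = W] f(2) diag_Cons.hyps by blast
qed

section \<open>Modules over residue rings and their coordinates\<close>

lemma residue_ring_simps:
  "carrier (residue_ring K) = {0..K - 1}" "x \<oplus>\<^bsub>residue_ring K\<^esub> y = (x + y) mod K"
  "x \<otimes>\<^bsub>residue_ring K\<^esub> y = (x * y) mod K" "\<zero>\<^bsub>residue_ring K\<^esub> = 0" "\<one>\<^bsub>residue_ring K\<^esub> = 1"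
  by (simp_all add: residue_ring_def)

lemma qfrac_mod: "K > 0 \<Longrightarrow> qfrac K (a mod K) = qfrac K a"
  by (simp add: qfrac_eq_iff cong_def)

lemma qfrac_inj: "K > 0 \<Longrightarrow> a \<in> {0..K - 1} \<Longrightarrow> c \<in> {0..K - 1} \<Longrightarrow> qfrac K a = qfrac K c \<longleftrightarrow> a = c"
  by (simp add: qfrac_eq_iff cong_def)

lemma finsum_residue_ring:
  fixes n :: nat
  assumes "K > 1" "\<And>i. i < n \<Longrightarrow> f i \<in> {0..K - 1}"
  shows "(\<Oplus>\<^bsub>residue_ring K\<^esub>i\<in>{..<n}. f i) = (\<Sum>i<n. f i) mod K"
  using assms(2)
proof (induct n)
  case 0
  interpret residues K "residue_ring K" using assms(1) by unfold_locales auto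
  show ?case by (simp add: residue_ring_simps)
next
  case (Suc n)
  interpret residues K "residue_ring K" using assms(1) by unfold_locales auto
  have "(\<Oplus>\<^bsub>residue_ring K\<^esub>i\<in>insert n {..<n}. f i) = f n \<oplus>\<^bsub>residue_ring K\<^esub> (\<Oplus>\<^bsub>residue_ring K\<^esub>i\<in>{..<n}. f i)"
    using Suc(2) by (intro finsum_insert) (auto simp: residue_ring_simps)
  then show ?case using Suc by (simp add: lessThan_Suc residue_ring_simps mod_simps add.commute)
qed

text \<open>A module over the integers modulo \<open>K\<close> is determined by its additive group.\<close>

lemma additive_smult:
  assumes K: "K > 1" and "module (residue_ring K) M" "module (residue_ring K) N"
    and f: "\<And>x. x \<in> carrier M \<Longrightarrow> f x \<in> carrier N"
    and add: "\<And>x y. x \<in> carrier M \<Longrightarrow> y \<in> carrier M \<Longrightarrow> f (x \<oplus>\<^bsub>M\<^esub> y) = f x \<oplus>\<^bsub>N\<^esub> f y"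
    and a: "a \<in> carrier (residue_ring K)" and x: "x \<in> carrier M"
  shows "f (a \<odot>\<^bsub>M\<^esub> x) = a \<odot>\<^bsub>N\<^esub> f x"
proof -
  interpret M: module "residue_ring K" M by fact
  interpret N: module "residue_ring K" N by fact
  have succ: "int (Suc n) = int n \<oplus>\<^bsub>residue_ring K\<^esub> 1" if "int (Suc n) < K" for n
    using that by (simp add: residue_ring_simps)
  have "f (int n \<odot>\<^bsub>M\<^esub> x) = int n \<odot>\<^bsub>N\<^esub> f x" if "int n < K" for n
    using that
  proof (induct n)
    case 0
    have z: "\<zero>\<^bsub>residue_ring K\<^esub> = int 0" by (simp add: residue_ring_simps)
    have "f \<zero>\<^bsub>M\<^esub> \<oplus>\<^bsub>N\<^esub> f \<zero>\<^bsub>M\<^esub> = f \<zero>\<^bsub>M\<^esub>" using add[of "\<zero>\<^bsub>M\<^esub>" "\<zero>\<^bsub>M\<^esub>"] by simp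
    then have "f \<zero>\<^bsub>M\<^esub> = \<zero>\<^bsub>N\<^esub>" using f[of "\<zero>\<^bsub>M\<^esub>"] N.add.r_cancel_one by auto
    then show ?case using M.smult_l_null[OF x] N.smult_l_null[OF f[OF x]] unfolding z by simp
  next
    case (Suc n)
    have mem: "int n \<in> carrier (residue_ring K)" "1 \<in> carrier (residue_ring K)"
      using Suc K by (auto simp: residue_ring_simps)
    have one: "1 \<odot>\<^bsub>M\<^esub> x = x" "1 \<odot>\<^bsub>N\<^esub> f x = f x"
      using M.smult_one[OF x] N.smult_one[OF f[OF x]] by (simp_all add: residue_ring_simps)
    have "f (int (Suc n) \<odot>\<^bsub>M\<^esub> x) = f (int n \<odot>\<^bsub>M\<^esub> x \<oplus>\<^bsub>M\<^esub> x)"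
      unfolding succ[OF Suc(2)] using M.smult_l_distr[OF mem x] one by simp
    also have "\<dots> = int n \<odot>\<^bsub>N\<^esub> f x \<oplus>\<^bsub>N\<^esub> f x"
      using add[of "int n \<odot>\<^bsub>M\<^esub> x" x] x mem Suc by simp
    also have "\<dots> = int (Suc n) \<odot>\<^bsub>N\<^esub> f x"
      unfolding succ[OF Suc(2)] using N.smult_l_distr[OF mem f[OF x]] one by simp
    finally show ?case .
  qed
  from this[of "nat a"] show ?thesis using a K by (auto simp: residue_ring_simps)
qed

text \<open>Demanding reduced residues as values of \<gamma> makes \<open>qfrac K\<close> injective
  on them, so that isometries can also be carried back from \<open>V\<close> to
  \<open>M\<close>.\<close>

definition coordinates ::
    "int \<Rightarrow> (int, 'b, 'm) module_scheme \<Rightarrow> ('b \<Rightarrow> 'b \<Rightarrow> int) \<Rightarrow> 'v::ab_group_add set \<Rightarrow> ('v \<Rightarrow> 'v \<Rightarrow> qz) \<Rightarrow> ('b \<Rightarrow> 'v) \<Rightarrow> bool"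
  where "coordinates K M \<gamma> V c \<theta> \<longleftrightarrow> bij_betw \<theta> (carrier M) V \<and>
    (\<forall>x\<in>carrier M. \<forall>y\<in>carrier M. \<theta> (x \<oplus>\<^bsub>M\<^esub> y) = \<theta> x + \<theta> y \<and>
      c (\<theta> x) (\<theta> y) = qfrac K (\<gamma> x y) \<and> \<gamma> x y \<in> {0..K - 1})"

lemma coordinatesD:
  assumes "coordinates K M \<gamma> V c \<theta>"
  shows "bij_betw \<theta> (carrier M) V" "x \<in> carrier M \<Longrightarrow> \<theta> x \<in> V"
    "z \<in> V \<Longrightarrow> inv_into (carrier M) \<theta> z \<in> carrier M" "z \<in> V \<Longrightarrow> \<theta> (inv_into (carrier M) \<theta> z) = z"
    "x \<in> carrier M \<Longrightarrow> inv_into (carrier M) \<theta> (\<theta> x) = x"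
    "x \<in> carrier M \<Longrightarrow> y \<in> carrier M \<Longrightarrow> \<theta> (x \<oplus>\<^bsub>M\<^esub> y) = \<theta> x + \<theta> y"
    "x \<in> carrier M \<Longrightarrow> y \<in> carrier M \<Longrightarrow> c (\<theta> x) (\<theta> y) = qfrac K (\<gamma> x y)"
    "x \<in> carrier M \<Longrightarrow> y \<in> carrier M \<Longrightarrow> \<gamma> x y \<in> {0..K - 1}"
  using assms by (auto simp: coordinates_def bij_betw_def inv_into_into f_inv_into_f)

lemma isometry_to_isom:
  assumes M: "coordinates K M \<gamma> V c \<theta>" "module R M" and N: "coordinates K N \<delta> W d \<theta>'"
    and f: "is_isometry R M \<gamma> N \<delta> f"
  shows "isom V c W d (\<theta>' \<circ> f \<circ> inv_into (carrier M) \<theta>)"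
proof -
  interpret M: module R M by fact
  note m = coordinatesD[OF M(1)] and n = coordinatesD[OF N]
  let ?i = "inv_into (carrier M) \<theta>"
  have fm: "bij_betw f (carrier M) (carrier N)" and fc: "\<And>x. x \<in> carrier M \<Longrightarrow> f x \<in> carrier N"
    and fa: "\<And>x y. x \<in> carrier M \<Longrightarrow> y \<in> carrier M \<Longrightarrow> f (x \<oplus>\<^bsub>M\<^esub> y) = f x \<oplus>\<^bsub>N\<^esub> f y"
    and fi: "\<And>x y. x \<in> carrier M \<Longrightarrow> y \<in> carrier M \<Longrightarrow> \<delta> (f x) (f y) = \<gamma> x y"
    using f by (auto simp: is_isometry_def LinearCombinations.module_hom_def)
  have ia: "?i (x + y) = ?i x \<oplus>\<^bsub>M\<^esub> ?i y" if "x \<in> V" "y \<in> V" for x y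
    using m(5)[of "?i x \<oplus>\<^bsub>M\<^esub> ?i y"] m(6)[of "?i x" "?i y"] m(3,4) that by simp
  show ?thesis
    unfolding isom_def
  proof (intro conjI ballI)
    show "bij_betw (\<theta>' \<circ> f \<circ> ?i) V W"
      by (rule bij_betw_trans[OF bij_betw_inv_into[OF m(1)] bij_betw_trans[OF fm n(1)]])
    fix x y assume xy: "x \<in> V" "y \<in> V"
    show "(\<theta>' \<circ> f \<circ> ?i) (x + y) = (\<theta>' \<circ> f \<circ> ?i) x + (\<theta>' \<circ> f \<circ> ?i) y"
      using xy m(3) by (simp add: ia fa fc n(6))
    show "d ((\<theta>' \<circ> f \<circ> ?i) x) ((\<theta>' \<circ> f \<circ> ?i) y) = c x y"
      using xy m(3,4) m(7)[of "?i x" "?i y"] by (simp add: fi fc n(7))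
  qed
qed

text \<open>\<open>f\<close> is prescribed on the carrier only, since members of the isometry group
  are \<open>undefined\<close> elsewhere; compatibility with scalars comes from
  \<open>additive_smult\<close>.\<close>

lemma isom_to_isometry:
  assumes K: "K > 1" and M: "coordinates K M \<gamma> V c \<theta>" "module (residue_ring K) M"
    and N: "coordinates K N \<delta> W d \<theta>'" "module (residue_ring K) N" and F: "isom V c W d F"
    and f: "\<And>x. x \<in> carrier M \<Longrightarrow> f x = inv_into (carrier N) \<theta>' (F (\<theta> x))"
  shows "is_isometry (residue_ring K) M \<gamma> N \<delta> f"
proof -
  interpret M: module "residue_ring K" M by fact
  interpret N: module "residue_ring K" N by fact
  note m = coordinatesD[OF M(1)] and n = coordinatesD[OF N(1)] and F = isomD[OF F]
  let ?j = "inv_into (carrier N) \<theta>'"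
  have fc: "f x \<in> carrier N" if "x \<in> carrier M" for x using f m(2) F(2) n(3) that by simp
  have tf: "\<theta>' (f x) = F (\<theta> x)" if "x \<in> carrier M" for x using f m(2) F(2) n(4) that by simp
  have ja: "?j (x + y) = ?j x \<oplus>\<^bsub>N\<^esub> ?j y" if "x \<in> W" "y \<in> W" for x y
    using n(5)[of "?j x \<oplus>\<^bsub>N\<^esub> ?j y"] n(6)[of "?j x" "?j y"] n(3,4) that by simp
  have fa: "f (x \<oplus>\<^bsub>M\<^esub> y) = f x \<oplus>\<^bsub>N\<^esub> f y" if "x \<in> carrier M" "y \<in> carrier M" for x y
    using that f m(2,6) F(2,3) ja by simp
  have "bij_betw (?j \<circ> F \<circ> \<theta>) (carrier M) (carrier N)"
    by (rule bij_betw_trans[OF m(1) bij_betw_trans[OF F(1) bij_betw_inv_into[OF n(1)]]])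
  then have bij: "bij_betw f (carrier M) (carrier N)"
    by (rule bij_betw_cong[THEN iffD1, rotated]) (simp add: f)
  have iso: "\<delta> (f x) (f y) = \<gamma> x y" if xy: "x \<in> carrier M" "y \<in> carrier M" for x y
  proof -
    have "qfrac K (\<delta> (f x) (f y)) = d (F (\<theta> x)) (F (\<theta> y))" using n(7)[OF fc[OF xy(1)] fc[OF xy(2)]] tf xy by simp
    also have "\<dots> = qfrac K (\<gamma> x y)" using F(4) m(2,7) xy by simp
    finally show ?thesis using qfrac_inj[of K] n(8)[OF fc[OF xy(1)] fc[OF xy(2)]] m(8)[OF xy] K by simp
  qed
  show ?thesis
    unfolding is_isometry_def LinearCombinations.module_hom_def
    using fc fa bij iso additive_smult[OF K M(2) N(2) fc fa] by auto
qed

section \<open>Orders in the isometry group\<close>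

lemma isometry_pow:
  assumes "module R M" "g \<in> carrier (isometry_group R M \<gamma>)" "x \<in> carrier M"
  shows "(g [^]\<^bsub>isometry_group R M \<gamma>\<^esub> n) x = (g ^^ n) x"
proof -
  interpret group "isometry_group R M \<gamma>" by (rule group_isometry_group[OF assms(1)])
  have car: "carrier (isometry_group R M \<gamma>) \<subseteq> Bij (carrier M)" by (auto simp: isometry_group_def)
  show ?thesis
    using assms(3)
  proof (induct n arbitrary: x)
    case 0
    then show ?case by (simp add: isometry_group_def BijGroup_def)
  next
    case (Suc n)
    have gB: "g \<in> Bij (carrier M)" "g [^]\<^bsub>isometry_group R M \<gamma>\<^esub> n \<in> Bij (carrier M)"
      using car assms(2) nat_pow_closed[OF assms(2), of n] by blast+
    have "g x \<in> carrier M" using Bij_imp_funcset[OF gB(1)] Suc(2) by auto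
    then have "(g ^^ Suc n) x = (g [^]\<^bsub>isometry_group R M \<gamma>\<^esub> n) (g x)"
      using Suc(1) by (simp add: funpow_swap1)
    also have "\<dots> = (g [^]\<^bsub>isometry_group R M \<gamma>\<^esub> n \<otimes>\<^bsub>isometry_group R M \<gamma>\<^esub> g) x"
      using gB Suc(2) by (simp add: isometry_group_def BijGroup_def compose_def)
    finally show ?case by simp
  qed
qed

lemma isometry_pow_eq_one_iff:
  assumes "module R M" "g \<in> carrier (isometry_group R M \<gamma>)"
  shows "g [^]\<^bsub>isometry_group R M \<gamma>\<^esub> n = \<one>\<^bsub>isometry_group R M \<gamma>\<^esub> \<longleftrightarrow> (\<forall>x\<in>carrier M. (g ^^ (n::nat)) x = x)"
proof -
  interpret group "isometry_group R M \<gamma>" by (rule group_isometry_group[OF assms(1)])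
  have one: "\<one>\<^bsub>isometry_group R M \<gamma>\<^esub> = (\<lambda>x\<in>carrier M. x)" by (simp add: isometry_group_def BijGroup_def)
  have "g [^]\<^bsub>isometry_group R M \<gamma>\<^esub> n \<in> Bij (carrier M)"
    using nat_pow_closed[OF assms(2), of n] by (auto simp: isometry_group_def)
  then have ext: "g [^]\<^bsub>isometry_group R M \<gamma>\<^esub> n \<in> extensional (carrier M)" by (rule Bij_imp_extensional)
  show ?thesis
  proof
    assume "g [^]\<^bsub>isometry_group R M \<gamma>\<^esub> n = \<one>\<^bsub>isometry_group R M \<gamma>\<^esub>"
    then show "\<forall>x\<in>carrier M. (g ^^ n) x = x"
      using isometry_pow[OF assms] one by (metis restrict_apply')
  next
    assume *: "\<forall>x\<in>carrier M. (g ^^ n) x = x"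
    show "g [^]\<^bsub>isometry_group R M \<gamma>\<^esub> n = \<one>\<^bsub>isometry_group R M \<gamma>\<^esub>"
      unfolding one
    proof (rule extensionalityI[OF ext])
      show "(g [^]\<^bsub>isometry_group R M \<gamma>\<^esub> n) x = (\<lambda>x\<in>carrier M. x) x" if "x \<in> carrier M" for x
        using isometry_pow[OF assms that] * that by simp
    qed (rule restrict_extensional)
  qed
qed

lemma isometry_ord_iff:
  assumes "module R M" "g \<in> carrier (isometry_group R M \<gamma>)" "prime q" "r > 0"
  shows "group.ord (isometry_group R M \<gamma>) g = q ^ r \<longleftrightarrow>
    (\<forall>x\<in>carrier M. (g ^^ (q ^ r)) x = x) \<and> \<not> (\<forall>x\<in>carrier M. (g ^^ (q ^ (r - 1))) x = x)"
proof -
  interpret group "isometry_group R M \<gamma>" by (rule group_isometry_group[OF assms(1)])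
  have dvd: "(\<forall>x\<in>carrier M. (g ^^ n) x = x) \<longleftrightarrow> ord g dvd n" for n
    using pow_eq_id[OF assms(2), of n] isometry_pow_eq_one_iff[OF assms(1,2), of n] by simp
  have "ord g = q ^ r \<longleftrightarrow> ord g dvd q ^ r \<and> \<not> ord g dvd q ^ (r - 1)"
  proof
    assume "ord g = q ^ r"
    moreover have "\<not> q ^ r dvd q ^ (r - 1)"
      using assms(4) prime_gt_1_nat[OF assms(3)] power_dvd_imp_le[of q r "r - 1"] by fastforce
    ultimately show "ord g dvd q ^ r \<and> \<not> ord g dvd q ^ (r - 1)" by simp
  next
    assume *: "ord g dvd q ^ r \<and> \<not> ord g dvd q ^ (r - 1)"
    then obtain i where i: "i \<le> r" "ord g = q ^ i" using divides_primepow_nat[OF assms(3)] by blast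
    have "\<not> i \<le> r - 1" using * i(2) le_imp_power_dvd by metis
    then have "i = r" using i(1) by linarith
    then show "ord g = q ^ r" using i(2) by simp
  qed
  then show ?thesis unfolding dvd .
qed

section \<open>Coordinates of the standard module and of free modules\<close>

lemma func_space_coordinates:
  assumes "K > 1"
  shows "coordinates K (ring.func_space (residue_ring K) {..<n}) (std_form (residue_ring K) n)
    (std_space n K) (std_b n K) (\<lambda>x i. if i < n then qfrac K (x i) else 0)"
    (is "coordinates K ?F _ _ _ ?\<theta>")
proof -
  have "residues K" using assms by unfold_locales
  then have "ring (residue_ring K)" by (intro cring.axioms residues.cring)
  note F_def = ring.func_space_def[OF this]
  have K: "K > 0" using assms by simp
  have car: "carrier ?F = {..<n} \<rightarrow>\<^sub>E {0..K - 1}" unfolding F_def residue_ring_simps by simp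
  have fr: "K *z qfrac K a = 0" for a unfolding zscale_qfrac qfrac_eq_0_iff[OF K] by simp
  have bij: "bij_betw ?\<theta> (carrier ?F) (std_space n K)"
    unfolding bij_betw_def
  proof
    show "inj_on ?\<theta> (carrier ?F)"
    proof (rule inj_onI)
      fix x y assume xy: "x \<in> carrier ?F" "y \<in> carrier ?F" and eq: "?\<theta> x = ?\<theta> y"
      show "x = y"
      proof (rule PiE_ext[OF xy[unfolded car]])
        fix i assume i: "i \<in> {..<n}"
        have "x i \<in> {0..K - 1}" "y i \<in> {0..K - 1}" using PiE_mem[OF xy(1)[unfolded car] i] PiE_mem[OF xy(2)[unfolded car] i] .
        moreover have "qfrac K (x i) = qfrac K (y i)" using fun_cong[OF eq, of i] i by simp
        ultimately show "x i = y i" using qfrac_inj[OF K] by blast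
      qed
    qed
    show "?\<theta> ` carrier ?F = std_space n K"
    proof
      show "?\<theta> ` carrier ?F \<subseteq> std_space n K" by (intro image_subsetI) (simp add: std_space_def fr)
      show "std_space n K \<subseteq> ?\<theta> ` carrier ?F"
      proof
        fix x assume x: "x \<in> std_space n K"
        obtain a where a: "\<And>i. x i = qfrac K (a i)" "\<And>i. i \<ge> n \<Longrightarrow> a i = 0" "\<And>i. a i \<in> {0..<K}"
          using std_space_frac[OF K x] by blast
        have "x = ?\<theta> (restrict a {..<n})"
        proof
          fix i show "x i = ?\<theta> (restrict a {..<n}) i" by (cases "i < n") (simp_all add: a(1) a(2))
        qed
        moreover have "restrict a {..<n} \<in> carrier ?F" unfolding car restrict_PiE_iff
        proof
          fix i show "a i \<in> {0..K - 1}" using a(3)[of i] by simp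
        qed
        ultimately show "x \<in> ?\<theta> ` carrier ?F" by (rule image_eqI)
      qed
    qed
  qed
  show ?thesis
    unfolding coordinates_def
  proof (intro conjI ballI bij)
    fix x y assume xy: "x \<in> carrier ?F" "y \<in> carrier ?F"
    show "?\<theta> (x \<oplus>\<^bsub>?F\<^esub> y) = ?\<theta> x + ?\<theta> y"
    proof
      fix i show "?\<theta> (x \<oplus>\<^bsub>?F\<^esub> y) i = (?\<theta> x + ?\<theta> y) i"
        unfolding F_def residue_ring_simps by (simp add: qfrac_mod[OF K] qfrac_add)
    qed
    have sf: "std_form (residue_ring K) n x y = (\<Sum>i<n. (x i * y i) mod K) mod K"
      unfolding std_form_def residue_ring_simps(3) using K by (intro finsum_residue_ring assms) auto
    have "std_b n K (?\<theta> x) (?\<theta> y) = (\<Sum>i<n. qfrac K (x i * y i))"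
      unfolding std_b_def by (rule sum.cong[OF refl]) (simp add: qmul_qfrac[OF K])
    also have "\<dots> = qfrac K (\<Sum>i<n. x i * y i)"
      by (induct n) (simp_all add: qfrac_add)
    also have "\<dots> = qfrac K (std_form (residue_ring K) n x y)" unfolding sf by (simp add: qfrac_mod[OF K] mod_sum_eq)
    finally show "std_b n K (?\<theta> x) (?\<theta> y) = qfrac K (std_form (residue_ring K) n x y)" .
    show "std_form (residue_ring K) n x y \<in> {0..K - 1}" unfolding sf using K by simp
  qed
qed

text \<open>Linear combination over a basis is a bijection from coefficient functions; its inverse,
  read along an enumeration of the basis, gives the coordinates.\<close>

lemma basis_coordinates:
  assumes K: "K > 1" and M: "free_of_rank (residue_ring K) M n"
  shows "\<exists>\<theta> :: 'b \<Rightarrow> nat \<Rightarrow> qz. bij_betw \<theta> (carrier M) (std_space n K) \<and>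
    (\<forall>x\<in>carrier M. \<forall>y\<in>carrier M. \<theta> (x \<oplus>\<^bsub>M\<^esub> y) = \<theta> x + \<theta> y)"
proof -
  have K0: "K > 0" using K by simp
  obtain A where A: "A \<subseteq> carrier M" "finite A" "card A = n" "\<not> module.lin_dep (residue_ring K) M A"
    "module.span (residue_ring K) M A = carrier M" and mod: "module (residue_ring K) M"
    using M unfolding free_of_rank_def by blast
  interpret module "residue_ring K" M by (rule mod)
  let ?F = "func_space A"
  interpret \<Lambda>: mod_hom "residue_ring K" ?F M "\<lambda>a. lincomb a A" by (rule lincomb_is_mod_hom[OF A(2,1)])
  have car: "carrier ?F = A \<rightarrow>\<^sub>E {0..K - 1}" unfolding func_space_def residue_ring_simps by simp
  have add: "(a \<oplus>\<^bsub>?F\<^esub> c) v = (a v + c v) mod K" if "v \<in> A" for a c v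
    unfolding func_space_def residue_ring_simps using that by simp
  have hom: "lincomb (a \<oplus>\<^bsub>?F\<^esub> c) A = lincomb a A \<oplus>\<^bsub>M\<^esub> lincomb c A"
    if "a \<in> carrier ?F" "c \<in> carrier ?F" for a c
    using module_hom_add[OF \<Lambda>.f_hom that] .
  have inj: "inj_on (\<lambda>a. lincomb a A) (carrier ?F)"
  proof (rule inj_onI)
    fix a c assume ac: "a \<in> carrier ?F" "c \<in> carrier ?F" "lincomb a A = lincomb c A"
    \<comment> \<open>The negative of \<open>c\<close>, reduced modulo \<open>K\<close>: the
      difference of \<open>a\<close> and \<open>c\<close> is formed in the function space, where
      linear independence applies.\<close>
    define d where "d = (\<lambda>v\<in>A. (- c v) mod K)"
    have dF: "d \<in> carrier ?F" unfolding car d_def using K0 by auto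
    have zero: "lincomb (x \<oplus>\<^bsub>?F\<^esub> d) A = lincomb x A \<oplus>\<^bsub>M\<^esub> lincomb d A" if "x \<in> carrier ?F" for x
      using hom[OF that dF] .
    have cd: "(c \<oplus>\<^bsub>?F\<^esub> d) v = 0" if "v \<in> A" for v
      unfolding add[OF that] d_def using that by (simp add: mod_simps)
    have "c \<oplus>\<^bsub>?F\<^esub> d = \<zero>\<^bsub>?F\<^esub>"
    proof
      fix v show "(c \<oplus>\<^bsub>?F\<^esub> d) v = \<zero>\<^bsub>?F\<^esub> v"
      proof (cases "v \<in> A")
        case True
        then show ?thesis using cd[OF True] unfolding func_space_def residue_ring_simps by simp
      next
        case False
        then show ?thesis unfolding func_space_def by simp
      qed
    qed
    then have "lincomb (c \<oplus>\<^bsub>?F\<^esub> d) A = \<zero>\<^bsub>M\<^esub>" using \<Lambda>.f0_is_0 by simp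
    then have ad: "lincomb (a \<oplus>\<^bsub>?F\<^esub> d) A = \<zero>\<^bsub>M\<^esub>" using zero[OF ac(1)] zero[OF ac(2)] ac(3) by simp
    have adF: "a \<oplus>\<^bsub>?F\<^esub> d \<in> A \<rightarrow> carrier (residue_ring K)"
    proof (rule Pi_I)
      fix v assume v: "v \<in> A"
      show "(a \<oplus>\<^bsub>?F\<^esub> d) v \<in> carrier (residue_ring K)"
        unfolding add[OF v] residue_ring_simps(1) using K0 by simp
    qed
    have z: "(a \<oplus>\<^bsub>?F\<^esub> d) v = 0" if "v \<in> A" for v
    proof (rule ccontr)
      assume "(a \<oplus>\<^bsub>?F\<^esub> d) v \<noteq> 0"
      then have ne: "(a \<oplus>\<^bsub>?F\<^esub> d) v \<noteq> \<zero>\<^bsub>residue_ring K\<^esub>" by (simp only: residue_ring_simps(4) not_False_eq_True)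
      have "lin_dep A"
        unfolding lin_dep_def
        by (intro exI conjI) (rule A(2), rule subset_refl, rule adF, rule ad, rule that, rule ne)
      then show False using A(4) by (rule notE[rotated])
    qed
    show "a = c"
    proof (rule PiE_ext[OF ac(1,2)[unfolded car]])
      fix v assume v: "v \<in> A"
      have "(a v + (- c v) mod K) mod K = 0" using z[OF v] unfolding add[OF v] d_def using v by simp
      then have "(a v - c v) mod K = 0" by (simp add: mod_simps)
      then have "K dvd a v - c v" by (rule mod_0_imp_dvd)
      then have "a v mod K = c v mod K" by (simp only: mod_eq_dvd_iff)
      moreover have "a v \<in> {0..K - 1}" "c v \<in> {0..K - 1}" using ac(1,2) v unfolding car by (auto dest: PiE_mem)
      ultimately show "a v = c v" by simp
    qed
  qed
  have surj: "(\<lambda>a. lincomb a A) ` carrier ?F = carrier M"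
  proof
    show "(\<lambda>a. lincomb a A) ` carrier ?F \<subseteq> carrier M"
      using module_hom_closed[OF \<Lambda>.f_hom] by blast
    show "carrier M \<subseteq> (\<lambda>a. lincomb a A) ` carrier ?F"
    proof
      fix x assume "x \<in> carrier M"
      then obtain a where a: "a \<in> A \<rightarrow> carrier (residue_ring K)" "lincomb a A = x"
        using finite_in_span[OF A(2,1)] A(5) by blast
      have "lincomb (restrict a A) A = lincomb a A"
        unfolding lincomb_def
      proof (rule finsum_cong'[OF refl])
        show "(\<lambda>v. a v \<odot>\<^bsub>M\<^esub> v) \<in> A \<rightarrow> carrier M"
        proof (rule Pi_I)
          fix v assume v: "v \<in> A"
          have "a v \<in> carrier (residue_ring K)" by (rule Pi_mem[OF a(1) v])
          moreover have "v \<in> carrier M" using A(1) v by blast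
          ultimately show "a v \<odot>\<^bsub>M\<^esub> v \<in> carrier M" by (rule smult_closed)
        qed
      next
        fix v assume "v \<in> A"
        then show "restrict a A v \<odot>\<^bsub>M\<^esub> v = a v \<odot>\<^bsub>M\<^esub> v" by (simp only: restrict_apply')
      qed
      moreover have "restrict a A \<in> carrier ?F" unfolding car restrict_PiE_iff
      proof
        fix v assume "v \<in> A"
        from Pi_mem[OF a(1) this] show "a v \<in> {0..K - 1}" unfolding residue_ring_simps(1) .
      qed
      ultimately show "x \<in> (\<lambda>a. lincomb a A) ` carrier ?F"
        by (intro image_eqI[where x = "restrict a A"]) (simp_all only: a(2))
    qed
  qed
  define co where "co = inv_into (carrier ?F) (\<lambda>a. lincomb a A)"
  have co: "co x \<in> carrier ?F" "lincomb (co x) A = x" if "x \<in> carrier M" for x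
  proof -
    have "x \<in> (\<lambda>a. lincomb a A) ` carrier ?F" using that by (simp only: surj)
    then show "co x \<in> carrier ?F" "lincomb (co x) A = x"
      unfolding co_def by (rule inv_into_into, rule f_inv_into_f[where f = "\<lambda>a. lincomb a A"])
  qed
  have co_eq: "co (lincomb a A) = a" if "a \<in> carrier ?F" for a
    unfolding co_def using inv_into_f_f[OF inj that] .
  obtain e where e: "bij_betw e {..<n} A"
    using ex_bij_betw_nat_finite[OF A(2)] unfolding A(3) atLeast0LessThan by blast
  have eA: "e i \<in> A" if "i < n" for i using bij_betwE[OF e] that by blast
  define \<theta> where "\<theta> x = (\<lambda>i. if i < n then qfrac K (co x (e i)) else 0)" for x
  have bij: "bij_betw \<theta> (carrier M) (std_space n K)"
    unfolding bij_betw_def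
  proof
    show "inj_on \<theta> (carrier M)"
    proof (rule inj_onI)
      fix x y assume xy: "x \<in> carrier M" "y \<in> carrier M" and eq: "\<theta> x = \<theta> y"
      have "co x = co y"
      proof (rule PiE_ext[OF co(1)[OF xy(1), unfolded car] co(1)[OF xy(2), unfolded car]])
        fix v assume v: "v \<in> A"
        then obtain i where i: "i < n" "v = e i" using bij_betw_imp_surj_on[OF e] by blast
        have "co x v \<in> {0..K - 1}" "co y v \<in> {0..K - 1}"
          using co(1)[OF xy(1)] co(1)[OF xy(2)] v unfolding car by (auto dest: PiE_mem)
        moreover have "qfrac K (co x v) = qfrac K (co y v)" using fun_cong[OF eq, of i] i by (simp add: \<theta>_def)
        ultimately show "co x v = co y v" using qfrac_inj[OF K0] by blast
      qed
      then have "lincomb (co x) A = lincomb (co y) A" by (rule arg_cong)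
      then show "x = y" unfolding co(2)[OF xy(1)] co(2)[OF xy(2)] .
    qed
    show "\<theta> ` carrier M = std_space n K"
    proof
      have "K *z qfrac K a = 0" for a unfolding zscale_qfrac qfrac_eq_0_iff[OF K0] by simp
      then show "\<theta> ` carrier M \<subseteq> std_space n K" by (intro image_subsetI) (simp add: std_space_def \<theta>_def)
      show "std_space n K \<subseteq> \<theta> ` carrier M"
      proof
        fix y assume y: "y \<in> std_space n K"
        obtain a where a: "\<And>i. y i = qfrac K (a i)" "\<And>i. i \<ge> n \<Longrightarrow> a i = 0" "\<And>i. a i \<in> {0..<K}"
          using std_space_frac[OF K0 y] by blast
        define c where "c = (\<lambda>v\<in>A. a (inv_into {..<n} e v))"
        have c: "c \<in> carrier ?F" unfolding car c_def using a(3) by auto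
        have ce: "c (e i) = a i" if "i < n" for i
          using eA[OF that] inv_into_f_f[OF bij_betw_imp_inj_on[OF e], of i] that by (simp add: c_def)
        have "\<theta> (lincomb c A) = y"
        proof
          fix i show "\<theta> (lincomb c A) i = y i"
            using a(1)[of i] a(2)[of i] ce[of i] by (simp add: \<theta>_def co_eq[OF c])
        qed
        moreover have "lincomb c A \<in> carrier M" using funcset_mem[OF module_hom_closed[OF \<Lambda>.f_hom] c] .
        ultimately show "y \<in> \<theta> ` carrier M" by (rule image_eqI[OF sym])
      qed
    qed
  qed
  have hom_\<theta>: "\<theta> (x \<oplus>\<^bsub>M\<^esub> y) = \<theta> x + \<theta> y" if xy: "x \<in> carrier M" "y \<in> carrier M" for x y
  proof -
    let ?s = "co x \<oplus>\<^bsub>?F\<^esub> co y"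
    have sF: "?s \<in> carrier ?F" unfolding car
    proof (rule PiE_I)
      fix v assume "v \<in> A" then show "?s v \<in> {0..K - 1}" unfolding add[OF \<open>v \<in> A\<close>] using K0 by simp
    next
      fix v assume "v \<notin> A" then show "?s v = undefined" unfolding func_space_def by simp
    qed
    have l: "lincomb ?s A = x \<oplus>\<^bsub>M\<^esub> y"
      using hom[OF co(1)[OF xy(1)] co(1)[OF xy(2)]] unfolding co(2)[OF xy(1)] co(2)[OF xy(2)] .
    have s: "co (x \<oplus>\<^bsub>M\<^esub> y) = ?s" using co_eq[OF sF] unfolding l .
    show ?thesis
    proof
      fix i show "\<theta> (x \<oplus>\<^bsub>M\<^esub> y) i = (\<theta> x + \<theta> y) i"
        by (cases "i < n") (simp_all add: \<theta>_def s add[OF eA] qfrac_mod[OF K0] qfrac_add)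
    qed
  qed
  show ?thesis by (intro exI[of _ \<theta>] conjI ballI, rule bij, rule hom_\<theta>)
qed


lemma coordinates_zero_iff:
  assumes "coordinates K M \<gamma> V c \<theta>" "module R M" "x \<in> carrier M"
  shows "\<theta> x = 0 \<longleftrightarrow> x = \<zero>\<^bsub>M\<^esub>"
proof -
  interpret module R M by fact
  note m = coordinatesD[OF assms(1)]
  have "\<theta> \<zero>\<^bsub>M\<^esub> = \<theta> \<zero>\<^bsub>M\<^esub> + \<theta> \<zero>\<^bsub>M\<^esub>" using m(6)[of "\<zero>\<^bsub>M\<^esub>" "\<zero>\<^bsub>M\<^esub>"] by simp
  then have z: "\<theta> \<zero>\<^bsub>M\<^esub> = 0" by simp
  show ?thesis using z m(5)[OF assms(3)] m(5)[of "\<zero>\<^bsub>M\<^esub>"] by fastforce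
qed

lemma conjugate_funpow:
  assumes M: "coordinates K M \<gamma> V c \<theta>"
    and g: "\<And>x. x \<in> carrier M \<Longrightarrow> g x \<in> carrier M" "\<And>x. x \<in> carrier M \<Longrightarrow> \<theta> (g x) = G (\<theta> x)"
  shows "(\<forall>z\<in>V. (G ^^ n) z = z) \<longleftrightarrow> (\<forall>x\<in>carrier M. (g ^^ n) x = x)"
proof -
  note m = coordinatesD[OF M]
  have gn: "(g ^^ n) x \<in> carrier M" if "x \<in> carrier M" for n x using that g(1) by (induct n) auto
  have Gn: "(G ^^ n) (\<theta> x) = \<theta> ((g ^^ n) x)" if "x \<in> carrier M" for n x
  proof (induct n)
    case (Suc n)
    then show ?case using g(2)[OF gn[OF that]] by simp
  qed simp
  show ?thesis
  proof
    assume *: "\<forall>z\<in>V. (G ^^ n) z = z"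
    show "\<forall>x\<in>carrier M. (g ^^ n) x = x"
    proof
      fix x assume x: "x \<in> carrier M"
      have "\<theta> ((g ^^ n) x) = \<theta> x" using bspec[OF * m(2)[OF x]] Gn[OF x, of n] by (rule trans[OF sym, rotated])
      then have "inv_into (carrier M) \<theta> (\<theta> ((g ^^ n) x)) = inv_into (carrier M) \<theta> (\<theta> x)" by simp
      then show "(g ^^ n) x = x" by (simp only: m(5)[OF gn[OF x]] m(5)[OF x])
    qed
  next
    assume *: "\<forall>x\<in>carrier M. (g ^^ n) x = x"
    show "\<forall>z\<in>V. (G ^^ n) z = z"
    proof
      fix z assume z: "z \<in> V"
      let ?x = "inv_into (carrier M) \<theta> z"
      have "(G ^^ n) (\<theta> ?x) = \<theta> ?x" using Gn[OF m(3)[OF z], of n] unfolding bspec[OF * m(3)[OF z]] .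
      then show "(G ^^ n) z = z" by (simp only: m(4)[OF z])
    qed
  qed
qed

lemma conjugate_fixed_points:
  assumes M: "coordinates K M \<gamma> V c \<theta>" "module R M"
    and g: "\<And>x. x \<in> carrier M \<Longrightarrow> g x \<in> carrier M" "\<And>x. x \<in> carrier M \<Longrightarrow> \<theta> (g x) = G (\<theta> x)"
  shows "(\<forall>z\<in>V. G z = z \<longrightarrow> z = 0) \<longleftrightarrow> (\<forall>x\<in>carrier M. g x = x \<longrightarrow> x = \<zero>\<^bsub>M\<^esub>)"
proof -
  note m = coordinatesD[OF M(1)]
  have eq: "G (\<theta> x) = \<theta> x \<longleftrightarrow> g x = x" if x: "x \<in> carrier M" for x
  proof
    assume "G (\<theta> x) = \<theta> x"
    then have "inv_into (carrier M) \<theta> (\<theta> (g x)) = inv_into (carrier M) \<theta> (\<theta> x)" using g(2)[OF x] by simp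
    then show "g x = x" by (simp only: m(5)[OF g(1)[OF x]] m(5)[OF x])
  next
    assume "g x = x"
    then show "G (\<theta> x) = \<theta> x" using g(2)[OF x] by simp
  qed
  note zero = coordinates_zero_iff[OF M]
  show ?thesis
  proof
    assume *: "\<forall>z\<in>V. G z = z \<longrightarrow> z = 0"
    show "\<forall>x\<in>carrier M. g x = x \<longrightarrow> x = \<zero>\<^bsub>M\<^esub>" using * m(2) eq zero by blast
  next
    assume *: "\<forall>x\<in>carrier M. g x = x \<longrightarrow> x = \<zero>\<^bsub>M\<^esub>"
    show "\<forall>z\<in>V. G z = z \<longrightarrow> z = 0"
    proof (intro ballI impI)
      fix z assume z: "z \<in> V" "G z = z"
      have x: "inv_into (carrier M) \<theta> z \<in> carrier M" "\<theta> (inv_into (carrier M) \<theta> z) = z"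
        using m(3,4)[OF z(1)] .
      then show "z = 0" using * eq[OF x(1)] zero[OF x(1)] z(2) by simp
    qed
  qed
qed

text \<open>Conjugation by \<theta> preserves which powers are the identity and whether nonzero
  vectors are fixed. Abstracting these two data into \<open>P\<close> serves both parts of the
  theorem.\<close>

lemma isometry_group_iff:
  assumes K: "K > 1" and M: "coordinates K M \<gamma> V c \<theta>" "module (residue_ring K) M"
  shows "(\<exists>g\<in>carrier (isometry_group (residue_ring K) M \<gamma>).
      P (\<lambda>n. \<forall>x\<in>carrier M. (g ^^ n) x = x) (\<forall>x\<in>carrier M. g x = x \<longrightarrow> x = \<zero>\<^bsub>M\<^esub>)) \<longleftrightarrow>
    (\<exists>G. isom V c V c G \<and> P (\<lambda>n. \<forall>z\<in>V. (G ^^ n) z = z) (\<forall>z\<in>V. G z = z \<longrightarrow> z = 0))"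
proof -
  let ?R = "residue_ring K" and ?i = "inv_into (carrier M) \<theta>"
  note m = coordinatesD[OF M(1)]
  show ?thesis
  proof
    assume "\<exists>g\<in>carrier (isometry_group ?R M \<gamma>).
      P (\<lambda>n. \<forall>x\<in>carrier M. (g ^^ n) x = x) (\<forall>x\<in>carrier M. g x = x \<longrightarrow> x = \<zero>\<^bsub>M\<^esub>)"
    then obtain g where g: "g \<in> carrier (isometry_group ?R M \<gamma>)"
      and P: "P (\<lambda>n. \<forall>x\<in>carrier M. (g ^^ n) x = x) (\<forall>x\<in>carrier M. g x = x \<longrightarrow> x = \<zero>\<^bsub>M\<^esub>)" by blast
    have iso: "is_isometry ?R M \<gamma> M \<gamma> g" using g by (simp add: isometry_group_def)
    then have gc: "g x \<in> carrier M" if "x \<in> carrier M" for x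
      using that by (auto simp: is_isometry_def LinearCombinations.module_hom_def)
    define G where "G = \<theta> \<circ> g \<circ> ?i"
    have "isom V c V c G" unfolding G_def by (rule isometry_to_isom[OF M M(1) iso])
    moreover have tg: "\<theta> (g x) = G (\<theta> x)" if "x \<in> carrier M" for x using m(5)[OF that] by (simp add: G_def)
    ultimately show "\<exists>G. isom V c V c G \<and> P (\<lambda>n. \<forall>z\<in>V. (G ^^ n) z = z) (\<forall>z\<in>V. G z = z \<longrightarrow> z = 0)"
      using P conjugate_funpow[where g = g and G = G, OF M(1) gc tg]
        conjugate_fixed_points[where g = g and G = G, OF M gc tg] by (intro exI[of _ G]) simp
  next
    assume "\<exists>G. isom V c V c G \<and> P (\<lambda>n. \<forall>z\<in>V. (G ^^ n) z = z) (\<forall>z\<in>V. G z = z \<longrightarrow> z = 0)"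
    then obtain G where G: "isom V c V c G"
      and P: "P (\<lambda>n. \<forall>z\<in>V. (G ^^ n) z = z) (\<forall>z\<in>V. G z = z \<longrightarrow> z = 0)" by blast
    define g where "g = (\<lambda>x\<in>carrier M. ?i (G (\<theta> x)))"
    have gc: "g x \<in> carrier M" and tg: "\<theta> (g x) = G (\<theta> x)" if "x \<in> carrier M" for x
      using that m(3,4)[OF isomD(2)[OF G m(2)[OF that]]] by (simp_all add: g_def)
    have iso: "is_isometry ?R M \<gamma> M \<gamma> g"
      by (rule isom_to_isometry[OF K M M G]) (simp add: g_def)
    then have "bij_betw g (carrier M) (carrier M)" by (simp add: is_isometry_def)
    then have "g \<in> Bij (carrier M)" by (simp add: Bij_def g_def)
    then have "g \<in> carrier (isometry_group ?R M \<gamma>)" using iso by (simp add: isometry_group_def)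
    then show "\<exists>g\<in>carrier (isometry_group ?R M \<gamma>).
      P (\<lambda>n. \<forall>x\<in>carrier M. (g ^^ n) x = x) (\<forall>x\<in>carrier M. g x = x \<longrightarrow> x = \<zero>\<^bsub>M\<^esub>)"
      using P conjugate_funpow[where g = g and G = G, OF M(1) gc tg]
        conjugate_fixed_points[where g = g and G = G, OF M gc tg] by (intro bexI[of _ g]) simp_all
  qed
qed

text \<open>The origin of the second factor of the index: for \<open>n = 2 * N\<close> the sign
  \<open>chi (- 1) ^ N\<close> is -1 exactly if \<open>p\<close> is 3 modulo 4 and \<open>N\<close>
  is odd.\<close>

lemma (in odd_prime_power) chi_minus_one: "chi (- 1) = (if nat p mod 4 = 3 then - 1 else 1)"
proof -
  have "[chi (- 1) = (- 1) ^ ((nat p - 1) div 2)] (mod p)" by (rule chi_euler)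
  moreover have "chi (- 1) = 1 \<or> chi (- 1) = - 1" by (rule chi_unit) simp
  moreover have "(- 1 :: int) ^ ((nat p - 1) div 2) = (if nat p mod 4 = 3 then - 1 else 1)"
  proof -
    have "odd (nat p)" using odd_p p_gt_2 by (simp add: even_nat_iff)
    moreover have "(- 1 :: int) ^ ((j - 1) div 2) = (if j mod 4 = 3 then - 1 else 1)" if "odd j" for j :: nat
    proof -
      have "even ((j - 1) div 2) \<longleftrightarrow> j mod 4 \<noteq> 3" using that by presburger
      then show ?thesis by (cases "j mod 4 = 3") simp_all
    qed
    ultimately show ?thesis by blast
  qed
  ultimately show ?thesis using p_gt_2 by (intro small_cong) (auto split: if_splits)
qed

section \<open>Both equivalences for free modules\<close>

theorem theorem1p3:
  fixes p q k n r s r' :: nat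
    and B :: "(int, 'b, 'm) module_scheme"
    and \<beta> :: "'b \<Rightarrow> 'b \<Rightarrow> int"
  defines "R \<equiv> residue_ring (int (p ^ k))"
  assumes "prime p" and "odd p" and "prime q" and "odd q" and "p \<noteq> q"
    and "k > 0" and "n > 0" and "r > 0"
    and "free_of_rank R B n"
    and "bilinear_form R B \<beta>" and "symmetric_form B \<beta>" and "nondegenerate_form R B \<beta>"
    and "s = multiplicity q (p ^ (2 * min_exp q p) - 1)"
    and "r' = nat (max (int r - int s) 0)"
  shows "((\<exists>g\<in>carrier (isometry_group R B \<beta>). group.ord (isometry_group R B \<beta>) g = q ^ r) \<longleftrightarrow>
            n \<ge> 2 * min_exp q p * q ^ r' + 1 \<or>
            (n = 2 * min_exp q p * q ^ r' \<and> form_index p k n B \<beta> = eta q p)) \<and>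
         ((\<exists>g\<in>carrier (isometry_group R B \<beta>). group.ord (isometry_group R B \<beta>) g = q ^ r \<and>
              (\<forall>x\<in>carrier B. g x = x \<longrightarrow> x = \<zero>\<^bsub>B\<^esub>)) \<longleftrightarrow>
            (\<exists>d. n = 2 * min_exp q p * d \<and> d \<ge> q ^ r' \<and> form_index p k n B \<beta> = eta q p ^ d))"
proof -
  interpret tp: two_odd_primes p q using assms(2-6) by unfold_locales
  interpret odd_prime_power "int p" k using assms(2,3,7) by unfold_locales auto
  define K where "K = int p ^ k"
  have RK: "R = residue_ring K" unfolding R_def K_def by simp
  have K1: "K > 1" unfolding K_def using p_gt_2 assms(7) by (intro one_less_power) auto
  then have K0: "K > 0" by simp
  have mod: "module (residue_ring K) B" using assms(10) unfolding free_of_rank_def RK by blast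
  interpret module "residue_ring K" B by (rule mod)
  obtain \<theta> :: "'b \<Rightarrow> nat \<Rightarrow> qz" where bij: "bij_betw \<theta> (carrier B) (std_space n K)"
    and add: "\<forall>x\<in>carrier B. \<forall>y\<in>carrier B. \<theta> (x \<oplus>\<^bsub>B\<^esub> y) = \<theta> x + \<theta> y"
    using basis_coordinates[OF K1 assms(10)[unfolded RK]] by (elim exE conjE) (rule that)
  define V where "V = std_space n K"
  let ?i = "inv_into (carrier B) \<theta>"
  \<comment> \<open>\<beta> read through the inverse coordinates, with values as fractions over
    \<open>K\<close>.\<close>
  define c where "c x y = qfrac K (\<beta> (?i x) (?i y))" for x y
  have bil: "\<beta> x y \<in> {0..K - 1}" "\<beta> (x \<oplus>\<^bsub>B\<^esub> y) z = (\<beta> x z + \<beta> y z) mod K"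
    if "x \<in> carrier B" "y \<in> carrier B" "z \<in> carrier B" for x y z
    using assms(11) that unfolding bilinear_form_def RK residue_ring_simps by blast+
  have ti: "?i (\<theta> x) = x" if "x \<in> carrier B" for x using bij that by (simp add: bij_betw_def)
  have coord: "coordinates K B \<beta> V c \<theta>"
    unfolding coordinates_def V_def using bij add bil(1) by (simp add: c_def ti)
  note co = coordinatesD[OF coord]
  have ia: "?i (x + y) = ?i x \<oplus>\<^bsub>B\<^esub> ?i y" if "x \<in> V" "y \<in> V" for x y
    using co(5)[of "?i x \<oplus>\<^bsub>B\<^esub> ?i y"] co(6)[of "?i x" "?i y"] co(3,4) that by simp
  interpret std: form_space "int p" k V "std_b n K" unfolding V_def K_def by (rule std_form_space) simp
  have nondeg: "x = 0" if x: "x \<in> V" and *: "\<And>y. y \<in> V \<Longrightarrow> c x y = 0" for x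
  proof -
    have "\<beta> (?i x) z = 0" if z: "z \<in> carrier B" for z
    proof -
      have "qfrac K (\<beta> (?i x) z) = 0" using *[OF co(2)[OF z]] by (simp add: c_def ti[OF z])
      then have "K dvd \<beta> (?i x) z" using qfrac_eq_0_iff[OF K0] by blast
      moreover have "\<beta> (?i x) z \<in> {0..K - 1}" using bil(1)[OF co(3)[OF x] z z] .
      ultimately show ?thesis using zdvd_not_zless[of "\<beta> (?i x) z" K] by fastforce
    qed
    then have "?i x = \<zero>\<^bsub>B\<^esub>"
      using assms(13) co(3)[OF x] unfolding nondegenerate_form_def RK residue_ring_simps by blast
    then have "\<theta> (?i x) = 0" using coordinates_zero_iff[OF coord mod co(3)[OF x]] by blast
    then show "x = 0" using co(4)[OF x] by simp
  qed
  interpret bf: bform "int p" k V c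
  proof
    show "c (x + y) z = c x z + c y z" if "x \<in> V" "y \<in> V" "z \<in> V" for x y z
      unfolding c_def ia[OF that(1,2)] bil(2)[OF co(3)[OF that(1)] co(3)[OF that(2)] co(3)[OF that(3)]]
      by (simp only: qfrac_mod[OF K0] qfrac_add)
    show "c x y = c y x" if "x \<in> V" "y \<in> V" for x y
    proof -
      have "\<beta> (?i x) (?i y) = \<beta> (?i y) (?i x)"
        using assms(12) co(3)[OF that(1)] co(3)[OF that(2)] unfolding symmetric_form_def by blast
      then show ?thesis by (simp only: c_def)
    qed
  qed (use std.finite_V std.zero_V std.add_V std.torsion in auto)
  have fs: "form_space (int p) k V c"
  proof
    fix x assume x: "x \<in> V" and *: "\<And>y. y \<in> V \<Longrightarrow> (int p ^ (k - 1)) *z c x y = 0"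
    \<comment> \<open>The scalar moves into the first argument of \<open>c\<close>, so nondegeneracy
      kills this multiple of \<open>x\<close>; divisibility by \<open>p\<close> then holds in the
      free coordinate space.\<close>
    have "(int p ^ (k - 1)) *z x = 0"
      by (rule nondeg) (use x * bf.scale_V bf.b_scale_left in auto)
    then show "\<exists>y\<in>V. x = int p *z y"
      using std_space_divisible[of x n] x unfolding V_def K_def by blast
  qed (rule nondeg)
  obtain us where us: "diag (int p) k c V us" using diag_exists[OF fs] by blast
  have dstd: "diag (int p) k (std_b n K) V (replicate n 1)" unfolding V_def K_def by (rule std_diag) simp
  have "int p ^ (k * length us) = int p ^ (k * n)"
    using diag_card[OF us bf.bform_axioms] diag_card[OF dstd std.bform_axioms] by simp
  then have len: "length us = n" using p_gt_2 assms(7) by (simp add: power_inject_exp)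
  have units: "chi (prod_list us) = 1 \<or> chi (prod_list us) = - 1"
    using chi_disc_unit[OF diag_units[OF us], of 0] by simp
  \<comment> \<open>The standard form has diagonal 1, ..., 1, so by the classification being
    standard means discriminant class 1.\<close>
  have standard: "is_standard_form R n B \<beta> \<longleftrightarrow> chi (prod_list us) = 1"
  proof -
    interpret residues K "residue_ring K" using K1 by unfold_locales
    note fc = func_space_coordinates[OF K1, of n]
    have fm: "module (residue_ring K) (func_space {..<n})" by (rule func_space_is_module)
    show ?thesis
    proof
      assume "is_standard_form R n B \<beta>"
      then obtain f where "is_isometry (residue_ring K) B \<beta> (func_space {..<n}) (std_form (residue_ring K) n) f"
        unfolding is_standard_form_def RK by blast
      from isometry_to_isom[OF coord mod fc this]
      have "diag (int p) k (std_b n K) V us" unfolding V_def[symmetric] by (rule diag_isom[OF us bf.bform_axioms])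
      then have "chi (prod_list us) = chi (prod_list (replicate n 1))" using std.diag_unique(2) dstd by blast
      then show "chi (prod_list us) = 1" by simp
    next
      assume "chi (prod_list us) = 1"
      then obtain F where F: "isom V c V (std_b n K) F"
        using isom_exists[OF fs std.form_space_axioms us dstd] len by auto
      have "is_isometry (residue_ring K) B \<beta> (func_space {..<n}) (std_form (residue_ring K) n)
          (\<lambda>x. inv_into (carrier (func_space {..<n})) (\<lambda>x i. if i < n then qfrac K (x i) else 0) (F (\<theta> x)))"
        by (rule isom_to_isometry[OF K1 coord mod fc[folded V_def] fm F]) (rule refl)
      then show "is_standard_form R n B \<beta>" unfolding is_standard_form_def RK by blast
    qed
  qed
  \<comment> \<open>In even rank the index is the discriminant sign of the counting formula:
    \<epsilon>_1 is the class, \<epsilon>_2 is \<open>chi (- 1) ^ (n div 2)\<close>. The conditions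
    on the index occur only in even rank.\<close>
  have index: "form_index p k n B \<beta> = chi (- 1) ^ (length us div 2) * chi (prod_list us)" if "even n"
  proof -
    define N where "N = n div 2"
    have N: "n = 2 * N" using that by (simp add: N_def)
    have st: "(if is_standard_form R n B \<beta> then 1 else - 1) = chi (prod_list us)"
      using standard units by auto
    have "(if p mod 4 = 3 \<and> n mod 4 = 2 then - 1 else 1) = chi (- 1) ^ N"
    proof -
      have "n mod 4 = 2 \<longleftrightarrow> odd N" unfolding N by presburger
      then show ?thesis using chi_minus_one by (cases "p mod 4 = 3") auto
    qed
    moreover have "length us div 2 = N" using len N by simp
    ultimately show ?thesis using st unfolding form_index_def R_def by simp
  qed
  have r': "r' = r - s" using assms(15) by simp
  note iff = tp.order_auto_iff[OF assms(7,9) fs us, unfolded len, folded assms(14), folded r']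
  have ord: "group.ord (isometry_group R B \<beta>) g = q ^ r \<longleftrightarrow>
    (\<forall>x\<in>carrier B. (g ^^ (q ^ r)) x = x) \<and> \<not> (\<forall>x\<in>carrier B. (g ^^ (q ^ (r - 1))) x = x)"
    if "g \<in> carrier (isometry_group R B \<beta>)" for g
    unfolding RK by (rule isometry_ord_iff[OF mod that[unfolded RK] assms(4,9)])
  have not_fixed: "\<not> (\<forall>x\<in>V. (G ^^ j) x = x) \<longleftrightarrow> (\<exists>x\<in>V. (G ^^ j) x \<noteq> x)" for G :: "(nat \<Rightarrow> qz) \<Rightarrow> nat \<Rightarrow> qz" and j
    by blast
  have order: "(\<exists>g\<in>carrier (isometry_group R B \<beta>). group.ord (isometry_group R B \<beta>) g = q ^ r) \<longleftrightarrow>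
      (\<exists>G. tp.order_auto V c G r)" (is "?L1 \<longleftrightarrow> ?R1")
  proof -
    have "?L1 \<longleftrightarrow> (\<exists>g\<in>carrier (isometry_group R B \<beta>).
        (\<forall>x\<in>carrier B. (g ^^ (q ^ r)) x = x) \<and> \<not> (\<forall>x\<in>carrier B. (g ^^ (q ^ (r - 1))) x = x))"
      by (rule bex_cong[OF refl]) (rule ord)
    also have "\<dots> \<longleftrightarrow> ?R1" unfolding RK tp.order_auto_def not_fixed[symmetric]
      by (rule isometry_group_iff[OF K1 coord mod, of "\<lambda>per fix. per (q ^ r) \<and> \<not> per (q ^ (r - 1))"])
    finally show ?thesis .
  qed
  have order_fpf: "(\<exists>g\<in>carrier (isometry_group R B \<beta>). group.ord (isometry_group R B \<beta>) g = q ^ r \<and>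
      (\<forall>x\<in>carrier B. g x = x \<longrightarrow> x = \<zero>\<^bsub>B\<^esub>)) \<longleftrightarrow> (\<exists>G. tp.order_auto V c G r \<and> tp.fixed_point_free V G)"
    (is "?L2 \<longleftrightarrow> ?R2")
  proof -
    have "?L2 \<longleftrightarrow> (\<exists>g\<in>carrier (isometry_group R B \<beta>).
        ((\<forall>x\<in>carrier B. (g ^^ (q ^ r)) x = x) \<and> \<not> (\<forall>x\<in>carrier B. (g ^^ (q ^ (r - 1))) x = x)) \<and>
        (\<forall>x\<in>carrier B. g x = x \<longrightarrow> x = \<zero>\<^bsub>B\<^esub>))"
      by (rule bex_cong[OF refl], rule conj_cong, rule ord) (assumption, rule refl)
    also have "\<dots> \<longleftrightarrow> ?R2" unfolding RK tp.order_auto_def tp.fixed_point_free_def not_fixed[symmetric] conj_assoc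
      by (rule isometry_group_iff[OF K1 coord mod, of "\<lambda>per fix. per (q ^ r) \<and> \<not> per (q ^ (r - 1)) \<and> fix", unfolded conj_assoc])
    finally show ?thesis .
  qed
  have disc: "chi (- 1) ^ (n div 2) * chi (prod_list us) = form_index p k n B \<beta>" if "n = 2 * min_exp q p * d" for d
    using index[unfolded len] that by simp
  show ?thesis
  proof (rule conjI)
    show "(\<exists>g\<in>carrier (isometry_group R B \<beta>). group.ord (isometry_group R B \<beta>) g = q ^ r) \<longleftrightarrow>
        n \<ge> 2 * min_exp q p * q ^ r' + 1 \<or>
        (n = 2 * min_exp q p * q ^ r' \<and> form_index p k n B \<beta> = eta q p)"
      unfolding order iff(1)
    proof (cases "n = 2 * min_exp q p * q ^ r'")
      case True
      show "n \<ge> 2 * min_exp q p * q ^ r' + 1 \<or>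
          (n = 2 * min_exp q p * q ^ r' \<and> chi (- 1) ^ (n div 2) * chi (prod_list us) = eta q p) \<longleftrightarrow>
        n \<ge> 2 * min_exp q p * q ^ r' + 1 \<or>
          (n = 2 * min_exp q p * q ^ r' \<and> form_index p k n B \<beta> = eta q p)"
        unfolding disc[OF True] by (rule refl)
    qed simp
    show "(\<exists>g\<in>carrier (isometry_group R B \<beta>). group.ord (isometry_group R B \<beta>) g = q ^ r \<and>
        (\<forall>x\<in>carrier B. g x = x \<longrightarrow> x = \<zero>\<^bsub>B\<^esub>)) \<longleftrightarrow>
        (\<exists>d. n = 2 * min_exp q p * d \<and> d \<ge> q ^ r' \<and> form_index p k n B \<beta> = eta q p ^ d)"
      unfolding order_fpf iff(2)
    proof (rule ex_cong1)
      fix d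
      show "n = 2 * min_exp q p * d \<and> d \<ge> q ^ r' \<and> chi (- 1) ^ (n div 2) * chi (prod_list us) = eta q p ^ d \<longleftrightarrow>
        n = 2 * min_exp q p * d \<and> d \<ge> q ^ r' \<and> form_index p k n B \<beta> = eta q p ^ d"
      proof (cases "n = 2 * min_exp q p * d")
        case True
        show ?thesis unfolding disc[OF True] by (rule refl)
      qed simp
    qed
  qed
qed

end
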